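(* If $G$ is an Abelian, countably infinite, precompact topological group, then $G$ does not have property (T).
   Context: All topological groups are assumed Hausdorff. A topological group $G$ is precompact if it is isomorphic, as a topological group, to a subgroup of a compact group. A unitary representation of $G$ is a continuous homomorphism $\rho:G\to U(\mathcal H)$, where $\mathcal H$ is a complex Hilbert space and the unitary group $U(\mathcal H)$ carries the strong operator topology. $1_G$ is the class of the trivial one-dimensional representation. For a unitary representation $\rho$ of $G$ on $\mathcal H$, $P_\rho'$ is the set of functions $g\mapsto(\rho(g)v,v)$ on $G$ with $v\in\mathcal H$, and $P_\rho$ is the set of finite sums of elements of $P_\rho'$; these depend only on the equivalence class $[\rho]$. Fell topology on a set $\mathcal R$ of equivalence classes of (not necessarily irreducible) unitary representations of $G$: the basic neighborhoods of $[\rho]\in\mathcal R$ are the sets $$W(f_1,\dots,f_n,C,\epsilon)=\{[\sigma]\in\mathcal R:\ \exists g_1,\dots,g_n\in P_\sigma\ \ \forall x\in C\ \ \forall i\ \ |f_i(x)-g_i(x)|<\epsilon\},$$ where $f_1,\dots,f_n\in P_\rho$, $C$ is a compact subset of $G$ and $\epsilon>0$. $G$ has property (T) if $1_G$ is isolated in $\mathcal R\cup\{1_G\}$ (with the Fell topology) for every set $\mathcal R$ of equivalence classes of unitary representations of $G$ without non-zero invariant vectors. Equivalently, there are a compact subset $Q\subseteq G$ and $\epsilon>0$ (a Kazhdan pair) such that every unitary representation $\pi$ of $G$ having a unit vector $v$ with $\|\pi(g)v-v\|<\epsilon$ for all $g\in Q$ has a non-zero invariant vector. *)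

theory Defs
  imports "HOL-Analysis.Analysis" "HOL-Algebra.Algebra" "HOL-Algebra.Algebraic_Closure_Type"
begin

section \<open>Topological groups\<close>

locale topological_group = group G
  for G :: "('a, 'b) monoid_scheme" (structure) and T :: "'a topology" +
  assumes topspace_eq: "topspace T = carrier G"
    and Hausdorff: "Hausdorff_space T"
    and continuous_mult: "continuous_map (prod_topology T T) T (\<lambda>(x, y). x \<otimes> y)"
    and continuous_inv: "continuous_map T T (\<lambda>x. inv x)"

text \<open>The ambient compact group lives on the type \<open>'k\<close>. As a premise of a theorem in which \<open>'k\<close>
  is an otherwise unconstrained type variable, this says that such a group exists on some type.\<close>

definition precompact_group ::
    "'k itself \<Rightarrow> ('g, 'b) monoid_scheme \<Rightarrow> 'g topology \<Rightarrow> bool" where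
  "precompact_group TYPE('k) G T \<longleftrightarrow>
     (\<exists>(K :: 'k monoid) S L \<phi>. topological_group K S \<and> compact_space S \<and> subgroup L K \<and>
        \<phi> \<in> iso G (K\<lparr>carrier := L\<rparr>) \<and> homeomorphic_map T (subtopology S L) \<phi>)"


section \<open>Complex Hilbert spaces\<close>

text \<open>The record type of modules extends that of rings; the multiplicative fields \<open>mult\<close> and
  \<open>one\<close> of the vector space are unused.\<close>

record 'h inner_space = "(complex, 'h) Module.module" +
  hinner :: "'h \<Rightarrow> 'h \<Rightarrow> complex"

definition hnorm :: "('h, 'b) inner_space_scheme \<Rightarrow> 'h \<Rightarrow> real" where
  "hnorm H x = sqrt (Re (hinner H x x))"

text \<open>The value outside the carrier is fixed because \<^locale>\<open>Metric_space\<close> asks for nonnegativity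
  and symmetry on the whole type.\<close>

definition hdist :: "('h, 'b) inner_space_scheme \<Rightarrow> 'h \<Rightarrow> 'h \<Rightarrow> real" where
  "hdist H x y = (if x \<in> carrier H \<and> y \<in> carrier H then hnorm H (x \<ominus>\<^bsub>H\<^esub> y) else 0)"

locale complex_inner_space =
  Module.module "ring_of_type_algebra :: complex ring" H
  for H :: "('h, 'b) inner_space_scheme" (structure) +
  assumes inner_add_left: "\<lbrakk>x \<in> carrier H; y \<in> carrier H; z \<in> carrier H\<rbrakk> \<Longrightarrow>
      hinner H (x \<oplus> y) z = hinner H x z + hinner H y z"
    and inner_smult_left: "\<lbrakk>x \<in> carrier H; y \<in> carrier H\<rbrakk> \<Longrightarrow>
      hinner H (c \<odot> x) y = c * hinner H x y"
    and inner_commute: "\<lbrakk>x \<in> carrier H; y \<in> carrier H\<rbrakk> \<Longrightarrow> hinner H y x = cnj (hinner H x y)"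
    and inner_ge_zero: "x \<in> carrier H \<Longrightarrow> 0 \<le> Re (hinner H x x)"
    and inner_eq_zero: "\<lbrakk>x \<in> carrier H; hinner H x x = 0\<rbrakk> \<Longrightarrow> x = \<zero>"

locale complex_hilbert_space = complex_inner_space +
  assumes complete: "Metric_space.mcomplete (carrier H) (hdist H)"

context complex_inner_space
begin

lemma carrier_C [simp]: "c \<in> carrier (ring_of_type_algebra :: complex ring)"
  by (simp add: ring_of_type_algebra_def)

lemma inner_add_right:
  "\<lbrakk>x \<in> carrier H; y \<in> carrier H; z \<in> carrier H\<rbrakk> \<Longrightarrow>
    hinner H z (x \<oplus> y) = hinner H z x + hinner H z y"
  by (metis M.a_closed complex_cnj_add inner_add_left inner_commute)

lemma inner_smult_right:
  "\<lbrakk>x \<in> carrier H; y \<in> carrier H\<rbrakk> \<Longrightarrow> hinner H y (c \<odot> x) = cnj c * hinner H y x"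
  by (metis carrier_C complex_cnj_mult inner_commute inner_smult_left smult_closed)

lemma inner_zero_left: "y \<in> carrier H \<Longrightarrow> hinner H \<zero> y = 0"
  using inner_add_left[of \<zero> \<zero> y] by simp

lemma inner_minus_left:
  "\<lbrakk>x \<in> carrier H; y \<in> carrier H\<rbrakk> \<Longrightarrow> hinner H (\<ominus> x) y = - hinner H x y"
  using inner_add_left[of x "\<ominus> x" y] inner_zero_left[of y]
  by (simp add: M.r_neg eq_neg_iff_add_eq_0 add.commute)

lemma inner_self: "x \<in> carrier H \<Longrightarrow> hinner H x x = complex_of_real ((hnorm H x)\<^sup>2)"
proof -
  assume x: "x \<in> carrier H"
  have "Im (hinner H x x) = 0" using inner_commute[OF x x] by (simp add: complex_eq_iff)
  then show ?thesis using inner_ge_zero[OF x] by (simp add: hnorm_def complex_eq_iff)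
qed

lemma hnorm_nonneg: "x \<in> carrier H \<Longrightarrow> 0 \<le> hnorm H x"
  by (simp add: hnorm_def inner_ge_zero)

lemma Cauchy_Schwarz:
  assumes x: "x \<in> carrier H" and y: "y \<in> carrier H"
  shows "cmod (hinner H x y) \<le> hnorm H x * hnorm H y"
proof (cases "hnorm H y = 0")
  case True
  then have "y = \<zero>" using inner_self[OF y] inner_eq_zero[OF y] by simp
  then have "hinner H x y = 0" using inner_zero_left[OF x] inner_commute[OF y x] by simp
  with True show ?thesis by simp
next
  case False
  then have pos: "0 < hnorm H y" using hnorm_nonneg[OF y] by simp
  define n where "n = (hnorm H y)\<^sup>2"
  define a where "a = hinner H x y"
  have n: "0 < n" using pos by (simp add: n_def)
  have yy: "hinner H y y = of_real n" using inner_self[OF y] by (simp add: n_def)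
  have xx: "hinner H x x = of_real ((hnorm H x)\<^sup>2)" by (rule inner_self[OF x])
  have yx: "hinner H y x = cnj a" using inner_commute[OF x y] by (simp add: a_def)
  let ?z = "(of_real n \<odot> x) \<oplus> ((- a) \<odot> y)"
  have cl: "of_real n \<odot> x \<in> carrier H" "(- a) \<odot> y \<in> carrier H" using x y by auto
  have "hinner H ?z ?z = of_real n * (of_real n * hinner H x x - a * cnj a)"
    using x y cl by (simp add: inner_add_left inner_add_right inner_smult_left inner_smult_right
        yy yx a_def[symmetric] algebra_simps)
  also have "\<dots> = of_real (n * (n * (hnorm H x)\<^sup>2 - (cmod a)\<^sup>2))"
    by (simp add: xx complex_norm_square[symmetric])
  finally have "0 \<le> n * (n * (hnorm H x)\<^sup>2 - (cmod a)\<^sup>2)"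
    using inner_ge_zero[of ?z] cl by simp
  then have "(cmod a)\<^sup>2 \<le> (hnorm H x * hnorm H y)\<^sup>2"
    using n by (simp add: zero_le_mult_iff n_def power_mult_distrib mult.commute)
  then show ?thesis
    unfolding a_def by (rule power2_le_imp_le) (use hnorm_nonneg[OF x] hnorm_nonneg[OF y] in simp)
qed

lemma hnorm_triangle:
  assumes x: "x \<in> carrier H" and y: "y \<in> carrier H"
  shows "hnorm H (x \<oplus> y) \<le> hnorm H x + hnorm H y"
proof -
  have "(hnorm H (x \<oplus> y))\<^sup>2 = Re (hinner H (x \<oplus> y) (x \<oplus> y))"
    using inner_self[of "x \<oplus> y"] x y by simp
  also have "\<dots> = Re (hinner H x x) + Re (hinner H y y) + 2 * Re (hinner H x y)"
    using x y inner_commute[OF x y] by (simp add: inner_add_left inner_add_right)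
  also have "\<dots> \<le> (hnorm H x)\<^sup>2 + (hnorm H y)\<^sup>2 + 2 * (hnorm H x * hnorm H y)"
    using Cauchy_Schwarz[OF x y] complex_Re_le_cmod[of "hinner H x y"]
      inner_self[OF x] inner_self[OF y] by simp
  also have "\<dots> = (hnorm H x + hnorm H y)\<^sup>2" by (simp add: power2_sum)
  finally show ?thesis
    by (rule power2_le_imp_le) (use hnorm_nonneg[OF x] hnorm_nonneg[OF y] in simp)
qed

lemma Metric_space_hdist: "Metric_space (carrier H) (hdist H)"
proof
  fix x y
  show "0 \<le> hdist H x y" by (simp add: hdist_def hnorm_nonneg)
  show "hdist H x y = hdist H y x"
  proof (cases "x \<in> carrier H \<and> y \<in> carrier H")
    case True
    then have "y \<ominus> x = \<ominus> (x \<ominus> y)" by (simp add: a_minus_def M.minus_add M.a_comm)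
    then have "hinner H (y \<ominus> x) (y \<ominus> x) = hinner H (x \<ominus> y) (x \<ominus> y)"
      using True inner_minus_left inner_commute
      by (metis M.a_inv_closed M.minus_closed M.minus_minus complex_cnj_minus minus_minus)
    then show ?thesis using True by (simp add: hdist_def hnorm_def)
  qed (auto simp: hdist_def)
next
  fix x y assume xy: "x \<in> carrier H" "y \<in> carrier H"
  have "hnorm H (x \<ominus> y) = 0 \<longleftrightarrow> x \<ominus> y = \<zero>"
  proof
    assume "hnorm H (x \<ominus> y) = 0"
    then show "x \<ominus> y = \<zero>"
      using inner_eq_zero inner_self M.minus_closed xy by (metis of_real_0 zero_power2)
  next
    assume "x \<ominus> y = \<zero>"
    then show "hnorm H (x \<ominus> y) = 0" by (simp only: hnorm_def inner_zero_left[OF M.zero_closed]) simp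
  qed
  also have "\<dots> \<longleftrightarrow> x = y" 
  proof
    assume "x \<ominus> y = \<zero>"
    then have "x = \<ominus> (\<ominus> y)"
      using xy M.minus_equality[of x "\<ominus> y"] by (simp add: a_minus_def)
    then show "x = y" using xy by simp
  qed (use xy in \<open>simp add: a_minus_def M.r_neg\<close>)
  finally show "hdist H x y = 0 \<longleftrightarrow> x = y" using xy by (simp add: hdist_def)
next
  fix x y z assume xyz: "x \<in> carrier H" "y \<in> carrier H" "z \<in> carrier H"
  have "(x \<ominus> y) \<oplus> (y \<ominus> z) = x \<oplus> ((\<ominus> y \<oplus> y) \<oplus> \<ominus> z)"
    using xyz by (simp add: a_minus_def M.a_assoc)
  then have "(x \<ominus> y) \<oplus> (y \<ominus> z) = x \<ominus> z"
    using xyz by (simp add: a_minus_def M.l_neg)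
  then show "hdist H x z \<le> hdist H x y + hdist H y z"
    using hnorm_triangle[of "x \<ominus> y" "y \<ominus> z"] xyz by (simp add: hdist_def)
qed

end


section \<open>Unitary representations\<close>

definition unitary_maps ::
    "('h, 'b) inner_space_scheme \<Rightarrow> ('k, 'c) inner_space_scheme \<Rightarrow> ('h \<Rightarrow> 'k) set" where
  "unitary_maps H K = {U \<in> extensional (carrier H). bij_betw U (carrier H) (carrier K) \<and>
     (\<forall>x\<in>carrier H. \<forall>y\<in>carrier H. U (x \<oplus>\<^bsub>H\<^esub> y) = U x \<oplus>\<^bsub>K\<^esub> U y) \<and>
     (\<forall>c. \<forall>x\<in>carrier H. U (c \<odot>\<^bsub>H\<^esub> x) = c \<odot>\<^bsub>K\<^esub> U x) \<and>
     (\<forall>x\<in>carrier H. \<forall>y\<in>carrier H. hinner K (U x) (U y) = hinner H x y)}"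

definition unitary_group :: "('h, 'b) inner_space_scheme \<Rightarrow> ('h \<Rightarrow> 'h) monoid" where
  "unitary_group H = \<lparr>carrier = unitary_maps H H,
     mult = (\<lambda>U V. compose (carrier H) U V), one = (\<lambda>x\<in>carrier H. x)\<rparr>"

text \<open>The strong operator topology is the topology of pointwise convergence with respect to the
  norm.\<close>

definition unitary_sot :: "('h, 'b) inner_space_scheme \<Rightarrow> ('h \<Rightarrow> 'h) topology" where
  "unitary_sot H = subtopology
     (product_topology (\<lambda>_. Metric_space.mtopology (carrier H) (hdist H)) (carrier H))
     (unitary_maps H H)"

type_synonym ('g, 'h) rep = "'h inner_space \<times> ('g \<Rightarrow> 'h \<Rightarrow> 'h)"

definition unitary_reps ::
    "('g, 'b) monoid_scheme \<Rightarrow> 'g topology \<Rightarrow> ('g, 'h) rep set" where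
  "unitary_reps G T = {(H, \<rho>). complex_hilbert_space H \<and> \<rho> \<in> hom G (unitary_group H) \<and>
     continuous_map T (unitary_sot H) \<rho>}"

definition rep_equiv ::
    "('g, 'b) monoid_scheme \<Rightarrow> 'g topology \<Rightarrow> (('g, 'h) rep \<times> ('g, 'h) rep) set" where
  "rep_equiv G T = {((H, \<rho>), (K, \<sigma>)). (H, \<rho>) \<in> unitary_reps G T \<and> (K, \<sigma>) \<in> unitary_reps G T \<and>
     (\<exists>U\<in>unitary_maps H K. \<forall>g\<in>carrier G. \<forall>v\<in>carrier H. U (\<rho> g v) = \<sigma> g (U v))}"

definition rep_classes ::
    "('g, 'b) monoid_scheme \<Rightarrow> 'g topology \<Rightarrow> ('g, 'h) rep set set" where
  "rep_classes G T = unitary_reps G T // rep_equiv G T"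

definition trivial_class :: "('g, 'b) monoid_scheme \<Rightarrow> 'g topology \<Rightarrow> ('g, 'h) rep set" where
  "trivial_class G T = {(H, \<rho>) \<in> unitary_reps G T.
     (\<exists>e\<in>carrier H. e \<noteq> \<zero>\<^bsub>H\<^esub> \<and> carrier H = range (\<lambda>c. c \<odot>\<^bsub>H\<^esub> e)) \<and>
     (\<forall>g\<in>carrier G. \<forall>v\<in>carrier H. \<rho> g v = v)}"

fun has_invariant_vector :: "('g, 'b) monoid_scheme \<Rightarrow> ('g, 'h) rep \<Rightarrow> bool" where
  "has_invariant_vector G (H, \<rho>) \<longleftrightarrow>
     (\<exists>v\<in>carrier H. v \<noteq> \<zero>\<^bsub>H\<^esub> \<and> (\<forall>g\<in>carrier G. \<rho> g v = v))"


section \<open>The Fell topology and property (T)\<close>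

fun matrix_coeffs :: "('g, 'b) monoid_scheme \<Rightarrow> ('g, 'h) rep \<Rightarrow> ('g \<Rightarrow> complex) set" where
  "matrix_coeffs G (H, \<rho>) = {\<lambda>g\<in>carrier G. hinner H (\<rho> g v) v | v. v \<in> carrier H}"

definition matrix_coeff_sums :: "('g, 'b) monoid_scheme \<Rightarrow> ('g, 'h) rep \<Rightarrow> ('g \<Rightarrow> complex) set" where
  "matrix_coeff_sums G r = {\<lambda>g\<in>carrier G. \<Sum>i<n. f i g | (n :: nat) f. \<forall>i<n. f i \<in> matrix_coeffs G r}"

text \<open>Equivalent representations have the same \<^const>\<open>matrix_coeff_sums\<close>, so the union below is the common
  value on the members of the class.\<close>

definition class_coeff_sums ::
    "('g, 'b) monoid_scheme \<Rightarrow> ('g, 'h) rep set \<Rightarrow> ('g \<Rightarrow> complex) set" where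
  "class_coeff_sums G c = (\<Union>r\<in>c. matrix_coeff_sums G r)"

definition fell_nbhd ::
    "('g, 'b) monoid_scheme \<Rightarrow> ('g, 'h) rep set set \<Rightarrow> nat \<Rightarrow> (nat \<Rightarrow> 'g \<Rightarrow> complex) \<Rightarrow> 'g set
      \<Rightarrow> real \<Rightarrow> ('g, 'h) rep set set" where
  "fell_nbhd G R n f C \<epsilon> = {s \<in> R. \<exists>g. (\<forall>i<n. g i \<in> class_coeff_sums G s) \<and>
     (\<forall>x\<in>C. \<forall>i<n. cmod (f i x - g i x) < \<epsilon>)}"

definition fell_open ::
    "('g, 'b) monoid_scheme \<Rightarrow> 'g topology \<Rightarrow> ('g, 'h) rep set set \<Rightarrow> ('g, 'h) rep set set
      \<Rightarrow> bool" where
  "fell_open G T R U \<longleftrightarrow> U \<subseteq> R \<and> (\<forall>r\<in>U. \<exists>n f C \<epsilon>. (\<forall>i<n. f i \<in> class_coeff_sums G r) \<and>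
     compactin T C \<and> 0 < \<epsilon> \<and> fell_nbhd G R n f C \<epsilon> \<subseteq> U)"

definition fell_topology ::
    "('g, 'b) monoid_scheme \<Rightarrow> 'g topology \<Rightarrow> ('g, 'h) rep set set \<Rightarrow> ('g, 'h) rep set topology"
    where
  "fell_topology G T R = topology (fell_open G T R)"

lemma istopology_fell_open: "istopology (fell_open G T R)"
  unfolding istopology_def
proof (intro conjI allI impI)
  fix U V assume U: "fell_open G T R U" and V: "fell_open G T R V"
  show "fell_open G T R (U \<inter> V)"
    unfolding fell_open_def
  proof (intro conjI ballI)
    show "U \<inter> V \<subseteq> R" using U by (auto simp: fell_open_def)
    fix r assume r: "r \<in> U \<inter> V"
    obtain n f C \<epsilon> where 1: "\<forall>i<n. f i \<in> class_coeff_sums G r" "compactin T C" "0 < \<epsilon>"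
        "fell_nbhd G R n f C \<epsilon> \<subseteq> U"
      using U r unfolding fell_open_def by blast
    obtain m h D \<delta> where 2: "\<forall>i<m. h i \<in> class_coeff_sums G r" "compactin T D" "0 < \<delta>"
        "fell_nbhd G R m h D \<delta> \<subseteq> V"
      using V r unfolding fell_open_def by blast
    define k where "k i = (if i < n then f i else h (i - n))" for i
    have "\<forall>i<n + m. k i \<in> class_coeff_sums G r"
      using 1(1) 2(1) by (auto simp: k_def)
    moreover have "compactin T (C \<union> D)" using 1 2 by (simp add: compactin_Un)
    moreover have "0 < min \<epsilon> \<delta>" using 1 2 by simp
    moreover have "fell_nbhd G R (n + m) k (C \<union> D) (min \<epsilon> \<delta>) \<subseteq> U \<inter> V"
    proof
      fix s assume "s \<in> fell_nbhd G R (n + m) k (C \<union> D) (min \<epsilon> \<delta>)"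
      then obtain g where s: "s \<in> R" and g: "\<forall>i<n + m. g i \<in> class_coeff_sums G s"
          "\<forall>x\<in>C \<union> D. \<forall>i<n + m. cmod (k i x - g i x) < min \<epsilon> \<delta>"
        unfolding fell_nbhd_def by blast
      have "\<forall>x\<in>C. \<forall>i<n. cmod (f i x - g i x) < \<epsilon>"
      proof (intro ballI allI impI)
        fix x i assume "x \<in> C" "i < n"
        then show "cmod (f i x - g i x) < \<epsilon>" using g(2)[rule_format, of x i] by (simp add: k_def)
      qed
      with s g(1) have "s \<in> fell_nbhd G R n f C \<epsilon>"
        unfolding fell_nbhd_def by (auto intro!: exI[of _ g])
      moreover have "\<forall>x\<in>D. \<forall>i<m. cmod (h i x - g (n + i) x) < \<delta>"
      proof (intro ballI allI impI)
        fix x i assume "x \<in> D" "i < m"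
        then show "cmod (h i x - g (n + i) x) < \<delta>"
          using g(2)[rule_format, of x "n + i"] by (simp add: k_def)
      qed
      with s g(1) have "s \<in> fell_nbhd G R m h D \<delta>"
        unfolding fell_nbhd_def by (auto intro!: exI[of _ "\<lambda>i. g (n + i)"])
      ultimately show "s \<in> U \<inter> V" using 1 2 by blast
    qed
    ultimately show "\<exists>n f C \<epsilon>. (\<forall>i<n. f i \<in> class_coeff_sums G r) \<and> compactin T C \<and> 0 < \<epsilon> \<and>
        fell_nbhd G R n f C \<epsilon> \<subseteq> U \<inter> V"
      by blast
  qed
next
  fix \<U> assume \<U>: "\<forall>U\<in>\<U>. fell_open G T R U"
  show "fell_open G T R (\<Union>\<U>)"
    unfolding fell_open_def
  proof (intro conjI ballI)
    show "\<Union>\<U> \<subseteq> R" using \<U> by (auto simp: fell_open_def)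
    fix r assume "r \<in> \<Union>\<U>"
    then obtain U where U: "U \<in> \<U>" "r \<in> U" by blast
    with \<U> have "fell_open G T R U" by blast
    with U(2) obtain n f C \<epsilon> where "\<forall>i<n. f i \<in> class_coeff_sums G r" "compactin T C" "0 < \<epsilon>"
        "fell_nbhd G R n f C \<epsilon> \<subseteq> U"
      unfolding fell_open_def by blast
    moreover have "U \<subseteq> \<Union>\<U>" using U by blast
    ultimately show "\<exists>n f C \<epsilon>. (\<forall>i<n. f i \<in> class_coeff_sums G r) \<and> compactin T C \<and> 0 < \<epsilon> \<and>
        fell_nbhd G R n f C \<epsilon> \<subseteq> \<Union>\<U>"
      by (meson order_trans)
  qed
qed

lemma openin_fell_topology: "openin (fell_topology G T R) U \<longleftrightarrow> fell_open G T R U"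
  by (simp add: fell_topology_def istopology_fell_open)

text \<open>HOL cannot quantify over all Hilbert spaces at once, so the representation spaces range over
  the Hilbert spaces whose underlying set lies in the type \<open>'h\<close>, which has to be large enough for
  this to be property (T). For a countable group, cardinality at least the continuum suffices:
  \<open>'h\<close> then contains a copy of every separable Hilbert space, and a coefficient sum of a
  representation of a countable group already occurs in a separable subrepresentation, so
  that larger \<open>'h\<close> give the same notion. For \<open>'h\<close> below the continuum the zero space is the only
  Hilbert space and the predicate is degenerate.\<close>

definition property_T ::
    "'h itself \<Rightarrow> ('g, 'b) monoid_scheme \<Rightarrow> 'g topology \<Rightarrow> bool" where
  "property_T TYPE('h) G T \<longleftrightarrow>
     (\<forall>R :: ('g, 'h) rep set set. R \<subseteq> rep_classes G T \<longrightarrow>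
        (\<forall>c\<in>R. \<forall>r\<in>c. \<not> has_invariant_vector G r) \<longrightarrow>
        openin (fell_topology G T (insert (trivial_class G T) R)) {trivial_class G T})"

end

theory Submission
  imports Defs
begin

text \<open>Continuous characters of an infinite precompact Abelian group separate points, so there are
  infinitely many of them, and by the pigeonhole principle there are nontrivial ones arbitrarily
  close to \<open>1\<close> on any finite set. Compact subsets of a countable group are countable, hence
  scattered, and on such a set pointwise approximation of \<open>1\<close> improves to uniform approximation
  by convex combinations (a case of Mazur's lemma). A convex combination of nontrivial characters is
  a matrix coefficient of their direct sum, which has no invariant vectors, so the trivial
  representation is not isolated.

  The characters are obtained without Haar measure: if \<open>f\<close> is the restriction of a continuous
  function on the compact group and \<open>P\<close> the autocorrelation of a difference of two translates of
  \<open>f\<close>, then maximizing the average of \<open>\<phi> P\<close> over the normalized positive definite functions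
  \<open>\<phi>\<close> of the discrete group leads to an extreme point, that is, a character, which correlates
  with \<open>P\<close> and is therefore continuous.\<close>

section \<open>Invariant means\<close>

text \<open>Convex combinations cannot be avoided. In Q/Z with the topology of the circle, 0 and all
  1/k form a compact set, and the character x -> exp(2 pi i n x) with n \<noteq> 0 equals -1 at
  1/(2|n|), so no single nontrivial character is uniformly close to 1 there. Countability enters
  through Baire's theorem, which gives every nonempty closed subset of a compact set an isolated
  point.

  Characters are sought among all positive definite functions because these form a compact set,
  whereas continuity does not survive pointwise limits; it is recovered at the end from an estimate
  of |\<theta>(z) - 1| by the distance between \<open>f\<close> and its translate. The maximal
  correlation with \<open>P\<close> is positive because \<open>P\<close>, normalized, is itself a
  competitor, and averages of the square of a nonzero almost periodic function are bounded below.
  Extremality is enforced at finitely many points at a time, and the averages are finite and only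
  almost invariant; compactness removes both defects together.\<close>

lemma compact_bounded_functions:
  fixes b :: "'a \<Rightarrow> real"
  shows "compact {f :: 'a \<Rightarrow> 'b::{real_normed_vector,heine_borel}. \<forall>x. f x \<in> cball 0 (b x)}"
proof -
  have "compactin (product_topology (\<lambda>_. euclidean) UNIV) (PiE UNIV (\<lambda>x. cball (0::'b::{real_normed_vector,heine_borel}) (b x)))"
    unfolding compactin_PiE by simp
  moreover have "PiE UNIV (\<lambda>x. cball (0::'b) (b x)) = {f. \<forall>x. f x \<in> cball 0 (b x)}"
    by (auto simp: PiE_UNIV_domain)
  ultimately show ?thesis by (simp add: euclidean_product_topology del: mem_cball mem_cball_0)
qed

text \<open>Finite intersection property: finitely many of the closed sets involve finitely many
  conditions and a smallest tolerance. It plays the role of a limit of ever better approximations,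
  once for means and once for characters.\<close>

lemma compact_exists_all_tolerances:
  fixes Q :: "'i \<Rightarrow> real \<Rightarrow> 'x::topological_space \<Rightarrow> bool"
  assumes K: "compact K"
    and closed: "\<And>i e. i \<in> A \<Longrightarrow> closed {x. Q i e x}"
    and mono: "\<And>i e e' x. \<lbrakk>i \<in> A; e \<le> e'; Q i e x\<rbrakk> \<Longrightarrow> Q i e' x"
    and fin: "\<And>S e. \<lbrakk>finite S; S \<subseteq> A; 0 < e\<rbrakk> \<Longrightarrow> \<exists>x\<in>K. \<forall>i\<in>S. Q i e x"
  shows "\<exists>x\<in>K. \<forall>i\<in>A. \<forall>e>0. Q i e x"
proof -
  have "K \<inter> (\<Inter>(i, e)\<in>A \<times> {0<..}. {x. Q i e x}) \<noteq> {}"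
  proof (rule compact_imp_fip_image[OF K])
    fix I' assume I': "finite I'" "I' \<subseteq> A \<times> {0::real<..}"
    \<comment> \<open>The 1 keeps the minimum defined when \<open>I'\<close> is empty.\<close>
    define e where "e = Min (insert 1 (snd ` I'))"
    have "0 < e" using I' unfolding e_def by (subst Min_gr_iff) auto
    then obtain x where x: "x \<in> K" "\<forall>i\<in>fst ` I'. Q i e x"
      using fin[of "fst ` I'" e] I' by fastforce
    have "Q i d x" if "(i, d) \<in> I'" for i d
    proof -
      have "e \<le> d" using I' that unfolding e_def by (intro Min_le) (auto intro: rev_image_eqI)
      moreover have "Q i e x" using x(2) that by force
      ultimately show ?thesis using mono that I' by blast
    qed
    then have "x \<in> K \<inter> (\<Inter>(i, e)\<in>I'. {x. Q i e x})" using x(1) by auto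
    then show "K \<inter> (\<Inter>i\<in>I'. case i of (i, e) \<Rightarrow> {x. Q i e x}) \<noteq> {}" by blast
  qed (use closed in auto)
  then show ?thesis by fastforce
qed

lemma bounded_image_iff: "bounded (F ` A) \<longleftrightarrow> (\<exists>b. \<forall>x\<in>A. norm (F x) \<le> b)"
  by (simp add: bounded_iff)

lemma bounded_image_mult:
  fixes F H :: "'x \<Rightarrow> real"
  assumes "bounded (F ` A)" "bounded (H ` A)"
  shows "bounded ((\<lambda>x. F x * H x) ` A)"
proof -
  obtain b c where "\<forall>x\<in>A. norm (F x) \<le> b" "\<forall>x\<in>A. norm (H x) \<le> c"
    using assms unfolding bounded_image_iff by blast
  then have "norm (F x * H x) \<le> b * c" if "x \<in> A" for x
    unfolding norm_mult using that norm_ge_zero[of "F x"] norm_ge_zero[of "H x"]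
    by (intro mult_mono) (auto simp del: norm_ge_zero intro: order.trans)
  then show ?thesis unfolding bounded_image_iff by blast
qed

lemma bounded_image_sum:
  fixes F :: "nat \<Rightarrow> 'x \<Rightarrow> real"
  assumes "\<And>i. i < n \<Longrightarrow> bounded (F i ` A)"
  shows "bounded ((\<lambda>x. \<Sum>i<n. F i x) ` A)"
  using assms
proof (induction n)
  case (Suc n)
  then show ?case using bounded_plus_comp[of "\<lambda>x. \<Sum>i<n. F i x" A "F n"] by simp
qed (simp add: image_constant_conv)

text \<open>A sequence of points rather than a set, so that points may repeat: the products with
  powers of an element formed below need not be distinct.\<close>

definition finite_average :: "nat \<Rightarrow> (nat \<Rightarrow> 'g) \<Rightarrow> ('g \<Rightarrow> 'v) \<Rightarrow> 'v::real_normed_vector" where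
  "finite_average M p F = (\<Sum>i<M. F (p i)) /\<^sub>R real M"

lemma finite_average_norm_le:
  assumes "0 < M" "\<And>i. i < M \<Longrightarrow> norm (F (p i)) \<le> b"
  shows "norm (finite_average M p F) \<le> b"
proof -
  have "norm (\<Sum>i<M. F (p i)) \<le> (\<Sum>i<M. b)"
    by (rule order.trans[OF norm_sum sum_mono]) (use assms in auto)
  then show ?thesis using assms(1) by (simp add: finite_average_def field_simps)
qed

lemma finite_average_diff:
  "finite_average M p (\<lambda>x. F x - H x) = finite_average M p F - finite_average M p H"
  by (simp add: finite_average_def sum_subtractf scaleR_diff_right)

lemma finite_average_add:
  "finite_average M p (\<lambda>x. F x + H x) = finite_average M p F + finite_average M p H"
  by (simp add: finite_average_def sum.distrib scaleR_add_right)

lemma finite_average_mult: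
  fixes c :: "'v::real_normed_algebra"
  shows "finite_average M p (\<lambda>x. c * F x) = c * finite_average M p F"
  by (simp add: finite_average_def sum_distrib_left)

lemma finite_average_diff_norm_le:
  assumes "0 < M" "\<And>i. i < M \<Longrightarrow> norm (F (p i) - H (p i)) \<le> b"
  shows "norm (finite_average M p F - finite_average M p H) \<le> b"
  using finite_average_norm_le[of M "\<lambda>x. F x - H x" p b] assms
  by (simp add: finite_average_diff)

lemma sum_mult_blocks:
  fixes F :: "nat \<Rightarrow> 'v::comm_monoid_add"
  shows "(\<Sum>i<M * N. F i) = (\<Sum>j<N. \<Sum>i<M. F (j * M + i))"
proof (induction N)
  case (Suc N)
  have "(\<Sum>i<M * N + k. F i) = (\<Sum>i<M * N. F i) + (\<Sum>i<k. F (N * M + i))" for k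
    by (induction k) (simp_all add: ac_simps)
  from this[of M] Suc show ?case by (simp add: ac_simps)
qed simp

context comm_group
begin

text \<open>In effect Reiter's condition: the averaging weights and their translate by
  \<open>y\<close> differ by at most \<open>e\<close> in the l1 norm. Uniformity in \<open>F\<close>
  matters because the positive definite function averaged later is chosen depending on
  \<open>M\<close> and \<open>p\<close>.\<close>

definition almost_invariant :: "nat \<Rightarrow> (nat \<Rightarrow> 'a) \<Rightarrow> 'a \<Rightarrow> real \<Rightarrow> 'v::real_normed_vector itself \<Rightarrow> bool" where
  "almost_invariant M p y e V \<longleftrightarrow> (\<forall>(F :: 'a \<Rightarrow> 'v) b. (\<forall>x\<in>carrier G. norm (F x) \<le> b) \<longrightarrow>
     norm (finite_average M p (\<lambda>x. F (x \<otimes> y)) - finite_average M p F) \<le> e * b)"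

text \<open>Folner-type averages built one element at a time: the old points are multiplied by the
  powers of \<open>z\<close> below \<open>N\<close>. For \<open>z\<close> itself the average over
  powers telescopes; commutativity preserves the invariance under the earlier elements.\<close>

lemma almost_invariant_averages:
  assumes "finite S" "S \<subseteq> carrier G" "0 < e"
  shows "\<exists>M p. 0 < M \<and> (\<forall>i. p i \<in> carrier G) \<and>
    (\<forall>y\<in>S. almost_invariant M p y e TYPE('v::real_normed_vector))"
  using assms
proof (induction S)
  case empty
  then show ?case by (intro exI[of _ 1] exI[of _ "\<lambda>_. \<one>"]) auto
next
  case (insert z S)
  then obtain M p where M: "0 < M" and p: "\<And>i. p i \<in> carrier G"
    and inv: "\<And>y. y \<in> S \<Longrightarrow> almost_invariant M p y e TYPE('v)"
    using insert.IH insert.prems by (simp del: split_paired_Ex) blast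
  have z: "z \<in> carrier G" using insert by simp
  \<comment> \<open>Telescoping leaves two boundary terms of norm at most \<open>b\<close>, hence an
    error of \<open>2 * b / N\<close>.\<close>
  obtain N :: nat where N: "2 / e < N" using reals_Archimedean2 by blast
  have N0: "0 < N" using N \<open>0 < e\<close> by (metis divide_pos_pos of_nat_0_less_iff order.strict_trans zero_less_numeral)
  define q where "q i = p (i mod M) \<otimes> z [^] (i div M)" for i
  have qc: "q i \<in> carrier G" for i using p z by (simp add: q_def)
  have avg: "finite_average (M * N) q F = finite_average N (\<lambda>j. j) (\<lambda>j. finite_average M p (\<lambda>x. F (x \<otimes> z [^] j)))"
    for F :: "'a \<Rightarrow> 'v"
  proof -
    have "(\<Sum>i<M * N. F (q i)) = (\<Sum>j<N. \<Sum>i<M. F (p i \<otimes> z [^] j))"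
      unfolding sum_mult_blocks by (intro sum.cong refl) (simp add: q_def)
    then show ?thesis by (simp add: finite_average_def scaleR_sum_right mult.commute)
  qed
  have "almost_invariant (M * N) q y e TYPE('v)" if y: "y \<in> insert z S" for y
    unfolding almost_invariant_def
  proof (intro allI impI)
    fix F :: "'a \<Rightarrow> 'v" and b
    assume b: "\<forall>x\<in>carrier G. norm (F x) \<le> b"
    have b0: "0 \<le> b" using b[rule_format, OF one_closed] norm_ge_zero order.trans by blast
    show "norm (finite_average (M * N) q (\<lambda>x. F (x \<otimes> y)) - finite_average (M * N) q F) \<le> e * b"
    proof (cases "y = z")
      case True
      define u where "u j = finite_average M p (\<lambda>x. F (x \<otimes> z [^] j))" for j :: nat
      have u: "norm (u j) \<le> b" for j
        unfolding u_def using M b p z by (intro finite_average_norm_le) auto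
      have u_Suc: "finite_average M p (\<lambda>x. F (x \<otimes> z [^] j \<otimes> z)) = u (Suc j)" for j :: nat
        unfolding u_def finite_average_def using p z by (simp add: m_ac)
      have "finite_average (M * N) q (\<lambda>x. F (x \<otimes> y)) - finite_average (M * N) q F
          = (\<Sum>j<N. u (Suc j) - u j) /\<^sub>R N"
        unfolding avg True u_Suc by (simp add: finite_average_def[of N] u_def sum_subtractf scaleR_diff_right)
      also have "\<dots> = (u N - u 0) /\<^sub>R N" by (simp add: sum_lessThan_telescope)
      also have "norm \<dots> = norm (u N - u 0) / N" by (simp add: divide_inverse mult.commute)
      also have "\<dots> \<le> (b + b) / N"
        using u[of N] u[of 0] norm_triangle_ineq4[of "u N" "u 0"] by (intro divide_right_mono) auto
      also have "\<dots> = (2 / N) * b" by simp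
      also have "\<dots> \<le> e * b"
      proof (rule mult_right_mono[OF _ b0])
        show "2 / real N \<le> e" using N N0 \<open>0 < e\<close> by (simp add: field_simps)
      qed
      finally show ?thesis .
    next
      case False
      then have yS: "y \<in> S" and yc: "y \<in> carrier G" using y insert by auto
      have "norm (finite_average M p (\<lambda>x. F (x \<otimes> z [^] j \<otimes> y)) - finite_average M p (\<lambda>x. F (x \<otimes> z [^] j))) \<le> e * b"
        for j :: nat
      proof -
        have "finite_average M p (\<lambda>x. F (x \<otimes> z [^] j \<otimes> y)) = finite_average M p (\<lambda>x. F (x \<otimes> y \<otimes> z [^] j))"
          unfolding finite_average_def using p z yc by (simp add: m_ac)
        then show ?thesis
          using inv[OF yS, unfolded almost_invariant_def, rule_format, of "\<lambda>x. F (x \<otimes> z [^] j)" b] b z by simp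
      qed
      then show ?thesis unfolding avg using N0 by (auto intro: finite_average_diff_norm_le)
    qed
  qed
  moreover have "0 < M * N" using M N0 by simp
  ultimately show ?case using qc by blast
qed

definition invariant_mean :: "(('a \<Rightarrow> real) \<Rightarrow> real) \<Rightarrow> bool" where
  "invariant_mean m \<longleftrightarrow>
     (\<forall>F H. bounded (F ` carrier G) \<longrightarrow> bounded (H ` carrier G) \<longrightarrow> m (\<lambda>x. F x + H x) = m F + m H) \<and>
     (\<forall>c F. bounded (F ` carrier G) \<longrightarrow> m (\<lambda>x. c * F x) = c * m F) \<and>
     (\<forall>b F. (\<forall>x\<in>carrier G. b \<le> F x) \<longrightarrow> bounded (F ` carrier G) \<longrightarrow> b \<le> m F) \<and>
     (\<forall>F y. bounded (F ` carrier G) \<longrightarrow> y \<in> carrier G \<longrightarrow> m (\<lambda>x. F (x \<otimes> y)) = m F)"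

lemma bounded_translate:
  "bounded (F ` carrier G) \<Longrightarrow> y \<in> carrier G \<Longrightarrow> bounded ((\<lambda>x. F (x \<otimes> y)) ` carrier G)"
  by (erule bounded_subset) auto

text \<open>Finite averages are linear and positive exactly and invariant up to a tolerance, so only
  the last condition of \<open>Q\<close> involves \<open>e\<close>. A limit point in the product of
  the intervals from \<open>- B F\<close> to \<open>B F\<close> is invariant.\<close>

theorem invariant_mean_exists: "\<exists>m. invariant_mean m"
proof -
  \<comment> \<open>The value 0 at unbounded functions confines \<open>m F\<close> to a compact
    interval for every \<open>F\<close>.\<close>
  define B where "B F = (if bounded (F ` carrier G) then SUP x\<in>carrier G. \<bar>F x\<bar> else 0)" for F :: "'a \<Rightarrow> real"
  have B: "\<bar>F x\<bar> \<le> B F" if "bounded (F ` carrier G)" "x \<in> carrier G" for F x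
  proof -
    have "bdd_above ((\<lambda>x. \<bar>F x\<bar>) ` carrier G)"
      using that(1) unfolding bounded_iff bdd_above_def by auto
    then show ?thesis using that by (auto simp: B_def intro: cSUP_upper)
  qed
  define K where "K = {m :: ('a \<Rightarrow> real) \<Rightarrow> real. \<forall>F. m F \<in> cball 0 (B F)}"
  define Q where "Q y e m \<longleftrightarrow>
     (\<forall>F H. bounded (F ` carrier G) \<longrightarrow> bounded (H ` carrier G) \<longrightarrow> m (\<lambda>x. F x + H x) = m F + m H) \<and>
     (\<forall>c F. bounded (F ` carrier G) \<longrightarrow> m (\<lambda>x. c * F x) = c * m F) \<and>
     (\<forall>b F. (\<forall>x\<in>carrier G. b \<le> F x) \<longrightarrow> bounded (F ` carrier G) \<longrightarrow> b \<le> m F) \<and>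
     (\<forall>F. bounded (F ` carrier G) \<longrightarrow> \<bar>m (\<lambda>x. F (x \<otimes> y)) - m F\<bar> \<le> e * B F)" for y e and m :: "('a \<Rightarrow> real) \<Rightarrow> real"
  have ev: "continuous_on UNIV (\<lambda>m :: ('a \<Rightarrow> real) \<Rightarrow> real. m F)" for F
    by (rule continuous_on_product_coordinates)
  have "\<exists>m\<in>K. \<forall>y\<in>carrier G. \<forall>e>0. Q y e m"
  proof (rule compact_exists_all_tolerances)
    show "compact K" unfolding K_def by (rule compact_bounded_functions)
    show "closed {m. Q y e m}" for y e
      unfolding Q_def
      by (intro closed_Collect_conj closed_Collect_all closed_Collect_imp open_Collect_const
          closed_Collect_eq closed_Collect_le continuous_intros ev)
    show "Q y e' m" if "y \<in> carrier G" "e \<le> e'" "Q y e m" for y e e' m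
    proof -
      have "e * B F \<le> e' * B F" if "bounded (F ` carrier G)" for F
        using \<open>e \<le> e'\<close> B[OF that one_closed] by (intro mult_right_mono) auto
      then show ?thesis using \<open>Q y e m\<close> unfolding Q_def by (meson order.trans)
    qed
    fix S and e :: real assume S: "finite S" "S \<subseteq> carrier G" "0 < e"
    obtain M p where M: "0 < M" and p: "\<And>i. p i \<in> carrier G"
      and inv: "\<And>y. y \<in> S \<Longrightarrow> almost_invariant M p y e TYPE(real)"
      using almost_invariant_averages[OF S] by metis
    define m where "m F = (if bounded (F ` carrier G) then finite_average M p F else 0)" for F :: "'a \<Rightarrow> real"
    have "m \<in> K" unfolding K_def m_def
    proof (clarsimp, safe)
      fix F :: "'a \<Rightarrow> real" assume "bounded (F ` carrier G)"
      then show "\<bar>finite_average M p F\<bar> \<le> B F"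
        using finite_average_norm_le[OF M, of F p "B F"] B p by simp
    qed (simp add: B_def)
    moreover have "Q y e m" if y: "y \<in> S" for y
      unfolding Q_def
    proof (intro conjI allI impI)
      fix F H :: "'a \<Rightarrow> real" assume bd: "bounded (F ` carrier G)" "bounded (H ` carrier G)"
      then show "m (\<lambda>x. F x + H x) = m F + m H"
        using bounded_plus_comp[OF bd] by (simp add: m_def finite_average_add)
    next
      fix c and F :: "'a \<Rightarrow> real" assume bd: "bounded (F ` carrier G)"
      have "bounded ((\<lambda>x. c * F x) ` carrier G)"
        using bounded_scaling[OF bd, of c] by (simp add: image_image)
      then show "m (\<lambda>x. c * F x) = c * m F" using bd by (simp add: m_def finite_average_mult)
    next
      fix b and F :: "'a \<Rightarrow> real" assume bd: "bounded (F ` carrier G)" and b: "\<forall>x\<in>carrier G. b \<le> F x"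
      have "(\<Sum>i<M. b) \<le> (\<Sum>i<M. F (p i))" using b p by (intro sum_mono) auto
      then show "b \<le> m F" using bd M by (simp add: m_def finite_average_def field_simps)
    next
      fix F :: "'a \<Rightarrow> real" assume bd: "bounded (F ` carrier G)"
      have "y \<in> carrier G" using y S by auto
      then show "\<bar>m (\<lambda>x. F (x \<otimes> y)) - m F\<bar> \<le> e * B F"
        using bd B[OF bd] inv[OF y, unfolded almost_invariant_def, rule_format, of F "B F"]
        by (simp add: m_def bounded_translate)
    qed
    ultimately show "\<exists>m\<in>K. \<forall>y\<in>S. Q y e m" by blast
  qed
  then obtain m where m: "\<And>y e. y \<in> carrier G \<Longrightarrow> 0 < e \<Longrightarrow> Q y e m" by blast
  have "m (\<lambda>x. F (x \<otimes> y)) = m F" if bd: "bounded (F ` carrier G)" and y: "y \<in> carrier G" for F y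
  proof -
    have B0: "0 \<le> B F" using B[OF bd one_closed] by linarith
    have "\<bar>m (\<lambda>x. F (x \<otimes> y)) - m F\<bar> \<le> 0 + d" if d: "0 < d" for d
    proof -
      have "\<bar>m (\<lambda>x. F (x \<otimes> y)) - m F\<bar> \<le> d / (B F + 1) * B F"
        using m[OF y, of "d / (B F + 1)"] bd B0 d unfolding Q_def by auto
      also have "\<dots> \<le> d" using B0 d by (simp add: field_simps)
      finally show ?thesis by simp
    qed
    then have "\<bar>m (\<lambda>x. F (x \<otimes> y)) - m F\<bar> \<le> 0" by (rule field_le_epsilon)
    then show ?thesis by simp
  qed
  moreover have "Q \<one> 1 m" using m by simp
  ultimately have "invariant_mean m"
    unfolding invariant_mean_def Q_def by (intro conjI) simp_all
  then show ?thesis by blast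
qed

end

section \<open>Positive definite functions\<close>

lemma cmod_parallelogram: "(cmod (z + w))\<^sup>2 + (cmod (z - w))\<^sup>2 = 2 * (cmod z)\<^sup>2 + 2 * (cmod w)\<^sup>2"
  unfolding cmod_power2 by (simp add: power2_eq_square algebra_simps)

lemma sum_lessThan_add:
  fixes F :: "nat \<Rightarrow> 'v::comm_monoid_add"
  shows "(\<Sum>i<m + n. F i) = (\<Sum>i<m. F i) + (\<Sum>i<n. F (m + i))"
  by (induction n) (simp_all add: ac_simps)

context comm_group
begin

lemma mult_mult_inv_cancel:
  assumes "x \<in> carrier G" "y \<in> carrier G" "b \<in> carrier G"
  shows "x \<otimes> b \<otimes> inv (y \<otimes> b) = x \<otimes> inv y"
proof -
  have "b \<otimes> (inv b \<otimes> inv y) = inv y" using assms by (simp add: m_assoc[symmetric])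
  then show ?thesis using assms by (simp add: inv_mult_group m_assoc)
qed

text \<open>Hermitian symmetry makes the quadratic form real, so testing its real part loses
  nothing. Vanishing off the carrier bounds the remaining coordinates, which is what makes the set
  compact.\<close>

definition normalized_pd :: "('a \<Rightarrow> complex) set" where
  "normalized_pd = {\<phi>. (\<forall>x. x \<notin> carrier G \<longrightarrow> \<phi> x = 0) \<and> \<phi> \<one> = 1 \<and>
     (\<forall>x\<in>carrier G. \<phi> (inv x) = cnj (\<phi> x)) \<and>
     (\<forall>n p c. (\<forall>i. p i \<in> carrier G) \<longrightarrow>
        0 \<le> Re (\<Sum>i<n::nat. \<Sum>j<n. c i * cnj (c j) * \<phi> (p i \<otimes> inv (p j))))}"

lemma normalized_pd_psd:
  "\<lbrakk>\<phi> \<in> normalized_pd; \<And>i. p i \<in> carrier G\<rbrakk> \<Longrightarrow>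
    0 \<le> Re (\<Sum>i<n::nat. \<Sum>j<n. c i * cnj (c j) * \<phi> (p i \<otimes> inv (p j)))"
  unfolding normalized_pd_def by blast

lemma normalized_pd_simps:
  assumes "\<phi> \<in> normalized_pd"
  shows "\<phi> \<one> = 1" "x \<in> carrier G \<Longrightarrow> \<phi> (inv x) = cnj (\<phi> x)" "x \<notin> carrier G \<Longrightarrow> \<phi> x = 0"
  using assms by (auto simp: normalized_pd_def)

text \<open>Positivity at the two points \<open>x\<close> and \<open>\<one>\<close>, with the phase
  of the second coefficient chosen so that both mixed terms become
  \<open>- cmod (\<phi> x)\<close>.\<close>

lemma normalized_pd_norm_le_1:
  assumes \<phi>: "\<phi> \<in> normalized_pd" shows "cmod (\<phi> x) \<le> 1"
proof (cases "x \<in> carrier G \<and> \<phi> x \<noteq> 0")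
  case True
  define p where "p i = (if i = 0 then x else \<one>)" for i :: nat
  define c where "c i = (if i = 0 then 1 else - (\<phi> x / cmod (\<phi> x)))" for i :: nat
  have "(\<Sum>i<2::nat. \<Sum>j<2. c i * cnj (c j) * \<phi> (p i \<otimes> inv (p j)))
      = 1 + (\<phi> x / cmod (\<phi> x)) * cnj (\<phi> x / cmod (\<phi> x))
        - cnj (\<phi> x / cmod (\<phi> x)) * \<phi> x - (\<phi> x / cmod (\<phi> x)) * cnj (\<phi> x)"
    using True by (simp add: numeral_2_eq_2 c_def p_def normalized_pd_simps[OF \<phi>])
  also have "\<dots> = of_real (2 - 2 * cmod (\<phi> x))"
    using True by (simp add: complex_norm_square[symmetric] power2_eq_square field_simps)
  finally show ?thesis
    using normalized_pd_psd[OF \<phi>, where p = p and n = 2 and c = c] True by (auto simp: p_def)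
qed (use normalized_pd_simps[OF \<phi>] in auto)

lemma compact_normalized_pd: "compact normalized_pd"
proof -
  have ev: "continuous_on UNIV (\<lambda>\<phi> :: 'a \<Rightarrow> complex. \<phi> x)" for x
    by (rule continuous_on_product_coordinates)
  have "closed normalized_pd"
    unfolding normalized_pd_def Ball_def
    by (intro closed_Collect_conj closed_Collect_all closed_Collect_imp open_Collect_const
        closed_Collect_eq closed_Collect_le continuous_intros ev)
  then have "compact (normalized_pd \<inter> {\<phi>. \<forall>x. \<phi> x \<in> cball 0 1})"
    by (rule closed_Int_compact) (rule compact_bounded_functions)
  moreover have "normalized_pd \<inter> {\<phi>. \<forall>x. \<phi> x \<in> cball 0 1} = normalized_pd"
    using normalized_pd_norm_le_1 by (intro Int_absorb2 subsetI) simp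
  ultimately show ?thesis by simp
qed

text \<open>In GNS terms the coefficient of \<open>(c U + cnj c U* - 2 r) / 4\<close>, where
  \<open>U\<close> is translation by \<open>b\<close> and \<open>r = Re (c * \<phi> b)\<close>.
  Subtracting \<open>2 r\<close> makes the perturbation vanish at the identity, which keeps the
  normalization.\<close>

definition pd_perturbation :: "('a \<Rightarrow> complex) \<Rightarrow> complex \<Rightarrow> 'a \<Rightarrow> 'a \<Rightarrow> complex" where
  "pd_perturbation \<phi> c b x = (if x \<in> carrier G then
     (c * \<phi> (x \<otimes> b) + cnj c * \<phi> (x \<otimes> inv b) - of_real (2 * Re (c * \<phi> b)) * \<phi> x) / 4 else 0)"

text \<open>In the GNS space of \<open>\<phi>\<close>, translation by \<open>b\<close> is a unitary \<open>U\<close> commuting with the group,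
  and \<open>2 + c U + cnj c U\<^sup>* = (1 + c U) (1 + c U)\<^sup>*\<close> is positive.\<close>

lemma normalized_pd_perturbed:
  assumes \<phi>: "\<phi> \<in> normalized_pd" and b: "b \<in> carrier G" and c: "cmod c = 1"
  shows "(\<lambda>x. \<phi> x + pd_perturbation \<phi> c b x) \<in> normalized_pd" (is "?\<psi> \<in> _")
proof -
  note s = normalized_pd_simps[OF \<phi>]
  define r where "r = Re (c * \<phi> b)"
  have "\<bar>r\<bar> \<le> cmod (c * \<phi> b)" unfolding r_def by (rule abs_Re_le_cmod)
  then have r: "\<bar>r\<bar> \<le> 1" using normalized_pd_norm_le_1[OF \<phi>, of b] c by (simp add: norm_mult)
  have cc: "c * cnj c = 1" using c by (simp add: complex_norm_square[symmetric])
  have "c * \<phi> b + cnj (c * \<phi> b) = of_real (2 * r)" unfolding r_def by (rule complex_add_cnj)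
  then have "c * \<phi> b + cnj c * cnj (\<phi> b) = 2 * of_real r" by simp
  then have "?\<psi> \<one> = 1" using b by (simp add: pd_perturbation_def s r_def)
  moreover have "?\<psi> (inv x) = cnj (?\<psi> x)" if x: "x \<in> carrier G" for x
  proof -
    have "inv x \<otimes> b = inv (x \<otimes> inv b)" "inv x \<otimes> inv b = inv (x \<otimes> b)"
      using x b by (simp_all add: inv_mult)
    then show ?thesis using x b by (simp add: pd_perturbation_def s)
  qed
  moreover have "0 \<le> Re (\<Sum>i<n::nat. \<Sum>j<n. d i * cnj (d j) * ?\<psi> (p i \<otimes> inv (p j)))"
    if p: "\<And>i. p i \<in> carrier G" for n p d
  proof -
    \<comment> \<open>Twice as many points, representing the GNS vector \<open>(1 + c U) v\<close>,
      where \<open>v\<close> is the combination of the \<open>p i\<close> with coefficients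
      \<open>d i\<close>.\<close>
    define q where "q i = (if i < n then p i else p (i - n) \<otimes> b)" for i
    define e where "e i = (if i < n then d i else c * d (i - n))" for i
    have q: "q i \<in> carrier G" for i using p b by (simp add: q_def)
    define A where "A f = (\<Sum>i<n. \<Sum>j<n. d i * cnj (d j) * f (p i \<otimes> inv (p j)))" for f :: "'a \<Rightarrow> complex"
    have A_add: "A (\<lambda>x. f x + g x) = A f + A g" for f g
      by (simp add: A_def sum.distrib algebra_simps)
    have A_mult: "A (\<lambda>x. u * f x) = u * A f" for u f
      by (simp add: A_def sum_distrib_left algebra_simps)
    have "p i \<otimes> b \<otimes> inv (p j \<otimes> b) = p i \<otimes> inv (p j)" for i j
      using p b by (simp add: mult_mult_inv_cancel)
    moreover have "p i \<otimes> b \<otimes> inv (p j) = p i \<otimes> inv (p j) \<otimes> b"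
      "p i \<otimes> inv (p j \<otimes> b) = p i \<otimes> inv (p j) \<otimes> inv b" for i j
      using p b by (simp_all add: inv_mult m_ac)
    ultimately have "(\<Sum>i<n+n. \<Sum>j<n+n. e i * cnj (e j) * \<phi> (q i \<otimes> inv (q j)))
        = (\<Sum>i<n. \<Sum>j<n. d i * cnj (d j) * \<phi> (p i \<otimes> inv (p j)) * (1 + c * cnj c)
             + c * (d i * cnj (d j) * \<phi> (p i \<otimes> inv (p j) \<otimes> b))
             + cnj c * (d i * cnj (d j) * \<phi> (p i \<otimes> inv (p j) \<otimes> inv b)))"
      unfolding sum_lessThan_add by (simp add: e_def q_def sum.distrib algebra_simps sum_distrib_left)
    also have "\<dots> = A \<phi> * 2 + c * A (\<lambda>x. \<phi> (x \<otimes> b)) + cnj c * A (\<lambda>x. \<phi> (x \<otimes> inv b))"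
      by (simp add: A_def cc sum.distrib sum_distrib_left sum_distrib_right)
    finally have 2: "0 \<le> Re (A \<phi> * 2 + c * A (\<lambda>x. \<phi> (x \<otimes> b)) + cnj c * A (\<lambda>x. \<phi> (x \<otimes> inv b)))"
      using normalized_pd_psd[OF \<phi>, where p = q and n = "n + n" and c = e] q by simp
    have 1: "0 \<le> Re (A \<phi>)" unfolding A_def using normalized_pd_psd[OF \<phi> p] .
    have "A ?\<psi> = A (\<lambda>x. \<phi> x + (1/4) * (c * \<phi> (x \<otimes> b) + (cnj c * \<phi> (x \<otimes> inv b) + of_real (-2 * r) * \<phi> x)))"
      unfolding A_def using p by (intro sum.cong refl) (simp add: pd_perturbation_def r_def[symmetric] del: times_complex.sel)
    also have "\<dots> = A \<phi> + (1/4) * (c * A (\<lambda>x. \<phi> (x \<otimes> b)) + (cnj c * A (\<lambda>x. \<phi> (x \<otimes> inv b)) + of_real (-2 * r) * A \<phi>))"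
      by (simp only: A_add A_mult)
    \<comment> \<open>Two nonnegative forms: the weight \<open>2 - 2 * r\<close> is nonnegative
      since \<open>\<bar>r\<bar> \<le> 1\<close>, and \<open>?X\<close> is the form at the doubled
      points.\<close>
    finally have "4 * A ?\<psi> = of_real (2 - 2 * r) * A \<phi>
        + (A \<phi> * 2 + c * A (\<lambda>x. \<phi> (x \<otimes> b)) + cnj c * A (\<lambda>x. \<phi> (x \<otimes> inv b)))" (is "_ = _ + ?X")
      by (simp add: field_simps)
    then have "Re (4 * A ?\<psi>) = Re (of_real (2 - 2 * r) * A \<phi> + ?X)" by (rule arg_cong)
    then have "4 * Re (A ?\<psi>) = (2 - 2 * r) * Re (A \<phi>) + Re ?X"
      by (simp del: of_real_diff of_real_mult)
    moreover have "0 \<le> (2 - 2 * r) * Re (A \<phi>)" using r 1 by simp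
    ultimately show ?thesis using 2 unfolding A_def by linarith
  qed
  ultimately show ?thesis
    using s(3) unfolding normalized_pd_def by (simp add: pd_perturbation_def)
qed

text \<open>Extreme points of the normalized positive definite functions are characters. Adding a small
  strictly convex functional to a linear one makes its maximizer behave like an extreme point
  at the points of \<open>F\<close>.\<close>

lemma maximizing_multiplicative_pd:
  assumes F: "finite F" "F \<subseteq> carrier G" and p: "\<And>i. p i \<in> carrier G" and \<eta>: "0 < \<eta>"
    and \<psi>: "\<psi> \<in> normalized_pd"
  obtains \<phi> where "\<phi> \<in> normalized_pd"
    "Re (finite_average M p (\<lambda>x. \<psi> x * P x)) - \<eta> \<le> Re (finite_average M p (\<lambda>x. \<phi> x * P x))"
    "\<And>x z. x \<in> F \<Longrightarrow> z \<in> carrier G \<Longrightarrow> \<phi> (x \<otimes> z) = \<phi> x * \<phi> z"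
proof -
  \<comment> \<open>With this weight the quadratic term of \<open>J\<close> is at most
    \<open>\<eta>\<close>, the loss allowed in the linear term. Adding 1 covers an empty
    \<open>F\<close>.\<close>
  define \<kappa> where "\<kappa> = \<eta> / (real (card F) + 1)"
  have \<kappa>: "0 < \<kappa>" "\<kappa> * card F \<le> \<eta>" using \<eta> by (auto simp: \<kappa>_def field_simps)
  define J where "J \<phi> = Re (finite_average M p (\<lambda>x. \<phi> x * P x)) + \<kappa> * (\<Sum>x\<in>F. (cmod (\<phi> x))\<^sup>2)" for \<phi>
  have ev: "continuous_on A (\<lambda>\<phi> :: 'a \<Rightarrow> complex. \<phi> x)" for x A
    by (rule continuous_on_subset[OF continuous_on_product_coordinates subset_UNIV])
  have "continuous_on normalized_pd J"
    unfolding J_def finite_average_def by (intro continuous_intros ev)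
  then obtain \<phi> where \<phi>: "\<phi> \<in> normalized_pd" and max: "\<And>\<theta>. \<theta> \<in> normalized_pd \<Longrightarrow> J \<theta> \<le> J \<phi>"
    using continuous_attains_sup[OF compact_normalized_pd, of J] \<psi> by blast
  have "(\<Sum>x\<in>F. (cmod (\<phi> x))\<^sup>2) \<le> (\<Sum>x\<in>F. 1)"
    using normalized_pd_norm_le_1[OF \<phi>] by (intro sum_mono) (simp add: power_le_one)
  then have "\<kappa> * (\<Sum>x\<in>F. (cmod (\<phi> x))\<^sup>2) \<le> \<kappa> * card F"
    using \<kappa> by (intro mult_left_mono) auto
  moreover have "0 \<le> \<kappa> * (\<Sum>x\<in>F. (cmod (\<psi> x))\<^sup>2)" using \<kappa> by (simp add: sum_nonneg)
  ultimately have "Re (finite_average M p (\<lambda>x. \<psi> x * P x)) - \<eta> \<le> Re (finite_average M p (\<lambda>x. \<phi> x * P x))"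
    using max[OF \<psi>] \<kappa> unfolding J_def by linarith
  \<comment> \<open>Replacing \<open>c\<close> by \<open>- c\<close> reverses the perturbation
    \<open>D\<close>, so \<open>\<phi> + D\<close> and \<open>\<phi> - D\<close> both compete. By
    the parallelogram law a \<open>D\<close> that is nonzero somewhere on \<open>F\<close> would
    raise the mean of their \<open>J\<close> values above the maximum.\<close>
  moreover have D0: "pd_perturbation \<phi> c b x = 0" if b: "b \<in> carrier G" and c: "cmod c = 1" and x: "x \<in> F" for b c x
  proof -
    define D where "D = pd_perturbation \<phi> c b"
    have "pd_perturbation \<phi> (- c) b = (\<lambda>x. - D x)"
      by (auto simp: D_def pd_perturbation_def fun_eq_iff field_simps)
    then have "(\<lambda>x. \<phi> x - D x) \<in> normalized_pd" "(\<lambda>x. \<phi> x + D x) \<in> normalized_pd"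
      using normalized_pd_perturbed[OF \<phi> b, of "- c"] normalized_pd_perturbed[OF \<phi> b c] c by (simp_all add: D_def)
    from this[THEN max] have "J (\<lambda>x. \<phi> x + D x) + J (\<lambda>x. \<phi> x - D x) \<le> 2 * J \<phi>"
      by linarith
    moreover have "(\<Sum>x\<in>F. (cmod (\<phi> x + D x))\<^sup>2) + (\<Sum>x\<in>F. (cmod (\<phi> x - D x))\<^sup>2)
        = 2 * (\<Sum>x\<in>F. (cmod (\<phi> x))\<^sup>2) + 2 * (\<Sum>x\<in>F. (cmod (D x))\<^sup>2)"
      by (simp add: sum.distrib[symmetric] cmod_parallelogram sum_distrib_left)
    then have "\<kappa> * (\<Sum>x\<in>F. (cmod (\<phi> x + D x))\<^sup>2) + \<kappa> * (\<Sum>x\<in>F. (cmod (\<phi> x - D x))\<^sup>2)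
        = 2 * (\<kappa> * (\<Sum>x\<in>F. (cmod (\<phi> x))\<^sup>2)) + 2 * (\<kappa> * (\<Sum>x\<in>F. (cmod (D x))\<^sup>2))"
      by (simp only: distrib_left[symmetric])
    ultimately have "\<kappa> * (\<Sum>x\<in>F. (cmod (D x))\<^sup>2) \<le> 0"
      unfolding J_def distrib_right left_diff_distrib finite_average_add finite_average_diff by simp
    then have "(\<Sum>x\<in>F. (cmod (D x))\<^sup>2) \<le> 0" using \<kappa> by (simp add: mult_le_0_iff)
    then have "(\<Sum>x\<in>F. (cmod (D x))\<^sup>2) = 0" by (simp add: sum_nonneg order.antisym)
    then have "(cmod (D x))\<^sup>2 = 0" using x F by (simp add: sum_nonneg_eq_0_iff)
    then show ?thesis by (simp add: D_def)
  qed
  have "\<phi> (x \<otimes> z) = \<phi> x * \<phi> z" if x: "x \<in> F" and z: "z \<in> carrier G" for x z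
  proof -
    have xc: "x \<in> carrier G" using x F by auto
    \<comment> \<open>\<open>c = 1\<close> determines the sum of
      \<open>\<phi> (x \<otimes> z)\<close> and \<open>\<phi> (x \<otimes> inv z)\<close>, and
      \<open>c = \<i>\<close> their difference.\<close>
    have "\<phi> (x \<otimes> z) + \<phi> (x \<otimes> inv z) = of_real (2 * Re (\<phi> z)) * \<phi> x"
      using D0[OF z _ x, of 1] xc by (simp add: pd_perturbation_def)
    moreover have "\<phi> (x \<otimes> z) - \<phi> (x \<otimes> inv z) = 2 * \<i> * of_real (Im (\<phi> z)) * \<phi> x"
    proof -
      have "\<i> * \<phi> (x \<otimes> z) - \<i> * \<phi> (x \<otimes> inv z) = of_real (- 2 * Im (\<phi> z)) * \<phi> x"
        using D0[OF z _ x, of \<i>] xc by (simp add: pd_perturbation_def eq_neg_iff_add_eq_0)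
      then have "- \<i> * (\<i> * \<phi> (x \<otimes> z) - \<i> * \<phi> (x \<otimes> inv z)) = - \<i> * (of_real (- 2 * Im (\<phi> z)) * \<phi> x)" by simp
      then show ?thesis by (simp add: algebra_simps)
    qed
    ultimately have "2 * \<phi> (x \<otimes> z) = 2 * ((of_real (Re (\<phi> z)) + \<i> * of_real (Im (\<phi> z))) * \<phi> x)"
      by (simp add: algebra_simps)
    then show ?thesis by (simp add: complex_eq[symmetric])
  qed
  ultimately show thesis using that \<phi> by blast
qed

end

section \<open>Autocorrelations of almost periodic functions\<close>

context comm_group
begin

lemma invariant_meanD:
  assumes "invariant_mean m"
  shows invariant_mean_add: "\<lbrakk>bounded (F ` carrier G); bounded (H ` carrier G)\<rbrakk> \<Longrightarrow> m (\<lambda>x. F x + H x) = m F + m H"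
    and invariant_mean_mult: "bounded (F ` carrier G) \<Longrightarrow> m (\<lambda>x. c * F x) = c * m F"
    and invariant_mean_ge: "\<lbrakk>\<And>x. x \<in> carrier G \<Longrightarrow> b \<le> F x; bounded (F ` carrier G)\<rbrakk> \<Longrightarrow> b \<le> m F"
    and invariant_mean_translate: "\<lbrakk>bounded (F ` carrier G); y \<in> carrier G\<rbrakk> \<Longrightarrow> m (\<lambda>x. F (x \<otimes> y)) = m F"
  using assms unfolding invariant_mean_def by blast+

lemma invariant_mean_zero: "invariant_mean m \<Longrightarrow> m (\<lambda>x. 0) = 0"
  using invariant_mean_mult[of m "\<lambda>x. 0" 0] by (simp add: image_constant_conv)

lemma invariant_mean_sum:
  assumes m: "invariant_mean m" and bd: "\<And>i. i < n \<Longrightarrow> bounded (F i ` carrier G)"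
  shows "m (\<lambda>x. \<Sum>i<n::nat. F i x) = (\<Sum>i<n. m (F i))"
  using bd
proof (induction n)
  case (Suc n)
  then show ?case
    using invariant_mean_add[OF m, of "\<lambda>x. \<Sum>i<n. F i x" "F n"] bounded_image_sum[of n F "carrier G"] by simp
qed (simp add: invariant_mean_zero[OF m])

lemma invariant_mean_diff:
  assumes m: "invariant_mean m" and "bounded (F ` carrier G)" "bounded (H ` carrier G)"
  shows "m (\<lambda>x. F x - H x) = m F - m H"
proof -
  have "bounded ((\<lambda>x. (- 1) * H x) ` carrier G)"
    using bounded_scaling[OF assms(3), of "- 1"] by (simp add: image_image)
  then show ?thesis
    using invariant_mean_add[OF m assms(2), of "\<lambda>x. (- 1) * H x"] invariant_mean_mult[OF m assms(3), of "- 1"]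
    by simp
qed

lemma invariant_mean_abs_le:
  assumes m: "invariant_mean m" and b: "\<And>x. x \<in> carrier G \<Longrightarrow> \<bar>F x\<bar> \<le> b"
  shows "\<bar>m F\<bar> \<le> b"
proof -
  have bd: "bounded (F ` carrier G)" using b unfolding bounded_image_iff by (auto intro!: exI[of _ b])
  have bd': "bounded ((\<lambda>x. (- 1) * F x) ` carrier G)"
    using bounded_scaling[OF bd, of "- 1"] by (simp add: image_image)
  have "- b \<le> m F" using b by (intro invariant_mean_ge[OF m _ bd]) (force simp: abs_le_iff)
  moreover have "- b \<le> m (\<lambda>x. (- 1) * F x)"
    using b by (intro invariant_mean_ge[OF m _ bd']) (force simp: abs_le_iff)
  ultimately show ?thesis using invariant_mean_mult[OF m bd, of "- 1"] by simp
qed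

text \<open>A diagonal coefficient of the regular representation, with the mean in place of
  integration over the compact group.\<close>

definition autocorrelation :: "(('a \<Rightarrow> real) \<Rightarrow> real) \<Rightarrow> ('a \<Rightarrow> real) \<Rightarrow> 'a \<Rightarrow> real" where
  "autocorrelation m g z = m (\<lambda>u. g (u \<otimes> z) * g u)"

text \<open>Substituting \<open>u \<otimes> inv y\<close> for \<open>u\<close> puts the kernel into
  Gram form, from which positivity can be read off.\<close>

lemma autocorrelation_quotient:
  assumes m: "invariant_mean m" and g: "bounded (g ` carrier G)" and xy: "x \<in> carrier G" "y \<in> carrier G"
  shows "autocorrelation m g (x \<otimes> inv y) = m (\<lambda>u. g (u \<otimes> x) * g (u \<otimes> y))"
proof -
  define H where "H u = g (u \<otimes> x) * g (u \<otimes> y)" for u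
  have "bounded (H ` carrier G)"
    unfolding H_def by (intro bounded_image_mult bounded_translate g xy)
  then have "m (\<lambda>u. H (u \<otimes> inv y)) = m H" using invariant_mean_translate[OF m] xy by simp
  moreover have "autocorrelation m g (x \<otimes> inv y) = m (\<lambda>u. H (u \<otimes> inv y))"
  proof -
    \<comment> \<open>Functions that agree only on the carrier are compared through the mean of
      their difference, which positivity forces to be 0.\<close>
    define N where "N u = g (u \<otimes> (x \<otimes> inv y)) * g u - H (u \<otimes> inv y)" for u
    have "N u = 0" if u: "u \<in> carrier G" for u
    proof -
      have "u \<otimes> (x \<otimes> inv y) = u \<otimes> inv y \<otimes> x" "u \<otimes> inv y \<otimes> y = u"
        using u xy by (simp_all add: m_ac)
      then show ?thesis by (simp add: N_def H_def)
    qed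
    then have "\<bar>m N\<bar> \<le> 0" by (intro invariant_mean_abs_le[OF m]) simp
    moreover have "m N = m (\<lambda>u. g (u \<otimes> (x \<otimes> inv y)) * g u) - m (\<lambda>u. H (u \<otimes> inv y))"
      unfolding N_def using xy \<open>bounded (H ` carrier G)\<close>
      by (intro invariant_mean_diff[OF m] bounded_image_mult bounded_translate g) auto
    ultimately show ?thesis by (simp add: autocorrelation_def)
  qed
  ultimately show ?thesis by (simp add: H_def[abs_def])
qed

text \<open>For real coefficients the form is the mean of a square. The kernel is real, so the real
  part of the form for complex coefficients splits into the forms of their real and imaginary
  parts.\<close>

lemma autocorrelation_normalized_pd:
  assumes m: "invariant_mean m" and g: "bounded (g ` carrier G)" and pos: "0 < autocorrelation m g \<one>"
  shows "(\<lambda>x. if x \<in> carrier G then complex_of_real (autocorrelation m g x / autocorrelation m g \<one>) else 0)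
    \<in> normalized_pd" (is "?\<phi> \<in> _")
proof -
  define A where "A = autocorrelation m g"
  note quotient = autocorrelation_quotient[OF m g, folded A_def]
  have sym: "A (inv x) = A x" if "x \<in> carrier G" for x
    using quotient[of \<one> x] quotient[of x \<one>] that by (simp add: mult.commute)
  have psd: "0 \<le> (\<Sum>i<n. \<Sum>j<n. c i * c j * A (p i \<otimes> inv (p j)))"
    if p: "\<And>i. p i \<in> carrier G" for n p and c :: "nat \<Rightarrow> real"
  proof -
    have bt: "bounded ((\<lambda>u. g (u \<otimes> p i)) ` carrier G)" for i using bounded_translate[OF g p] .
    have bij: "bounded ((\<lambda>u. c i * c j * (g (u \<otimes> p i) * g (u \<otimes> p j))) ` carrier G)" for i j
      by (intro bounded_image_mult bt) (simp_all add: image_constant_conv)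
    have "(\<Sum>i<n. \<Sum>j<n. c i * c j * A (p i \<otimes> inv (p j)))
        = (\<Sum>i<n. \<Sum>j<n. m (\<lambda>u. c i * c j * (g (u \<otimes> p i) * g (u \<otimes> p j))))"
      using p by (simp add: quotient invariant_mean_mult[OF m] bounded_image_mult bt)
    also have "\<dots> = m (\<lambda>u. \<Sum>i<n. \<Sum>j<n. c i * c j * (g (u \<otimes> p i) * g (u \<otimes> p j)))"
      using bij by (simp add: invariant_mean_sum[OF m] bounded_image_sum)
    also have "0 \<le> \<dots>"
    proof (rule invariant_mean_ge[OF m])
      fix u
      have "(\<Sum>i<n. \<Sum>j<n. c i * c j * (g (u \<otimes> p i) * g (u \<otimes> p j))) = (\<Sum>i<n. c i * g (u \<otimes> p i))\<^sup>2"
        by (simp add: power2_eq_square sum_product algebra_simps)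
      then show "0 \<le> (\<Sum>i<n. \<Sum>j<n. c i * c j * (g (u \<otimes> p i) * g (u \<otimes> p j)))" by simp
    qed (use bij in \<open>simp add: bounded_image_sum\<close>)
    finally show ?thesis .
  qed
  have "0 \<le> Re (\<Sum>i<n::nat. \<Sum>j<n. c i * cnj (c j) * ?\<phi> (p i \<otimes> inv (p j)))"
    if p: "\<And>i. p i \<in> carrier G" for n p c
  proof -
    have "Re (\<Sum>i<n::nat. \<Sum>j<n. c i * cnj (c j) * ?\<phi> (p i \<otimes> inv (p j)))
      = (\<Sum>i<n. \<Sum>j<n. (Re (c i) * Re (c j) * A (p i \<otimes> inv (p j)) + Im (c i) * Im (c j) * A (p i \<otimes> inv (p j))) / A \<one>)"
      using p by (simp add: A_def[symmetric] field_simps)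
    also have "\<dots> = ((\<Sum>i<n. \<Sum>j<n. Re (c i) * Re (c j) * A (p i \<otimes> inv (p j))) +
       (\<Sum>i<n. \<Sum>j<n. Im (c i) * Im (c j) * A (p i \<otimes> inv (p j)))) / A \<one>"
      by (simp add: sum_divide_distrib sum.distrib add_divide_distrib)
    also have "0 \<le> \<dots>"
      using psd[of p "\<lambda>i. Re (c i)" n, OF p] psd[of p "\<lambda>i. Im (c i)" n, OF p] pos
      by (intro divide_nonneg_pos add_nonneg_nonneg) (auto simp: A_def)
    finally show ?thesis .
  qed
  then show ?thesis
    using pos sym unfolding normalized_pd_def A_def by simp
qed

text \<open>Bochner's condition: the translates of \<open>F\<close> are totally bounded in the
  supremum norm.\<close>

definition almost_periodic :: "('a \<Rightarrow> real) \<Rightarrow> bool" where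
  "almost_periodic F \<longleftrightarrow> (\<forall>e>0. \<exists>D. finite D \<and> D \<subseteq> carrier G \<and>
     (\<forall>x\<in>carrier G. \<exists>d\<in>D. \<forall>u\<in>carrier G. \<bar>F (u \<otimes> x) - F (u \<otimes> d)\<bar> \<le> e))"

text \<open>Some \<open>d\<close> in the net acts like the inverse of \<open>x\<close>, so
  \<open>F (x \<otimes> d)\<close> is near \<open>F \<one>\<close>. This stands in for the fact that
  Haar measure charges nonempty open sets: it makes means of squares positive.\<close>

lemma almost_periodic_sum_squares:
  assumes "almost_periodic F" "F \<one> \<noteq> 0"
  obtains D h where "finite D" "D \<subseteq> carrier G" "0 < h" "\<And>x. x \<in> carrier G \<Longrightarrow> h \<le> (\<Sum>d\<in>D. (F (x \<otimes> d))\<^sup>2)"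
proof -
  define e where "e = \<bar>F \<one>\<bar> / 2"
  have "0 < e" using assms by (simp add: e_def)
  then obtain D where D: "finite D" "D \<subseteq> carrier G"
    and *: "\<And>x. x \<in> carrier G \<Longrightarrow> \<exists>d\<in>D. \<forall>u\<in>carrier G. \<bar>F (u \<otimes> x) - F (u \<otimes> d)\<bar> \<le> e"
    using assms(1) unfolding almost_periodic_def by meson
  have "e\<^sup>2 \<le> (\<Sum>d\<in>D. (F (x \<otimes> d))\<^sup>2)" if x: "x \<in> carrier G" for x
  proof -
    obtain d where d: "d \<in> D" "\<bar>F (x \<otimes> inv x) - F (x \<otimes> d)\<bar> \<le> e"
      using *[of "inv x"] x by auto
    then have "\<bar>F \<one> - F (x \<otimes> d)\<bar> \<le> e" using x by simp
    then have "\<bar>e\<bar> \<le> \<bar>F (x \<otimes> d)\<bar>" unfolding e_def by linarith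
    then have "e\<^sup>2 \<le> (F (x \<otimes> d))\<^sup>2" by (simp add: abs_le_square_iff)
    also have "\<dots> \<le> (\<Sum>d\<in>D. (F (x \<otimes> d))\<^sup>2)" using D d by (intro member_le_sum) auto
    finally show ?thesis .
  qed
  then show thesis using that[OF D, of "e\<^sup>2"] \<open>0 < e\<close> by simp
qed

lemma autocorrelation_diff_le:
  assumes m: "invariant_mean m" and g: "\<And>u. u \<in> carrier G \<Longrightarrow> \<bar>g u\<bar> \<le> b"
    and xy: "x \<in> carrier G" "y \<in> carrier G"
    and d: "\<And>u. u \<in> carrier G \<Longrightarrow> \<bar>g (u \<otimes> x) - g (u \<otimes> y)\<bar> \<le> d"
  shows "\<bar>autocorrelation m g x - autocorrelation m g y\<bar> \<le> d * b"
proof -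
  have bd: "bounded (g ` carrier G)" unfolding bounded_image_iff using g by auto
  have "autocorrelation m g x - autocorrelation m g y = m (\<lambda>u. g (u \<otimes> x) * g u - g (u \<otimes> y) * g u)"
    unfolding autocorrelation_def using xy bd
    by (intro invariant_mean_diff[OF m, symmetric] bounded_image_mult bounded_translate)
  also have "\<bar>\<dots>\<bar> \<le> d * b"
  proof (rule invariant_mean_abs_le[OF m])
    fix u assume u: "u \<in> carrier G"
    have "\<bar>g (u \<otimes> x) * g u - g (u \<otimes> y) * g u\<bar> = \<bar>g (u \<otimes> x) - g (u \<otimes> y)\<bar> * \<bar>g u\<bar>"
      by (simp add: abs_mult[symmetric] left_diff_distrib)
    also have "\<dots> \<le> d * b"
      using d[OF u] g[OF u] by (intro mult_mono) auto
    finally show "\<bar>g (u \<otimes> x) * g u - g (u \<otimes> y) * g u\<bar> \<le> d * b" .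
  qed
  finally show ?thesis .
qed

lemma autocorrelation_abs_le:
  assumes m: "invariant_mean m" and g: "\<And>u. u \<in> carrier G \<Longrightarrow> \<bar>g u\<bar> \<le> b" and z: "z \<in> carrier G"
  shows "\<bar>autocorrelation m g z\<bar> \<le> b * b"
  unfolding autocorrelation_def
proof (rule invariant_mean_abs_le[OF m])
  fix u assume u: "u \<in> carrier G"
  have "\<bar>g (u \<otimes> z)\<bar> * \<bar>g u\<bar> \<le> b * b" using u z by (intro mult_mono g) (auto intro: order.trans[OF _ g])
  then show "\<bar>g (u \<otimes> z) * g u\<bar> \<le> b * b" by (simp add: abs_mult)
qed

text \<open>The source of nontriviality: averaged against a character \<phi>, the three terms
  combine to the factor \<open>2 - 2 * Re (\<phi> a)\<close>.\<close>

lemma autocorrelation_difference: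
  assumes m: "invariant_mean m" and f: "bounded (f ` carrier G)" and a: "a \<in> carrier G" and z: "z \<in> carrier G"
  shows "autocorrelation m (\<lambda>u. f (u \<otimes> a) - f u) z
    = 2 * autocorrelation m f z - autocorrelation m f (z \<otimes> a) - autocorrelation m f (z \<otimes> inv a)"
proof -
  define g where "g = (\<lambda>u. f (u \<otimes> a) - f u)"
  have bt: "bounded ((\<lambda>u. f (u \<otimes> x)) ` carrier G)" if "x \<in> carrier G" for x using bounded_translate[OF f that] .
  have g: "bounded (g ` carrier G)"
    unfolding g_def using bounded_minus_comp[OF bt[OF a] f] .
  note b = bounded_image_mult bt
  have q: "m (\<lambda>u. f (u \<otimes> x) * f (u \<otimes> y)) = autocorrelation m f (x \<otimes> inv y)"
    if "x \<in> carrier G" "y \<in> carrier G" for x y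
    using autocorrelation_quotient[OF m f that] by simp
  have "autocorrelation m g z = m (\<lambda>u. g (u \<otimes> z) * g (u \<otimes> \<one>))"
    using autocorrelation_quotient[OF m g z one_closed] z by simp
  also have "\<dots> = m (\<lambda>u. (f (u \<otimes> z \<otimes> a) * f (u \<otimes> \<one> \<otimes> a) + f (u \<otimes> z) * f (u \<otimes> \<one>))
       - (f (u \<otimes> z \<otimes> a) * f (u \<otimes> \<one>) + f (u \<otimes> z) * f (u \<otimes> \<one> \<otimes> a)))"
    unfolding g_def by (rule arg_cong[where f = m]) (simp add: fun_eq_iff algebra_simps)
  also have "\<dots> = m (\<lambda>u. (f (u \<otimes> (z \<otimes> a)) * f (u \<otimes> a) + f (u \<otimes> z) * f (u \<otimes> \<one>))
       - (f (u \<otimes> (z \<otimes> a)) * f (u \<otimes> \<one>) + f (u \<otimes> z) * f (u \<otimes> a)))" (is "m ?L = m ?R")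
  proof -
    have bL: "bounded (?L ` carrier G)"
      using bounded_image_mult[OF bounded_translate[OF g z] bounded_translate[OF g one_closed]]
      unfolding g_def by (simp add: algebra_simps)
    have bR: "bounded (?R ` carrier G)"
      using a z by (intro bounded_minus_comp bounded_plus_comp b) auto
    have "\<bar>m (\<lambda>u. ?L u - ?R u)\<bar> \<le> 0"
      using a z by (intro invariant_mean_abs_le[OF m]) (simp add: m_assoc)
    then show ?thesis unfolding invariant_mean_diff[OF m bL bR] by simp
  qed
  also have "\<dots> = (m (\<lambda>u. f (u \<otimes> (z \<otimes> a)) * f (u \<otimes> a)) + m (\<lambda>u. f (u \<otimes> z) * f (u \<otimes> \<one>)))
       - (m (\<lambda>u. f (u \<otimes> (z \<otimes> a)) * f (u \<otimes> \<one>)) + m (\<lambda>u. f (u \<otimes> z) * f (u \<otimes> a)))"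
  proof -
    have 1: "bounded ((\<lambda>u. f (u \<otimes> (z \<otimes> a)) * f (u \<otimes> a)) ` carrier G)"
      and 2: "bounded ((\<lambda>u. f (u \<otimes> z) * f (u \<otimes> \<one>)) ` carrier G)"
      and 3: "bounded ((\<lambda>u. f (u \<otimes> (z \<otimes> a)) * f (u \<otimes> \<one>)) ` carrier G)"
      and 4: "bounded ((\<lambda>u. f (u \<otimes> z) * f (u \<otimes> a)) ` carrier G)"
      using a z by (intro b; simp)+
    show ?thesis
      using invariant_mean_diff[OF m bounded_plus_comp[OF 1 2] bounded_plus_comp[OF 3 4]]
        invariant_mean_add[OF m 1 2] invariant_mean_add[OF m 3 4] by simp
  qed
  also have "\<dots> = autocorrelation m f (z \<otimes> a \<otimes> inv a) + autocorrelation m f (z \<otimes> inv \<one>)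
      - (autocorrelation m f (z \<otimes> a \<otimes> inv \<one>) + autocorrelation m f (z \<otimes> inv a))"
    using a z by (simp only: q m_closed one_closed)
  also have "z \<otimes> a \<otimes> inv a = z" using a z by (simp add: m_assoc)
  finally show ?thesis using a z by (simp add: g_def)
qed

text \<open>Average the pointwise lower bound and undo each translate at the cost
  \<open>e * B\<close>.\<close>

lemma finite_average_sum_translates_ge:
  assumes M: "0 < M" and p: "\<And>i. p i \<in> carrier G"
    and inv: "\<And>d. d \<in> D \<Longrightarrow> almost_invariant M p d e TYPE(complex)"
    and B: "\<And>x. x \<in> carrier G \<Longrightarrow> \<bar>Q x\<bar> \<le> B"
    and h: "\<And>x. x \<in> carrier G \<Longrightarrow> h \<le> (\<Sum>d\<in>D. Q (x \<otimes> d))"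
  shows "h \<le> card D * (Re (finite_average M p (\<lambda>x. complex_of_real (Q x))) + e * B)"
proof -
  define q where "q = (\<lambda>x. complex_of_real (Q x))"
  have Re: "Re (finite_average M p (\<lambda>x. complex_of_real (R x))) = (\<Sum>i<M. R (p i)) / M" for R
    by (simp add: finite_average_def divide_inverse)
  have "h = (\<Sum>i<M. h) / M" using M by simp
  also have "\<dots> \<le> (\<Sum>i<M. \<Sum>d\<in>D. Q (p i \<otimes> d)) / M"
    using p h by (intro divide_right_mono sum_mono) auto
  also have "\<dots> = (\<Sum>d\<in>D. Re (finite_average M p (\<lambda>x. q (x \<otimes> d))))"
    unfolding q_def Re by (subst sum.swap) (simp add: sum_divide_distrib)
  also have "\<dots> \<le> (\<Sum>d\<in>D. Re (finite_average M p q) + e * B)"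
  proof (rule sum_mono)
    fix d assume "d \<in> D"
    then have "cmod (finite_average M p (\<lambda>x. q (x \<otimes> d)) - finite_average M p q) \<le> e * B"
      using inv[unfolded almost_invariant_def, rule_format, of d q B] B by (simp add: q_def)
    then show "Re (finite_average M p (\<lambda>x. q (x \<otimes> d))) \<le> Re (finite_average M p q) + e * B"
      using abs_Re_le_cmod[of "finite_average M p (\<lambda>x. q (x \<otimes> d)) - finite_average M p q"] by simp
  qed
  finally show ?thesis by (simp add: q_def)
qed

text \<open>A character correlated with \<open>P\<close> is nearly invariant under the almost periods of \<open>f\<close>, and
  nontrivial at \<open>a\<close> because \<open>P\<close> is a difference of translates by \<open>a\<close>. Such characters are first
  obtained up to errors, and on finitely many points.\<close>

theorem almost_periodic_character:
  fixes f :: "'a \<Rightarrow> real"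
  assumes f1: "\<And>x. x \<in> carrier G \<Longrightarrow> \<bar>f x\<bar> \<le> 1" and ap: "almost_periodic f"
    and a: "a \<in> carrier G" and fa: "f a \<noteq> f \<one>"
  obtains \<theta> K where "\<theta> \<in> normalized_pd"
    "\<And>x y. \<lbrakk>x \<in> carrier G; y \<in> carrier G\<rbrakk> \<Longrightarrow> \<theta> (x \<otimes> y) = \<theta> x * \<theta> y"
    "\<theta> a \<noteq> 1"
    "\<And>z d. \<lbrakk>z \<in> carrier G; \<And>u. u \<in> carrier G \<Longrightarrow> \<bar>f (u \<otimes> z) - f u\<bar> \<le> d\<rbrakk> \<Longrightarrow> cmod (\<theta> z - 1) \<le> K * d"
proof -
  obtain m where m: "invariant_mean m" using invariant_mean_exists by blast
  define g where "g = (\<lambda>u. f (u \<otimes> a) - f u)"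
  define P where "P = autocorrelation m g"
  define Pf where "Pf = autocorrelation m f"
  have f_bd: "bounded (f ` carrier G)" unfolding bounded_image_iff using f1 by auto
  have g2: "\<bar>g u\<bar> \<le> 2" if "u \<in> carrier G" for u
    using f1[OF that] f1[of "u \<otimes> a"] that a unfolding g_def by fastforce
  then have g_bd: "bounded (g ` carrier G)" unfolding bounded_image_iff by auto
  have g_diff: "\<bar>g (u \<otimes> x) - g (u \<otimes> y)\<bar> \<le> 2 * d"
    if "\<And>u. u \<in> carrier G \<Longrightarrow> \<bar>f (u \<otimes> x) - f (u \<otimes> y)\<bar> \<le> d" "u \<in> carrier G" "x \<in> carrier G" "y \<in> carrier G"
    for u x y d
  proof -
    have "u \<otimes> x \<otimes> a = u \<otimes> a \<otimes> x" "u \<otimes> y \<otimes> a = u \<otimes> a \<otimes> y" using that a by (simp_all add: m_ac)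
    then show ?thesis using that(1)[of u] that(1)[of "u \<otimes> a"] that(2) a unfolding g_def by simp
  qed
  have P_diff: "\<bar>P x - P y\<bar> \<le> 4 * d"
    if "\<And>u. u \<in> carrier G \<Longrightarrow> \<bar>f (u \<otimes> x) - f (u \<otimes> y)\<bar> \<le> d" "x \<in> carrier G" "y \<in> carrier G" for x y d
    using autocorrelation_diff_le[OF m, where g = g and b = 2 and x = x and y = y and d = "2 * d"] g2 g_diff that unfolding P_def by simp
  have g_ap: "almost_periodic g"
    unfolding almost_periodic_def
  proof (intro allI impI)
    fix e :: real assume "0 < e"
    then obtain D where D: "finite D" "D \<subseteq> carrier G"
      "\<And>x. x \<in> carrier G \<Longrightarrow> \<exists>d\<in>D. \<forall>u\<in>carrier G. \<bar>f (u \<otimes> x) - f (u \<otimes> d)\<bar> \<le> e / 2"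
      using ap unfolding almost_periodic_def by (meson half_gt_zero)
    have "\<exists>d\<in>D. \<forall>u\<in>carrier G. \<bar>g (u \<otimes> x) - g (u \<otimes> d)\<bar> \<le> e" if x: "x \<in> carrier G" for x
    proof -
      obtain d where d: "d \<in> D" "\<And>u. u \<in> carrier G \<Longrightarrow> \<bar>f (u \<otimes> x) - f (u \<otimes> d)\<bar> \<le> e / 2"
        using D(3)[OF x] by blast
      then have "\<bar>g (u \<otimes> x) - g (u \<otimes> d)\<bar> \<le> 2 * (e / 2)" if "u \<in> carrier G" for u
        using that x D(2) by (intro g_diff) auto
      then show ?thesis using d(1) by auto
    qed
    then show "\<exists>D. finite D \<and> D \<subseteq> carrier G \<and> (\<forall>x\<in>carrier G. \<exists>d\<in>D. \<forall>u\<in>carrier G. \<bar>g (u \<otimes> x) - g (u \<otimes> d)\<bar> \<le> e)"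
      using D by blast
  qed
  have P_ap: "almost_periodic P"
    unfolding almost_periodic_def
  proof (intro allI impI)
    fix e :: real assume "0 < e"
    then obtain D where D: "finite D" "D \<subseteq> carrier G"
      "\<And>x. x \<in> carrier G \<Longrightarrow> \<exists>d\<in>D. \<forall>u\<in>carrier G. \<bar>f (u \<otimes> x) - f (u \<otimes> d)\<bar> \<le> e / 4"
      using ap unfolding almost_periodic_def by (metis zero_less_divide_iff zero_less_numeral)
    have "\<exists>d\<in>D. \<forall>u\<in>carrier G. \<bar>P (u \<otimes> x) - P (u \<otimes> d)\<bar> \<le> e" if x: "x \<in> carrier G" for x
    proof -
      obtain d where d: "d \<in> D" "\<And>u. u \<in> carrier G \<Longrightarrow> \<bar>f (u \<otimes> x) - f (u \<otimes> d)\<bar> \<le> e / 4"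
        using D(3)[OF x] by blast
      have "\<bar>P (u \<otimes> x) - P (u \<otimes> d)\<bar> \<le> 4 * (e / 4)" if u: "u \<in> carrier G" for u
      proof (rule P_diff)
        fix w assume "w \<in> carrier G"
        then show "\<bar>f (w \<otimes> (u \<otimes> x)) - f (w \<otimes> (u \<otimes> d))\<bar> \<le> e / 4"
          using d(2)[of "w \<otimes> u"] u x d(1) D(2) by (simp add: m_assoc subset_iff)
      qed (use u x d D in auto)
      then show ?thesis using d(1) by auto
    qed
    then show "\<exists>D. finite D \<and> D \<subseteq> carrier G \<and> (\<forall>x\<in>carrier G. \<exists>d\<in>D. \<forall>u\<in>carrier G. \<bar>P (u \<otimes> x) - P (u \<otimes> d)\<bar> \<le> e)"
      using D by blast
  qed
  define c0 where "c0 = P \<one>"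
  \<comment> \<open>By invariance every translate of the square of \<open>g\<close> has mean
    \<open>c0\<close>, and finitely many of these translates add up to at least
    \<open>h\<close>.\<close>
  have c0: "0 < c0"
  proof -
    have "g \<one> \<noteq> 0" using fa a by (simp add: g_def)
    then obtain D h where D: "finite D" "D \<subseteq> carrier G" and "0 < h"
      and h: "\<And>x. x \<in> carrier G \<Longrightarrow> h \<le> (\<Sum>d\<in>D. (g (x \<otimes> d))\<^sup>2)"
      using almost_periodic_sum_squares[OF g_ap] by blast
    obtain n d where nd: "D = d ` {i. i < (n::nat)}" "inj_on d {i. i < n}"
      using finite_imp_nat_seg_image_inj_on[OF D(1)] by metis
    have dc: "d i \<in> carrier G" if "i < n" for i using nd D that by auto
    have sq: "bounded ((\<lambda>x. (g (x \<otimes> y))\<^sup>2) ` carrier G)" if "y \<in> carrier G" for y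
      unfolding power2_eq_square by (intro bounded_image_mult bounded_translate g_bd that)
    have "m (\<lambda>x. (g (x \<otimes> y))\<^sup>2) = c0" if "y \<in> carrier G" for y
      unfolding c0_def P_def using autocorrelation_quotient[OF m g_bd that that] that
      by (simp add: power2_eq_square)
    then have "m (\<lambda>x. \<Sum>i<n. (g (x \<otimes> d i))\<^sup>2) = n * c0"
      using dc sq by (subst invariant_mean_sum[OF m]) auto
    moreover have "h \<le> m (\<lambda>x. \<Sum>i<n. (g (x \<otimes> d i))\<^sup>2)"
    proof (rule invariant_mean_ge[OF m])
      fix x assume "x \<in> carrier G"
      then show "h \<le> (\<Sum>i<n. (g (x \<otimes> d i))\<^sup>2)"
        using h[of x] nd(2) unfolding nd(1) by (simp add: sum.reindex lessThan_def)
    qed (use dc sq in \<open>auto intro!: bounded_image_sum\<close>)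
    ultimately have "0 < n * c0" using \<open>0 < h\<close> by simp
    then show ?thesis by (simp add: zero_less_mult_iff)
  qed
  \<comment> \<open>The same argument for \<open>P\<close> bounds the averages of its square below;
    divided by \<open>c0\<close>, these averages are the correlations of \<open>\<psi>\<close> with
    \<open>P\<close>.\<close>
  obtain D h where D: "finite D" "D \<subseteq> carrier G" and h0: "0 < h"
    and h: "\<And>x. x \<in> carrier G \<Longrightarrow> h \<le> (\<Sum>d\<in>D. (P (x \<otimes> d))\<^sup>2)"
    using almost_periodic_sum_squares[OF P_ap] c0 unfolding c0_def by (metis less_irrefl)
  have "D \<noteq> {}" using h[OF one_closed] h0 by auto
  then have cardD: "0 < card D" using D by (simp add: card_gt_0_iff)
  have P4: "\<bar>P x\<bar> \<le> 4" if "x \<in> carrier G" for x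
    using autocorrelation_abs_le[where g = g and b = 2, OF m g2 that] by (simp add: P_def)
  have Pf1: "\<bar>Pf x\<bar> \<le> 1" if "x \<in> carrier G" for x
    using autocorrelation_abs_le[where g = f and b = 1, OF m f1 that] by (simp add: Pf_def)
  have PPf: "P z = 2 * Pf z - Pf (z \<otimes> a) - Pf (z \<otimes> inv a)" if "z \<in> carrier G" for z
    using autocorrelation_difference[OF m f_bd a that] unfolding P_def Pf_def g_def .
  define \<psi> where "\<psi> = (\<lambda>x. if x \<in> carrier G then complex_of_real (P x / c0) else 0)"
  have \<psi>: "\<psi> \<in> normalized_pd"
    using autocorrelation_normalized_pd[OF m g_bd] c0 unfolding \<psi>_def P_def c0_def by simp
  \<comment> \<open>Half of the lower bound for that correlation: the maximization and the finite
    averaging may each lose \<open>\<kappa> / 2\<close>, and \<open>\<kappa>\<close>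
    remains.\<close>
  define \<kappa> where "\<kappa> = h / card D / c0 / 2"
  have \<kappa>: "0 < \<kappa>" using h0 cardD c0 by (simp add: \<kappa>_def)
  \<comment> \<open>Multiplicativity is required exactly, and only the two estimates carry the
    tolerance. Each single equation or inequality involves finitely many values of
    \<open>\<theta>\<close>, so all of them persist under pointwise limits.\<close>
  define Q where "Q z e \<theta> \<longleftrightarrow> (\<forall>x\<in>carrier G. \<theta> (x \<otimes> z) = \<theta> x * \<theta> z) \<and>
     (\<forall>d. (\<forall>u\<in>carrier G. \<bar>f (u \<otimes> z) - f u\<bar> \<le> d) \<longrightarrow> \<kappa> * cmod (\<theta> z - 1) \<le> 4 * d + e) \<and>
     \<kappa> \<le> 2 - 2 * Re (\<theta> a) + e" for z e and \<theta> :: "'a \<Rightarrow> complex"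
  have ev: "continuous_on UNIV (\<lambda>\<phi> :: 'a \<Rightarrow> complex. \<phi> x)" for x
    by (rule continuous_on_product_coordinates)
  have "\<exists>\<theta>\<in>normalized_pd. \<forall>z\<in>carrier G. \<forall>e>0. Q z e \<theta>"
  proof (rule compact_exists_all_tolerances[OF compact_normalized_pd])
    show "closed {\<theta>. Q z e \<theta>}" for z e
      unfolding Q_def Ball_def
      by (intro closed_Collect_conj closed_Collect_all closed_Collect_imp open_Collect_const
          closed_Collect_eq closed_Collect_le continuous_intros ev)
    show "Q z e' \<theta>" if "e \<le> e'" "Q z e \<theta>" for z e e' \<theta>
      using that unfolding Q_def by force
    fix S and e :: real assume S: "finite S" "S \<subseteq> carrier G" "0 < e"
    \<comment> \<open>The nontriviality estimate shifts averages by both \<open>a\<close> and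
      \<open>inv a\<close>.\<close>
    define F where "F = insert a (insert (inv a) S)"
    \<comment> \<open>The shift errors below are \<open>4 * \<epsilon>\<close> and
      \<open>2 * \<epsilon>\<close> and must stay within \<open>e\<close>. The second bound handles
      the square of \<open>P\<close>, which is at most 16 and hence costs
      \<open>16 * \<epsilon> / c0\<close>.\<close>
    define \<epsilon> where "\<epsilon> = min (e / 4) (\<kappa> * c0 / 32)"
    have \<epsilon>: "0 < \<epsilon>" "4 * \<epsilon> \<le> e" "16 * \<epsilon> / c0 \<le> \<kappa> / 2"
    proof -
      have "\<epsilon> \<le> \<kappa> * c0 / 32" by (simp add: \<epsilon>_def)
      then show "16 * \<epsilon> / c0 \<le> \<kappa> / 2" using c0 by (simp add: field_simps)
    qed (use S \<kappa> c0 in \<open>auto simp: \<epsilon>_def\<close>)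
    have FD: "finite (F \<union> D)" "F \<union> D \<subseteq> carrier G" using S D a by (auto simp: F_def)
    obtain M p where M: "0 < M" and p: "\<And>i. p i \<in> carrier G"
      and inv: "\<And>y. y \<in> F \<union> D \<Longrightarrow> almost_invariant M p y \<epsilon> TYPE(complex)"
      using almost_invariant_averages[OF FD \<epsilon>(1)] by metis
    define A where "A H = finite_average M p H" for H :: "'a \<Rightarrow> complex"
    have A_le: "cmod (A H) \<le> b" if "\<And>x. x \<in> carrier G \<Longrightarrow> cmod (H x) \<le> b" for H b
      unfolding A_def using M p that by (intro finite_average_norm_le) auto
    have A_diff_le: "cmod (A H - A H') \<le> b" if "\<And>x. x \<in> carrier G \<Longrightarrow> cmod (H x - H' x) \<le> b" for H H' b
      unfolding A_def using M p that by (intro finite_average_diff_norm_le) auto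
    have A_cong: "A H = A H'" if "\<And>x. x \<in> carrier G \<Longrightarrow> H x = H' x" for H H'
      unfolding A_def finite_average_def using p that by simp
    have A_shift: "cmod (A (\<lambda>x. H (x \<otimes> y)) - A H) \<le> \<epsilon> * b"
      if "y \<in> F" "\<And>x. x \<in> carrier G \<Longrightarrow> cmod (H x) \<le> b" for H y b
      using inv that unfolding almost_invariant_def A_def by blast
    have Fc: "F \<subseteq> carrier G" "finite F" using FD by auto
    have "0 < \<kappa> / 2" using \<kappa> by simp
    then obtain \<phi> where \<phi>: "\<phi> \<in> normalized_pd"
      and big: "Re (A (\<lambda>x. \<psi> x * P x)) - \<kappa> / 2 \<le> Re (A (\<lambda>x. \<phi> x * P x))"
      and mult: "\<And>x z. x \<in> F \<Longrightarrow> z \<in> carrier G \<Longrightarrow> \<phi> (x \<otimes> z) = \<phi> x * \<phi> z"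
      using maximizing_multiplicative_pd[where p = p and \<eta> = "\<kappa> / 2" and M = M and P = "\<lambda>x. complex_of_real (P x)", OF Fc(2,1) p _ \<psi>]
      unfolding A_def by metis
    have mult': "\<phi> (x \<otimes> z) = \<phi> x * \<phi> z" if "x \<in> carrier G" "z \<in> F" for x z
      using mult[OF that(2,1)] that Fc by (simp add: m_comm subset_iff mult.commute)
    note \<phi>1 = normalized_pd_norm_le_1[OF \<phi>]
    define R where "R = A (\<lambda>x. \<phi> x * P x)"
    have "\<kappa> \<le> Re R"
    proof -
      have P16: "\<bar>(P x)\<^sup>2\<bar> \<le> 16" if "x \<in> carrier G" for x
        using power_mono[OF P4[OF that], of 2] by simp
      have "h \<le> card D * (Re (A (\<lambda>x. complex_of_real ((P x)\<^sup>2))) + \<epsilon> * 16)"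
        unfolding A_def using inv h P16
        by (intro finite_average_sum_translates_ge[where p = p, OF M p]) auto
      then have "h / card D \<le> Re (A (\<lambda>x. complex_of_real ((P x)\<^sup>2))) + \<epsilon> * 16"
        using cardD by (simp add: divide_le_eq mult.commute)
      then have "h / card D / c0 \<le> (Re (A (\<lambda>x. complex_of_real ((P x)\<^sup>2))) + \<epsilon> * 16) / c0"
        using c0 by (intro divide_right_mono) auto
      moreover have "A (\<lambda>x. \<psi> x * P x) = A (\<lambda>x. complex_of_real (1 / c0) * complex_of_real ((P x)\<^sup>2))"
        by (rule A_cong) (simp add: \<psi>_def power2_eq_square)
      then have "Re (A (\<lambda>x. \<psi> x * P x)) = Re (A (\<lambda>x. complex_of_real ((P x)\<^sup>2))) / c0"
        unfolding A_def finite_average_mult by (simp del: of_real_divide)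
      ultimately have "2 * \<kappa> \<le> Re (A (\<lambda>x. \<psi> x * P x)) + 16 * \<epsilon> / c0"
        by (simp add: \<kappa>_def add_divide_distrib mult.commute)
      then show ?thesis using big \<epsilon>(3) unfolding R_def by linarith
    qed
    then have R: "\<kappa> \<le> cmod R" using complex_Re_le_cmod[of R] by linarith
    \<comment> \<open>Shifting the average of \<open>\<phi> * P\<close> by \<open>z\<close> pulls
      out the factor \<open>\<phi> z\<close>, and replacing the shifted \<open>P\<close> by
      \<open>P\<close> costs \<open>4 * d\<close>. So \<open>\<phi> z * R\<close> is close to
      \<open>R\<close>, while \<open>R\<close> stays away from 0.\<close>
    have near1: "\<kappa> * cmod (\<phi> z - 1) \<le> 4 * d + e"
      if z: "z \<in> S" and d: "\<forall>u\<in>carrier G. \<bar>f (u \<otimes> z) - f u\<bar> \<le> d" for z d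
    proof -
      have zF: "z \<in> F" and zc: "z \<in> carrier G" using z S by (auto simp: F_def)
      have bnd: "cmod (\<phi> x * P x) \<le> 4" if "x \<in> carrier G" for x
        using mult_mono[OF \<phi>1 P4[OF that], of x] by (simp add: norm_mult)
      have 1: "cmod (A (\<lambda>x. \<phi> (x \<otimes> z) * P (x \<otimes> z)) - R) \<le> \<epsilon> * 4"
        unfolding R_def using A_shift[OF zF, of "\<lambda>x. \<phi> x * P x" 4] bnd by simp
      have 2: "A (\<lambda>x. \<phi> (x \<otimes> z) * P (x \<otimes> z)) = \<phi> z * A (\<lambda>x. \<phi> x * P (x \<otimes> z))"
        unfolding A_def finite_average_mult[symmetric]
        by (rule A_cong[unfolded A_def]) (simp add: mult' zF)
      have 3: "cmod (A (\<lambda>x. \<phi> x * P (x \<otimes> z)) - R) \<le> 4 * d"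
        unfolding R_def
      proof (rule A_diff_le)
        fix x assume x: "x \<in> carrier G"
        have "\<bar>P (x \<otimes> z) - P x\<bar> \<le> 4 * d"
        proof (rule P_diff)
          fix u assume "u \<in> carrier G"
          then show "\<bar>f (u \<otimes> (x \<otimes> z)) - f (u \<otimes> x)\<bar> \<le> d"
            using d[rule_format, of "u \<otimes> x"] x zc by (simp add: m_assoc)
        qed (use x zc in auto)
        moreover have "\<phi> x * P (x \<otimes> z) - \<phi> x * P x = \<phi> x * of_real (P (x \<otimes> z) - P x)"
          by (simp add: algebra_simps)
        moreover have "cmod (\<phi> x * of_real (P (x \<otimes> z) - P x)) \<le> 1 * \<bar>P (x \<otimes> z) - P x\<bar>"
          unfolding norm_mult norm_of_real by (intro mult_right_mono \<phi>1) simp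
        ultimately show "cmod (\<phi> x * P (x \<otimes> z) - \<phi> x * P x) \<le> 4 * d" by simp
      qed
      have "\<kappa> * cmod (\<phi> z - 1) \<le> cmod R * cmod (\<phi> z - 1)" using R by (intro mult_right_mono) auto
      also have "\<dots> = cmod ((\<phi> z * A (\<lambda>x. \<phi> x * P (x \<otimes> z)) - R) - \<phi> z * (A (\<lambda>x. \<phi> x * P (x \<otimes> z)) - R))"
        unfolding norm_mult[symmetric] by (simp add: algebra_simps)
      also have "\<dots> \<le> cmod (\<phi> z * A (\<lambda>x. \<phi> x * P (x \<otimes> z)) - R) + cmod (\<phi> z * (A (\<lambda>x. \<phi> x * P (x \<otimes> z)) - R))"
        by (rule norm_triangle_ineq4)
      also have "\<dots> \<le> \<epsilon> * 4 + 1 * (4 * d)"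
        using 1 2 3 \<phi>1[of z] unfolding norm_mult by (intro add_mono mult_mono) auto
      finally show ?thesis using \<epsilon>(2) by simp
    qed
    \<comment> \<open>The decomposition of \<open>P\<close> into translates of \<open>Pf\<close>
      makes \<open>R\<close>, up to \<open>2 * \<epsilon>\<close>, the product of
      \<open>2 - 2 * Re (\<phi> a)\<close> and a number of modulus at most 1.\<close>
    have nontriv: "\<kappa> \<le> 2 - 2 * Re (\<phi> a) + e"
    proof -
      define Rf where "Rf = A (\<lambda>x. \<phi> x * Pf x)"
      have bnd: "cmod (\<phi> x * Pf x) \<le> 1" if "x \<in> carrier G" for x
        using mult_mono[OF \<phi>1 Pf1[OF that], of x] by (simp add: norm_mult)
      have shift: "cmod (A (\<lambda>x. \<phi> x * Pf (x \<otimes> b)) - cnj (\<phi> b) * Rf) \<le> \<epsilon>"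
        if b: "b \<in> F" for b
      proof -
        have bc: "b \<in> carrier G" using b Fc by auto
        \<comment> \<open>\<open>\<phi>\<close> is not yet a character, but multiplicativity with
          one factor in \<open>F\<close> already makes \<open>\<phi> b\<close> unimodular.\<close>
        have "\<phi> (b \<otimes> inv b) = \<phi> b * \<phi> (inv b)" using mult[OF b, of "inv b"] bc by simp
        then have unit: "\<phi> b * cnj (\<phi> b) = 1" using bc by (simp add: normalized_pd_simps[OF \<phi>])
        then have "cmod (\<phi> b) * cmod (\<phi> b) = 1"
          by (metis complex_mod_cnj norm_mult norm_one)
        then have nb: "cmod (\<phi> b) = 1"
          using norm_ge_zero[of "\<phi> b"] by (simp add: square_eq_1_iff)
        have "cmod (A (\<lambda>x. \<phi> (x \<otimes> b) * Pf (x \<otimes> b)) - Rf) \<le> \<epsilon> * 1"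
          unfolding Rf_def using A_shift[OF b, of "\<lambda>x. \<phi> x * Pf x" 1] bnd by simp
        moreover have "A (\<lambda>x. \<phi> (x \<otimes> b) * Pf (x \<otimes> b)) = \<phi> b * A (\<lambda>x. \<phi> x * Pf (x \<otimes> b))"
          unfolding A_def finite_average_mult[symmetric]
          by (rule A_cong[unfolded A_def]) (simp add: mult' b)
        moreover have "\<phi> b * A (\<lambda>x. \<phi> x * Pf (x \<otimes> b)) - Rf = \<phi> b * (A (\<lambda>x. \<phi> x * Pf (x \<otimes> b)) - cnj (\<phi> b) * Rf)"
          using unit by (simp add: algebra_simps flip: mult.assoc)
        ultimately show ?thesis using nb by (simp add: norm_mult)
      qed
      have "R = A (\<lambda>x. 2 * (\<phi> x * Pf x) - \<phi> x * Pf (x \<otimes> a) - \<phi> x * Pf (x \<otimes> inv a))"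
        unfolding R_def by (rule A_cong) (simp add: PPf algebra_simps)
      also have "\<dots> = 2 * Rf - A (\<lambda>x. \<phi> x * Pf (x \<otimes> a)) - A (\<lambda>x. \<phi> x * Pf (x \<otimes> inv a))"
        by (simp add: A_def Rf_def finite_average_diff finite_average_mult)
      finally have "R = (2 - cnj (\<phi> a) - cnj (\<phi> (inv a))) * Rf - (A (\<lambda>x. \<phi> x * Pf (x \<otimes> a)) - cnj (\<phi> a) * Rf)
          - (A (\<lambda>x. \<phi> x * Pf (x \<otimes> inv a)) - cnj (\<phi> (inv a)) * Rf)" (is "_ = ?T - ?U - ?V")
        by (simp add: algebra_simps)
      then have "cmod R = cmod (?T - ?U - ?V)" by (rule arg_cong)
      then have "cmod R \<le> cmod ?T + cmod ?U + cmod ?V"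
        using norm_triangle_ineq4[of "?T - ?U" ?V] norm_triangle_ineq4[of ?T ?U] by linarith
      moreover have "cmod ?U \<le> \<epsilon>" "cmod ?V \<le> \<epsilon>" using shift[of a] shift[of "inv a"] by (auto simp: F_def)
      moreover have "cmod ?T \<le> 2 - 2 * Re (\<phi> a)"
      proof -
        have "2 - cnj (\<phi> a) - cnj (\<phi> (inv a)) = of_real (2 - 2 * Re (\<phi> a))"
          using a by (simp add: normalized_pd_simps[OF \<phi>] complex_eq_iff)
        moreover have "Re (\<phi> a) \<le> 1" using complex_Re_le_cmod[of "\<phi> a"] \<phi>1[of a] by linarith
        moreover have "cmod Rf \<le> 1" unfolding Rf_def by (rule A_le) (rule bnd)
        ultimately have "cmod ?T \<le> (2 - 2 * Re (\<phi> a)) * 1"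
          unfolding norm_mult by (intro mult_mono) (simp_all del: of_real_diff)
        then show ?thesis by simp
      qed
      ultimately have "cmod R \<le> 2 - 2 * Re (\<phi> a) + \<epsilon> + \<epsilon>"
        by (meson add_mono order.trans)
      then show ?thesis using R \<epsilon>(1,2) by linarith
    qed
    have "Q z e \<phi>" if z: "z \<in> S" for z
      using mult' near1[OF z] nontriv z unfolding Q_def F_def by blast
    then show "\<exists>\<theta>\<in>normalized_pd. \<forall>z\<in>S. Q z e \<theta>" using \<phi> by blast
  qed
  then obtain \<theta> where \<theta>: "\<theta> \<in> normalized_pd" and Q: "\<And>z e. \<lbrakk>z \<in> carrier G; 0 < e\<rbrakk> \<Longrightarrow> Q z e \<theta>"
    by blast
  show thesis
  proof (rule that[OF \<theta>])
    show "\<theta> (x \<otimes> y) = \<theta> x * \<theta> y" if "x \<in> carrier G" "y \<in> carrier G" for x y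
      using Q[OF that(2), of 1] that(1) unfolding Q_def by simp
    \<comment> \<open>With \<open>\<theta> a = 1\<close> the third condition at this tolerance would
      read \<open>\<kappa> \<le> \<kappa> / 2\<close>.\<close>
    show "\<theta> a \<noteq> 1" using Q[OF a, of "\<kappa> / 2"] \<kappa> unfolding Q_def by auto
    show "cmod (\<theta> z - 1) \<le> 4 / \<kappa> * d"
      if z: "z \<in> carrier G" and d: "\<And>u. u \<in> carrier G \<Longrightarrow> \<bar>f (u \<otimes> z) - f u\<bar> \<le> d" for z d
    proof -
      have "\<kappa> * cmod (\<theta> z - 1) \<le> 4 * d"
      proof (rule field_le_epsilon)
        fix e :: real assume "0 < e"
        then show "\<kappa> * cmod (\<theta> z - 1) \<le> 4 * d + e" using Q[OF z] d unfolding Q_def by simp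
      qed
      then show ?thesis using \<kappa> by (simp add: field_simps)
    qed
  qed
qed

end

section \<open>Characters of precompact groups\<close>

context topological_group
begin

lemma continuous_map_left_mult:
  assumes "l \<in> carrier G" shows "continuous_map T T (\<lambda>x. l \<otimes> x)"
proof -
  have "continuous_map T (prod_topology T T) (\<lambda>x. (l, x))"
    using assms by (simp add: continuous_map_pairwise o_def topspace_eq)
  from continuous_map_compose[OF this continuous_mult] show ?thesis by (simp add: o_def)
qed

text \<open>Tube lemma along the slice over \<open>\<one>\<close>, where the difference
  vanishes.\<close>

lemma uniformly_continuous_right:
  fixes h :: "'a \<Rightarrow> real"
  assumes "compact_space T" and h: "continuous_map T euclideanreal h" and e: "0 < e"
  obtains W where "openin T W" "\<one> \<in> W"
    "\<And>k w. \<lbrakk>k \<in> carrier G; w \<in> W\<rbrakk> \<Longrightarrow> \<bar>h (k \<otimes> w) - h k\<bar> < e"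
proof -
  have "continuous_map (prod_topology T T) euclideanreal (h \<circ> (\<lambda>(x, y). x \<otimes> y))"
    by (rule continuous_map_compose[OF continuous_mult h])
  moreover have "continuous_map (prod_topology T T) euclideanreal (h \<circ> fst)"
    by (rule continuous_map_compose[OF continuous_map_fst h])
  ultimately have c: "continuous_map (prod_topology T T) euclideanreal
      (\<lambda>p. (h \<circ> (\<lambda>(x, y). x \<otimes> y)) p - (h \<circ> fst) p)"
    by (rule continuous_map_diff)
  define O1 where "O1 = {p \<in> topspace (prod_topology T T). (h \<circ> (\<lambda>(x, y). x \<otimes> y)) p - (h \<circ> fst) p \<in> {-e<..<e}}"
  have "openin (prod_topology T T) O1"
    unfolding O1_def by (rule openin_continuous_map_preimage[OF c]) simp
  moreover have "topspace T \<times> {\<one>} \<subseteq> O1" using e by (auto simp: O1_def topspace_eq)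
  moreover have "compactin T (topspace T)" using assms(1) by (simp add: compact_space_def)
  ultimately obtain U W where "openin T W" "topspace T \<subseteq> U" "\<one> \<in> W" "U \<times> W \<subseteq> O1"
    using tube_lemma_left[of T T O1 "topspace T" \<one>] topspace_eq by auto
  then show thesis using that[of W] by (force simp: O1_def topspace_eq abs_less_iff)
qed

end

text \<open>A Urysohn function on the compact group separates the images of \<open>a\<close> and the
  identity. Its uniform continuity gives the estimate near the identity and, with compactness, the
  finite nets of translates.\<close>

lemma precompact_separating_function:
  assumes G: "topological_group G T" and pre: "precompact_group TYPE('k) G T"
    and a: "a \<in> carrier G" "a \<noteq> \<one>\<^bsub>G\<^esub>"
  obtains f :: "'g \<Rightarrow> real" where "\<And>x. x \<in> carrier G \<Longrightarrow> \<bar>f x\<bar> \<le> 1" "comm_group G \<Longrightarrow> comm_group.almost_periodic G f"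
    "f a \<noteq> f \<one>\<^bsub>G\<^esub>"
    "\<And>e. 0 < e \<Longrightarrow> \<exists>W. openin T W \<and> \<one>\<^bsub>G\<^esub> \<in> W \<and>
       (\<forall>z\<in>W. \<forall>u\<in>carrier G. \<bar>f (u \<otimes>\<^bsub>G\<^esub> z) - f u\<bar> \<le> e)"
proof -
  obtain K :: "'k monoid" and S L \<phi> where K: "topological_group K S" and comp: "compact_space S"
    and L: "subgroup L K" and iso: "\<phi> \<in> iso G (K\<lparr>carrier := L\<rparr>)" and homeo: "homeomorphic_map T (subtopology S L) \<phi>"
    using pre unfolding precompact_group_def by blast
  interpret G: topological_group G T by fact
  interpret K: topological_group K S by fact
  have LK: "L \<subseteq> carrier K" using L by (rule subgroup.subset)
  have bij: "bij_betw \<phi> (carrier G) L" and mult: "\<And>x y. \<lbrakk>x \<in> carrier G; y \<in> carrier G\<rbrakk> \<Longrightarrow> \<phi> (x \<otimes>\<^bsub>G\<^esub> y) = \<phi> x \<otimes>\<^bsub>K\<^esub> \<phi> y"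
    using iso by (auto simp: iso_def hom_def)
  have \<phi>L: "\<phi> x \<in> L" if "x \<in> carrier G" for x using bij that by (auto simp: bij_betw_def)
  then have \<phi>K: "\<phi> x \<in> carrier K" if "x \<in> carrier G" for x using that LK by blast
  have one: "\<phi> \<one>\<^bsub>G\<^esub> = \<one>\<^bsub>K\<^esub>"
    using mult[of "\<one>\<^bsub>G\<^esub>" "\<one>\<^bsub>G\<^esub>"] \<phi>K by (metis G.l_one G.one_closed K.l_cancel_one)
  have \<phi>_cont: "continuous_map T S \<phi>"
    using homeomorphic_imp_continuous_map[OF homeo] by (rule continuous_map_into_fulltopology)
  have neq: "\<phi> a \<noteq> \<one>\<^bsub>K\<^esub>" using a one bij by (metis G.one_closed bij_betw_inv_into_left)
  have "normal_space S" using comp K.Hausdorff by (simp add: compact_Hausdorff_or_regular_imp_normal_space)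
  moreover have "closedin S {\<one>\<^bsub>K\<^esub>}" "closedin S {\<phi> a}"
    using K.Hausdorff a \<phi>K by (auto simp: closedin_Hausdorff_sing_eq K.topspace_eq)
  ultimately obtain h where h01: "continuous_map S (subtopology euclideanreal {0..1}) h" and "h ` {\<one>\<^bsub>K\<^esub>} \<subseteq> {0}" "h ` {\<phi> a} \<subseteq> {1}"
    using Urysohn_lemma[of S "{\<one>\<^bsub>K\<^esub>}" "{\<phi> a}" 0 1] neq by auto
  then have h: "continuous_map S euclideanreal h" and hr: "\<And>k. k \<in> carrier K \<Longrightarrow> 0 \<le> h k \<and> h k \<le> 1"
    and h_one: "h \<one>\<^bsub>K\<^esub> = 0" and h_a: "h (\<phi> a) = 1"
    by (auto simp: continuous_map_in_subtopology K.topspace_eq Pi_iff)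
  show thesis
  proof (rule that[of "h \<circ> \<phi>"])
    show "\<bar>(h \<circ> \<phi>) x\<bar> \<le> 1" if "x \<in> carrier G" for x using hr[OF \<phi>K[OF that]] by simp
    show "(h \<circ> \<phi>) a \<noteq> (h \<circ> \<phi>) \<one>\<^bsub>G\<^esub>" by (simp add: one h_one h_a)
    fix e :: real assume "0 < e"
    then obtain W where W: "openin S W" "\<one>\<^bsub>K\<^esub> \<in> W"
      and *: "\<And>k w. \<lbrakk>k \<in> carrier K; w \<in> W\<rbrakk> \<Longrightarrow> \<bar>h (k \<otimes>\<^bsub>K\<^esub> w) - h k\<bar> < e"
      using K.uniformly_continuous_right[OF comp h] by blast
    show "\<exists>W. openin T W \<and> \<one>\<^bsub>G\<^esub> \<in> W \<and> (\<forall>z\<in>W. \<forall>u\<in>carrier G. \<bar>(h \<circ> \<phi>) (u \<otimes>\<^bsub>G\<^esub> z) - (h \<circ> \<phi>) u\<bar> \<le> e)"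
    proof (intro exI conjI)
      show "openin T {x \<in> topspace T. \<phi> x \<in> W}" by (rule openin_continuous_map_preimage[OF \<phi>_cont W(1)])
    qed (use W one * \<phi>K mult in \<open>auto simp: G.topspace_eq less_imp_le\<close>)
  next
    assume "comm_group G"
    show "comm_group.almost_periodic G (h \<circ> \<phi>)"
      unfolding comm_group.almost_periodic_def[OF \<open>comm_group G\<close>]
    proof (intro allI impI)
      fix e :: real assume "0 < e"
      then obtain W where W: "openin S W" "\<one>\<^bsub>K\<^esub> \<in> W"
        and *: "\<And>k w. \<lbrakk>k \<in> carrier K; w \<in> W\<rbrakk> \<Longrightarrow> \<bar>h (k \<otimes>\<^bsub>K\<^esub> w) - h k\<bar> < e"
        using K.uniformly_continuous_right[OF comp h] by blast
      define V where "V l = {k \<in> topspace S. inv\<^bsub>K\<^esub> l \<otimes>\<^bsub>K\<^esub> k \<in> W}" for l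
      have openV: "openin S (V l)" if "l \<in> L" for l
        unfolding V_def using that LK
        by (intro openin_continuous_map_preimage[OF K.continuous_map_left_mult W(1)]) auto
      \<comment> \<open>The net must consist of elements of \<open>L\<close>, so the compact closure
        of \<open>L\<close> is covered by translates of \<open>W\<close> with centers in
        \<open>L\<close>: the centers whose translate contains \<open>x\<close> form a neighborhood
        of \<open>x\<close>, which meets \<open>L\<close>.\<close>
      have cover: "S closure_of L \<subseteq> \<Union>(V ` L)"
      proof
        fix x assume x: "x \<in> S closure_of L"
        then have xK: "x \<in> carrier K" by (simp add: in_closure_of K.topspace_eq)
        define N where "N = {k \<in> topspace S. inv\<^bsub>K\<^esub> k \<otimes>\<^bsub>K\<^esub> x \<in> W}"
        have "continuous_map S (prod_topology S S) (\<lambda>k. (inv\<^bsub>K\<^esub> k, x))"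
          using xK K.continuous_inv by (simp add: continuous_map_pairwise o_def K.topspace_eq)
        from continuous_map_compose[OF this K.continuous_mult]
        have "continuous_map S S (\<lambda>k. inv\<^bsub>K\<^esub> k \<otimes>\<^bsub>K\<^esub> x)" by (simp add: o_def)
        then have "openin S N" unfolding N_def by (rule openin_continuous_map_preimage[OF _ W(1)])
        moreover have "x \<in> N" using xK W(2) by (simp add: N_def K.topspace_eq)
        ultimately obtain l where "l \<in> L" "l \<in> N" using x unfolding in_closure_of by blast
        then show "x \<in> \<Union>(V ` L)" using xK by (auto simp: N_def V_def K.topspace_eq)
      qed
      have "compactin S (S closure_of L)" using comp by (simp add: closedin_compact_space)
      then obtain \<F> where \<F>: "finite \<F>" "\<F> \<subseteq> V ` L" "S closure_of L \<subseteq> \<Union>\<F>"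
        using cover openV unfolding compactin_def by (metis (no_types, lifting) imageE)
      obtain D' where D': "finite D'" "D' \<subseteq> L" "\<F> = V ` D'"
        using finite_subset_image[OF \<F>(1,2)] by blast
      define D where "D = inv_into (carrier G) \<phi> ` D'"
      have D: "finite D" "D \<subseteq> carrier G" "D' = \<phi> ` D"
      proof -
        show "finite D" using D'(1) by (simp add: D_def)
        show "D \<subseteq> carrier G"
          using D'(2) bij unfolding D_def by (auto simp: bij_betw_def intro!: inv_into_into)
        have "\<phi> (inv_into (carrier G) \<phi> d) = d" if "d \<in> D'" for d
          using D'(2) bij that by (auto simp: bij_betw_def intro!: f_inv_into_f)
        then show "D' = \<phi> ` D" by (simp add: D_def image_image)
      qed
      have "\<exists>d\<in>D. \<forall>u\<in>carrier G. \<bar>(h \<circ> \<phi>) (u \<otimes>\<^bsub>G\<^esub> x) - (h \<circ> \<phi>) (u \<otimes>\<^bsub>G\<^esub> d)\<bar> \<le> e"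
        if x: "x \<in> carrier G" for x
      proof -
        have "L \<subseteq> S closure_of L" using LK by (intro closure_of_subset) (simp add: K.topspace_eq)
        then have "\<phi> x \<in> \<Union>\<F>" using \<F>(3) \<phi>L[OF x] by blast
        then obtain d where d: "d \<in> D" "\<phi> x \<in> V (\<phi> d)" using D D' by blast
        then have dc: "d \<in> carrier G" using D by auto
        define w where "w = inv\<^bsub>K\<^esub> \<phi> d \<otimes>\<^bsub>K\<^esub> \<phi> x"
        have w: "w \<in> W" "w \<in> carrier K" using d \<phi>K x dc by (auto simp: V_def w_def)
        have "\<phi> d \<otimes>\<^bsub>K\<^esub> w = \<phi> x"
          using \<phi>K x dc by (simp add: w_def K.m_assoc[symmetric])
        then have "\<phi> (u \<otimes>\<^bsub>G\<^esub> x) = \<phi> (u \<otimes>\<^bsub>G\<^esub> d) \<otimes>\<^bsub>K\<^esub> w" if "u \<in> carrier G" for u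
          using that x dc \<phi>K w by (simp add: mult K.m_assoc)
        then have "\<bar>(h \<circ> \<phi>) (u \<otimes>\<^bsub>G\<^esub> x) - (h \<circ> \<phi>) (u \<otimes>\<^bsub>G\<^esub> d)\<bar> \<le> e" if "u \<in> carrier G" for u
          using that *[OF _ w(1), of "\<phi> (u \<otimes>\<^bsub>G\<^esub> d)"] dc \<phi>K by (simp add: less_imp_le)
        then show ?thesis using d(1) by blast
      qed
      then show "\<exists>D. finite D \<and> D \<subseteq> carrier G \<and> (\<forall>x\<in>carrier G. \<exists>d\<in>D. \<forall>u\<in>carrier G.
          \<bar>(h \<circ> \<phi>) (u \<otimes>\<^bsub>G\<^esub> x) - (h \<circ> \<phi>) (u \<otimes>\<^bsub>G\<^esub> d)\<bar> \<le> e)"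
        using D by blast
    qed
  qed
qed

text \<open>Vanishing off the carrier makes characters that agree on the group equal as functions,
  so that counting them is meaningful.\<close>

definition unitary_characters :: "('g, 'b) monoid_scheme \<Rightarrow> 'g topology \<Rightarrow> ('g \<Rightarrow> complex) set" where
  "unitary_characters G T = {\<theta>. (\<forall>x. x \<notin> carrier G \<longrightarrow> \<theta> x = 0) \<and>
     (\<forall>x\<in>carrier G. cmod (\<theta> x) = 1) \<and>
     (\<forall>x\<in>carrier G. \<forall>y\<in>carrier G. \<theta> (x \<otimes>\<^bsub>G\<^esub> y) = \<theta> x * \<theta> y) \<and>
     continuous_map T euclidean \<theta>}"

lemma (in topological_group) continuous_multiplicative:
  fixes \<theta> :: "'a \<Rightarrow> complex"
  assumes norm: "\<And>x. x \<in> carrier G \<Longrightarrow> cmod (\<theta> x) = 1"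
    and mult: "\<And>x y. \<lbrakk>x \<in> carrier G; y \<in> carrier G\<rbrakk> \<Longrightarrow> \<theta> (x \<otimes> y) = \<theta> x * \<theta> y"
    and cont: "\<And>e. 0 < e \<Longrightarrow> \<exists>W. openin T W \<and> \<one> \<in> W \<and> (\<forall>z\<in>W. cmod (\<theta> z - 1) < e)"
  shows "continuous_map T euclidean \<theta>"
  unfolding continuous_map_def
proof (intro conjI allI impI)
  fix U :: "complex set" assume "openin euclidean U"
  then have U: "open U" by simp
  show "openin T {x \<in> topspace T. \<theta> x \<in> U}"
  proof (subst openin_subopen, intro ballI)
    fix x assume "x \<in> {x \<in> topspace T. \<theta> x \<in> U}"
    then have x: "x \<in> carrier G" "\<theta> x \<in> U" by (auto simp: topspace_eq)
    then obtain e where e: "0 < e" "ball (\<theta> x) e \<subseteq> U" using U openE by blast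
    obtain W where W: "openin T W" "\<one> \<in> W" "\<And>z. z \<in> W \<Longrightarrow> cmod (\<theta> z - 1) < e" using cont[OF e(1)] by blast
    define N where "N = {y \<in> topspace T. inv x \<otimes> y \<in> W}"
    have "openin T N"
      unfolding N_def using x by (intro openin_continuous_map_preimage[OF continuous_map_left_mult W(1)]) auto
    moreover have "x \<in> N" using x W(2) by (simp add: N_def topspace_eq)
    moreover have "\<theta> y \<in> U" if "y \<in> N" for y
    proof -
      have y: "y \<in> carrier G" "inv x \<otimes> y \<in> W" using that by (auto simp: N_def topspace_eq)
      have "\<theta> y = \<theta> (x \<otimes> (inv x \<otimes> y))" using x y by (simp add: m_assoc[symmetric])
      also have "\<dots> = \<theta> x * \<theta> (inv x \<otimes> y)" using x y by (intro mult) auto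
      finally have "\<theta> y - \<theta> x = \<theta> x * (\<theta> (inv x \<otimes> y) - 1)" by (simp add: algebra_simps)
      then have "cmod (\<theta> y - \<theta> x) = cmod (\<theta> (inv x \<otimes> y) - 1)" using norm[OF x(1)] by (simp add: norm_mult)
      also have "\<dots> < e" by (rule W(3)[OF y(2)])
      finally have "\<theta> y \<in> ball (\<theta> x) e" by (simp add: dist_norm norm_minus_commute)
      then show ?thesis using e by blast
    qed
    ultimately show "\<exists>N. openin T N \<and> x \<in> N \<and> N \<subseteq> {x \<in> topspace T. \<theta> x \<in> U}"
      by (intro exI[of _ N]) (auto simp: N_def)
  qed
qed simp

text \<open>Exact multiplicativity makes \<open>\<theta>\<close> unimodular, so continuity at the
  identity suffices, and this is inherited from the translates of \<open>f\<close>.\<close>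

theorem precompact_characters_separate:
  assumes G: "topological_group G T" and comm: "comm_group G" and pre: "precompact_group TYPE('k) G T"
    and a: "a \<in> carrier G" "a \<noteq> \<one>\<^bsub>G\<^esub>"
  obtains \<theta> where "\<theta> \<in> unitary_characters G T" "\<theta> a \<noteq> 1"
proof -
  interpret comm_group G by fact
  interpret topological_group G T by fact
  obtain f :: "_ \<Rightarrow> real" where f: "\<And>x. x \<in> carrier G \<Longrightarrow> \<bar>f x\<bar> \<le> 1" "almost_periodic f" "f a \<noteq> f \<one>\<^bsub>G\<^esub>"
    and f_cont: "\<And>e. 0 < e \<Longrightarrow> \<exists>W. openin T W \<and> \<one>\<^bsub>G\<^esub> \<in> W \<and>
       (\<forall>z\<in>W. \<forall>u\<in>carrier G. \<bar>f (u \<otimes>\<^bsub>G\<^esub> z) - f u\<bar> \<le> e)"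
    using precompact_separating_function[OF G pre a] comm by metis
  obtain \<theta> C where \<theta>: "\<theta> \<in> normalized_pd"
    and mult: "\<And>x y. \<lbrakk>x \<in> carrier G; y \<in> carrier G\<rbrakk> \<Longrightarrow> \<theta> (x \<otimes>\<^bsub>G\<^esub> y) = \<theta> x * \<theta> y"
    and \<theta>a: "\<theta> a \<noteq> 1"
    and near: "\<And>z d. \<lbrakk>z \<in> carrier G; \<And>u. u \<in> carrier G \<Longrightarrow> \<bar>f (u \<otimes>\<^bsub>G\<^esub> z) - f u\<bar> \<le> d\<rbrakk> \<Longrightarrow> cmod (\<theta> z - 1) \<le> C * d"
    using almost_periodic_character[OF f(1,2) a(1) f(3)] by metis
  have norm: "cmod (\<theta> x) = 1" if x: "x \<in> carrier G" for x
  proof -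
    have "\<theta> x * cnj (\<theta> x) = 1"
      using mult[of x "inv\<^bsub>G\<^esub> x"] x by (simp add: normalized_pd_simps[OF \<theta>])
    then have "cmod (\<theta> x) * cmod (\<theta> x) = 1" by (metis complex_mod_cnj norm_mult norm_one)
    then show ?thesis using norm_ge_zero[of "\<theta> x"] by (simp add: square_eq_1_iff)
  qed
  have "continuous_map T euclidean \<theta>"
  proof (rule continuous_multiplicative[OF norm mult])
    fix e :: real assume e: "0 < e"
    \<comment> \<open>The sign of \<open>C\<close> is unknown, and adding 1 keeps the denominator
      positive.\<close>
    define d where "d = e / (\<bar>C\<bar> + 1)"
    have d: "0 < d" "C * d < e"
    proof -
      show "0 < d" using e by (simp add: d_def)
      then have "C * d \<le> \<bar>C\<bar> * d" by (intro mult_right_mono) auto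
      also have "\<dots> < e" using e by (simp add: d_def field_simps)
      finally show "C * d < e" .
    qed
    obtain W where W: "openin T W" "\<one>\<^bsub>G\<^esub> \<in> W"
      "\<And>z u. \<lbrakk>z \<in> W; u \<in> carrier G\<rbrakk> \<Longrightarrow> \<bar>f (u \<otimes>\<^bsub>G\<^esub> z) - f u\<bar> \<le> d"
      using f_cont[OF d(1)] by blast
    have "cmod (\<theta> z - 1) < e" if "z \<in> W" for z
    proof -
      have "z \<in> carrier G" using W(1) that openin_subset topspace_eq by blast
      then show ?thesis using near[of z d] W(3)[OF that] d(2) by fastforce
    qed
    then show "\<exists>W. openin T W \<and> \<one>\<^bsub>G\<^esub> \<in> W \<and> (\<forall>z\<in>W. cmod (\<theta> z - 1) < e)" using W by blast
  qed
  then have "\<theta> \<in> unitary_characters G T"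
    using norm mult normalized_pd_simps(3)[OF \<theta>] by (simp add: unitary_characters_def)
  then show thesis using \<theta>a that by blast
qed

lemma unitary_characters_mult:
  assumes "\<theta> \<in> unitary_characters G T" "\<omega> \<in> unitary_characters G T"
  shows "(\<lambda>x. \<theta> x * \<omega> x) \<in> unitary_characters G T"
proof -
  have "continuous_map T euclidean (\<lambda>x. \<theta> x * \<omega> x)"
    using assms by (simp add: unitary_characters_def continuous_map_atin tendsto_mult)
  then show ?thesis using assms
    by (auto simp: unitary_characters_def norm_mult o_def)
qed

lemma unitary_characters_cnj:
  assumes "\<theta> \<in> unitary_characters G T"
  shows "(\<lambda>x. cnj (\<theta> x)) \<in> unitary_characters G T"
proof -
  have "continuous_map T euclidean (\<lambda>x. cnj (\<theta> x))"
    using assms by (simp add: unitary_characters_def continuous_map_atin tendsto_cnj)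
  then show ?thesis using assms by (simp add: unitary_characters_def o_def)
qed

text \<open>The exponent starts at 1 because a zeroth power would be 1 off the carrier as
  well.\<close>

lemma unitary_characters_power:
  assumes "\<theta> \<in> unitary_characters G T"
  shows "(\<lambda>x. \<theta> x ^ Suc n) \<in> unitary_characters G T"
proof (induction n)
  case (Suc n)
  then show ?case using unitary_characters_mult[OF assms] by simp
qed (use assms in simp)

text \<open>If there were finitely many, a repetition among the powers of each would give it finite
  order, hence finitely many values. Evaluation, injective because characters separate points, would
  embed the group in a finite product.\<close>

theorem infinite_unitary_characters:
  assumes G: "topological_group G T" and comm: "comm_group G" and pre: "precompact_group TYPE('k) G T"
    and inf: "infinite (carrier G)"
  shows "infinite (unitary_characters G T)"
proof
  assume fin: "finite (unitary_characters G T)"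
  interpret comm_group G by fact
  have roots: "\<exists>n>0. \<forall>x\<in>carrier G. \<theta> x ^ n = 1" if \<theta>: "\<theta> \<in> unitary_characters G T" for \<theta>
  proof -
    have "range (\<lambda>n x. \<theta> x ^ Suc n) \<subseteq> unitary_characters G T"
      using unitary_characters_power[OF \<theta>] by auto
    then have "finite (range (\<lambda>n x. \<theta> x ^ Suc n))" using fin by (rule finite_subset)
    then have "\<not> inj (\<lambda>n x. \<theta> x ^ Suc n)" using finite_imageD infinite_UNIV_nat by blast
    then obtain i j where ij: "i < j" "(\<lambda>x. \<theta> x ^ Suc i) = (\<lambda>x. \<theta> x ^ Suc j)"
      unfolding inj_def by (metis linorder_neqE_nat)
    have "\<theta> x ^ (j - i) = 1" if x: "x \<in> carrier G" for x
    proof -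
      have "cmod (\<theta> x) = 1" using \<theta> x by (simp add: unitary_characters_def)
      then have nz: "\<theta> x \<noteq> 0" by auto
      have "\<theta> x ^ Suc i * \<theta> x ^ (j - i) = \<theta> x ^ Suc j" using ij(1) by (simp flip: power_add)
      also have "\<dots> = \<theta> x ^ Suc i" using ij(2) by (metis (no_types))
      finally show ?thesis using nz by simp
    qed
    then show ?thesis using ij(1) by (intro exI[of _ "j - i"]) auto
  qed
  then obtain n where n: "\<And>\<theta>. \<theta> \<in> unitary_characters G T \<Longrightarrow> n \<theta> > 0 \<and> (\<forall>x\<in>carrier G. \<theta> x ^ n \<theta> = 1)"
    by metis
  define ev where "ev x = restrict (\<lambda>\<theta>. \<theta> x) (unitary_characters G T)" for x
  have "ev ` carrier G \<subseteq> PiE (unitary_characters G T) (\<lambda>\<theta>. {z. z ^ n \<theta> = 1})"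
    using n by (auto simp: ev_def)
  moreover have "finite (PiE (unitary_characters G T) (\<lambda>\<theta>. {z::complex. z ^ n \<theta> = 1}))"
    using fin n by (intro finite_PiE finite_roots_unity) (auto simp: Suc_le_eq)
  ultimately have "finite (ev ` carrier G)" by (rule finite_subset)
  moreover have "inj_on ev (carrier G)"
  proof (rule inj_onI, rule ccontr)
    fix x y assume xy: "x \<in> carrier G" "y \<in> carrier G" "ev x = ev y" "x \<noteq> y"
    then have "x \<otimes>\<^bsub>G\<^esub> inv\<^bsub>G\<^esub> y \<noteq> \<one>\<^bsub>G\<^esub>" using inv_equality[of x "inv\<^bsub>G\<^esub> y"] by auto
    then obtain \<theta> where \<theta>: "\<theta> \<in> unitary_characters G T" "\<theta> (x \<otimes>\<^bsub>G\<^esub> inv\<^bsub>G\<^esub> y) \<noteq> 1"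
      using precompact_characters_separate[OF G comm pre] xy by (metis inv_closed m_closed)
    have mult: "\<theta> (u \<otimes>\<^bsub>G\<^esub> v) = \<theta> u * \<theta> v" if "u \<in> carrier G" "v \<in> carrier G" for u v
      using \<theta>(1) that by (simp add: unitary_characters_def)
    have "ev x \<theta> = ev y \<theta>" using xy(3) by simp
    then have "\<theta> x = \<theta> y" using \<theta>(1) by (simp add: ev_def)
    then have "\<theta> (x \<otimes>\<^bsub>G\<^esub> inv\<^bsub>G\<^esub> y) = \<theta> (y \<otimes>\<^bsub>G\<^esub> inv\<^bsub>G\<^esub> y)" using xy mult[of x "inv\<^bsub>G\<^esub> y"] mult[of y "inv\<^bsub>G\<^esub> y"] by (simp del: r_inv)
    also have "\<dots> = 1"
    proof -
      have "\<theta> \<one>\<^bsub>G\<^esub> * \<theta> \<one>\<^bsub>G\<^esub> = \<theta> \<one>\<^bsub>G\<^esub>" using mult[of "\<one>\<^bsub>G\<^esub>" "\<one>\<^bsub>G\<^esub>"] by simp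
      moreover have "cmod (\<theta> \<one>\<^bsub>G\<^esub>) = 1" using \<theta>(1) by (simp add: unitary_characters_def)
      ultimately show ?thesis using xy by auto
    qed
    finally show False using \<theta>(2) by simp
  qed
  ultimately show False using inf finite_imageD by blast
qed

text \<open>Dirichlet's box principle: two distinct characters with values on \<open>F\<close> in
  the same cells of a grid of mesh \<open>1 / N\<close> have a nontrivial quotient close to 1 on
  \<open>F\<close>.\<close>

lemma infinite_unitary_characters_near_one:
  assumes inf: "infinite (unitary_characters G T)" and F: "finite F" "F \<subseteq> carrier G" and d: "0 < d"
  obtains \<theta> where "\<theta> \<in> unitary_characters G T" "\<exists>a\<in>carrier G. \<theta> a \<noteq> 1" "\<And>x. x \<in> F \<Longrightarrow> cmod (\<theta> x - 1) < d"
proof -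
  \<comment> \<open>Real and imaginary parts will each differ by less than \<open>1 / N\<close>, so
    the modulus of the difference stays below \<open>2 / N\<close>.\<close>
  obtain N :: nat where N: "2 / d < N" using reals_Archimedean2 by blast
  then have N0: "0 < N" using d by (metis divide_pos_pos of_nat_0_less_iff order.strict_trans zero_less_numeral)
  have norm: "cmod (\<theta> x) = 1" if "\<theta> \<in> unitary_characters G T" "x \<in> carrier G" for \<theta> x
    using that by (simp add: unitary_characters_def)
  define q where "q \<theta> = restrict (\<lambda>x. (\<lfloor>Re (\<theta> x) * N\<rfloor>, \<lfloor>Im (\<theta> x) * N\<rfloor>)) F" for \<theta> :: "'a \<Rightarrow> complex"
  have bnd: "\<lfloor>r * N\<rfloor> \<in> {- int N..int N}" if "\<bar>r\<bar> \<le> 1" for r :: real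
  proof -
    have "\<bar>r * N\<bar> \<le> N" using mult_right_mono[OF that, of "real N"] by (simp add: abs_mult)
    then show ?thesis by (simp add: abs_le_iff floor_le_iff le_floor_iff)
  qed
  have "q \<theta> \<in> PiE F (\<lambda>_. {- int N..int N} \<times> {- int N..int N})" if "\<theta> \<in> unitary_characters G T" for \<theta>
  proof -
    have "\<bar>Re (\<theta> x)\<bar> \<le> 1" "\<bar>Im (\<theta> x)\<bar> \<le> 1" if "x \<in> F" for x
      using abs_Re_le_cmod[of "\<theta> x"] abs_Im_le_cmod[of "\<theta> x"] norm[OF \<open>\<theta> \<in> _\<close>, of x] that F by auto
    then show ?thesis unfolding q_def using bnd by (intro restrict_PiE_iff[THEN iffD2] ballI SigmaI) auto
  qed
  then have "q ` unitary_characters G T \<subseteq> PiE F (\<lambda>_. {- int N..int N} \<times> {- int N..int N})"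
    by (rule image_subsetI)
  moreover have "finite (PiE F (\<lambda>_. {- int N..int N} \<times> {- int N..int N}))"
    using F(1) by (intro finite_PiE) simp_all
  ultimately have "finite (q ` unitary_characters G T)" by (rule finite_subset)
  then have "\<not> inj_on q (unitary_characters G T)" using inf finite_imageD by blast
  then obtain \<theta> \<omega> where \<theta>: "\<theta> \<in> unitary_characters G T" and \<omega>: "\<omega> \<in> unitary_characters G T"
    and ne: "\<theta> \<noteq> \<omega>" and eq: "q \<theta> = q \<omega>" unfolding inj_on_def by blast
  have diff: "cmod (\<theta> x * cnj (\<omega> x) - 1) = cmod (\<theta> x - \<omega> x)" if "x \<in> carrier G" for x
  proof -
    have 1: "\<omega> x * cnj (\<omega> x) = 1" using norm[OF \<omega> that] by (simp add: complex_norm_square[symmetric])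
    have "\<theta> x * cnj (\<omega> x) - 1 = (\<theta> x - \<omega> x) * cnj (\<omega> x)" by (simp add: left_diff_distrib 1)
    then show ?thesis using norm[OF \<omega> that] by (simp add: norm_mult)
  qed
  show thesis
  proof (rule that[of "\<lambda>x. \<theta> x * cnj (\<omega> x)"])
    show "(\<lambda>x. \<theta> x * cnj (\<omega> x)) \<in> unitary_characters G T"
      using unitary_characters_mult[OF \<theta> unitary_characters_cnj[OF \<omega>]] .
    obtain a where a: "\<theta> a \<noteq> \<omega> a" using ne by blast
    then have "a \<in> carrier G" using \<theta> \<omega> by (cases "a \<in> carrier G") (simp_all add: unitary_characters_def)
    then show "\<exists>a\<in>carrier G. \<theta> a * cnj (\<omega> a) \<noteq> 1" using a diff[of a] by (intro bexI[of _ a]) auto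
    fix x assume x: "x \<in> F"
    have close: "\<bar>r - s\<bar> < 1 / N" if "\<lfloor>r * N\<rfloor> = \<lfloor>s * N\<rfloor>" for r s :: real
    proof -
      have "\<bar>r * N - s * N\<bar> < 1" using that by linarith
      then have "\<bar>r - s\<bar> * N < 1" by (simp add: abs_mult flip: left_diff_distrib)
      then show ?thesis using N0 by (simp add: field_simps)
    qed
    have "q \<theta> x = q \<omega> x" using eq by simp
    then have "\<bar>Re (\<theta> x - \<omega> x)\<bar> < 1 / N" "\<bar>Im (\<theta> x - \<omega> x)\<bar> < 1 / N"
      using x close by (simp_all add: q_def)
    then have "cmod (\<theta> x - \<omega> x) < 1 / N + 1 / N"
      using cmod_le[of "\<theta> x - \<omega> x"] by linarith
    also have "\<dots> < d" using N N0 d by (simp add: field_simps)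
    finally show "cmod (\<theta> x * cnj (\<omega> x) - 1) < d" using diff x F by auto
  qed
qed

section \<open>Uniform approximation on countable compact spaces\<close>

text \<open>Otherwise the space would be a countable union of closed points with empty interior,
  against Baire's theorem.\<close>

lemma countable_compact_Hausdorff_isolated:
  assumes "compact_space Y" "Hausdorff_space Y" "countable (topspace Y)" "topspace Y \<noteq> {}"
  obtains p where "p \<in> topspace Y" "openin Y {p}"
proof -
  have "\<exists>p\<in>topspace Y. Y interior_of {p} \<noteq> {}"
  proof (rule ccontr)
    assume "\<not> ?thesis"
    then have "Y interior_of \<Union>((\<lambda>x. {x}) ` topspace Y) = {}"
      using assms
      by (intro Baire_category_alt)
        (auto simp: closedin_Hausdorff_sing_eq compact_imp_locally_compact_space
          compact_Hausdorff_imp_regular_space)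
    then show False using assms(4) by simp
  qed
  then obtain p where p: "p \<in> topspace Y" "Y interior_of {p} \<noteq> {}" by blast
  then have "Y interior_of {p} = {p}" using interior_of_subset[of Y "{p}"] by blast
  then show thesis using that p by (metis openin_interior_of)
qed

text \<open>Deviations from \<open>1\<close> rather than from \<open>0\<close> are measured because the functions in question will
  be convex combinations of characters.\<close>

definition pointwise_approximating :: "'x topology \<Rightarrow> ('x \<Rightarrow> complex) set \<Rightarrow> bool" where
  "pointwise_approximating Y A \<longleftrightarrow>
     (\<forall>\<phi>\<in>A. continuous_map Y euclidean \<phi> \<and> (\<forall>x\<in>topspace Y. cmod (\<phi> x - 1) \<le> 2)) \<and>
     (\<forall>\<phi>\<in>A. \<forall>\<psi>\<in>A. \<forall>t. 0 \<le> t \<longrightarrow> t \<le> 1 \<longrightarrow> (\<lambda>x. (1 - complex_of_real t) * \<phi> x + t * \<psi> x) \<in> A) \<and>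
     (\<forall>F e. finite F \<longrightarrow> F \<subseteq> topspace Y \<longrightarrow> 0 < e \<longrightarrow> (\<exists>\<phi>\<in>A. \<forall>x\<in>F. cmod (\<phi> x - 1) < e))"

text \<open>The quantification over all families and the extra finite set are there for unions: the
  second set is handled inside a subfamily obtained from the first.\<close>

definition uniformly_approximated :: "'x topology \<Rightarrow> 'x set \<Rightarrow> bool" where
  "uniformly_approximated Y W \<longleftrightarrow> (\<forall>A. pointwise_approximating Y A \<longrightarrow>
     (\<forall>F e. finite F \<longrightarrow> F \<subseteq> topspace Y \<longrightarrow> 0 < e \<longrightarrow> (\<exists>\<phi>\<in>A. \<forall>x\<in>W \<union> F. cmod (\<phi> x - 1) < e)))"

lemma pointwise_approximatingD:
  assumes "pointwise_approximating Y A"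
  shows "\<phi> \<in> A \<Longrightarrow> continuous_map Y euclidean \<phi>"
    and "\<lbrakk>\<phi> \<in> A; x \<in> topspace Y\<rbrakk> \<Longrightarrow> cmod (\<phi> x - 1) \<le> 2"
    and "\<lbrakk>\<phi> \<in> A; \<psi> \<in> A; 0 \<le> t; t \<le> 1\<rbrakk> \<Longrightarrow> (\<lambda>x. (1 - complex_of_real t) * \<phi> x + t * \<psi> x) \<in> A"
    and "\<lbrakk>finite F; F \<subseteq> topspace Y; 0 < e\<rbrakk> \<Longrightarrow> \<exists>\<phi>\<in>A. \<forall>x\<in>F. cmod (\<phi> x - 1) < e"
  using assms unfolding pointwise_approximating_def by simp_all

lemma pointwise_approximating_average:
  assumes A: "pointwise_approximating Y A" and \<phi>: "\<And>k. \<phi> k \<in> A"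
  shows "(\<lambda>x. (\<Sum>k<Suc m. \<phi> k x) / Suc m) \<in> A"
proof (induction m)
  case (Suc m)
  define t where "t = 1 / real (Suc (Suc m))"
  have "(\<lambda>x. (1 - complex_of_real t) * ((\<Sum>k<Suc m. \<phi> k x) / Suc m) + t * \<phi> (Suc m) x) \<in> A"
    by (rule pointwise_approximatingD(3)[OF A Suc \<phi>]) (simp_all add: t_def)
  moreover have "1 - complex_of_real t = of_nat (Suc m) / of_nat (Suc (Suc m))"
    unfolding t_def by (simp add: field_simps del: of_nat_Suc) simp
  then have "(1 - complex_of_real t) * (S / Suc m) + t * y = (S + y) / Suc (Suc m)" for S y :: complex
    unfolding t_def by (simp add: add_divide_distrib del: of_nat_Suc)
  ultimately have "(\<lambda>x. ((\<Sum>k<Suc m. \<phi> k x) + \<phi> (Suc m) x) / Suc (Suc m)) \<in> A" by (simp only:)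
  then show ?case by (simp only: sum.lessThan_Suc[of _ "Suc m"])
qed (use \<phi> in simp)

lemma norm_convex_combination_diff_less:
  fixes z w :: complex
  assumes "0 \<le> t" "t \<le> 1" "cmod (z - 1) < e" "cmod (w - 1) < e"
  shows "cmod ((1 - complex_of_real t) * z + t * w - 1) < e"
proof -
  have "(1 - complex_of_real t) * z + t * w - 1 = (1 - t) *\<^sub>R (z - 1) + t *\<^sub>R (w - 1)"
    by (simp add: scaleR_conv_of_real algebra_simps)
  moreover have "(1 - t) *\<^sub>R (z - 1) + t *\<^sub>R (w - 1) \<in> ball 0 e"
    using assms by (intro convexD[OF convex_ball]) auto
  ultimately show ?thesis by simp
qed

lemma uniformly_approximatedD:
  "\<lbrakk>uniformly_approximated Y W; pointwise_approximating Y A; finite F; F \<subseteq> topspace Y; 0 < e\<rbrakk> \<Longrightarrow>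
    \<exists>\<phi>\<in>A. \<forall>x\<in>W \<union> F. cmod (\<phi> x - 1) < e"
  unfolding uniformly_approximated_def by simp

lemma uniformly_approximated_mono:
  assumes W: "uniformly_approximated Y W" and "V \<subseteq> W"
  shows "uniformly_approximated Y V"
  unfolding uniformly_approximated_def
proof (intro allI impI)
  fix A F and e :: real
  assume "pointwise_approximating Y A" "finite F" "F \<subseteq> topspace Y" "0 < e"
  from uniformly_approximatedD[OF W this] show "\<exists>\<phi>\<in>A. \<forall>x\<in>V \<union> F. cmod (\<phi> x - 1) < e"
    using \<open>V \<subseteq> W\<close> by (elim bexE, intro bexI) auto
qed

lemma uniformly_approximated_empty: "uniformly_approximated Y {}"
  unfolding uniformly_approximated_def using pointwise_approximatingD(4) by auto

text \<open>The members of \<open>A\<close> that are good on \<open>V\<close> form a convex family,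
  since balls are convex. It is still pointwise approximating because \<open>V\<close> tolerates any
  finite set, so the assumption on \<open>W\<close> applies to it.\<close>

lemma uniformly_approximated_Un:
  assumes V: "uniformly_approximated Y V" and W: "uniformly_approximated Y W"
  shows "uniformly_approximated Y (V \<union> W)"
  unfolding uniformly_approximated_def
proof (intro allI impI)
  fix A F and e :: real
  assume A: "pointwise_approximating Y A" and F: "finite F" "F \<subseteq> topspace Y" and e: "0 < e"
  define A' where "A' = {\<phi> \<in> A. \<forall>x\<in>V. cmod (\<phi> x - 1) < e}"
  have "pointwise_approximating Y A'"
    unfolding pointwise_approximating_def
  proof (intro conjI allI impI ballI)
    fix F' and d :: real assume F': "finite F'" "F' \<subseteq> topspace Y" "0 < d"
    have "0 < min d e" using e F' by simp
    then obtain \<phi> where "\<phi> \<in> A" "\<forall>x\<in>V \<union> F'. cmod (\<phi> x - 1) < min d e"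
      using uniformly_approximatedD[OF V A F'(1,2)] by blast
    then show "\<exists>\<phi>\<in>A'. \<forall>x\<in>F'. cmod (\<phi> x - 1) < d" unfolding A'_def by auto
  qed (use pointwise_approximatingD[OF A] in \<open>auto simp: A'_def norm_convex_combination_diff_less\<close>)
  then obtain \<phi> where "\<phi> \<in> A'" "\<forall>x\<in>W \<union> F. cmod (\<phi> x - 1) < e"
    using uniformly_approximatedD[OF W _ F e] by blast
  then show "\<exists>\<phi>\<in>A. \<forall>x\<in>V \<union> W \<union> F. cmod (\<phi> x - 1) < e" unfolding A'_def by blast
qed

lemma uniformly_approximated_Union:
  "\<lbrakk>finite \<F>; \<And>W. W \<in> \<F> \<Longrightarrow> uniformly_approximated Y W\<rbrakk> \<Longrightarrow> uniformly_approximated Y (\<Union>\<F>)"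
  by (induction rule: finite_induct) (auto simp: uniformly_approximated_empty uniformly_approximated_Un)

lemma uniformly_approximated_compactin:
  assumes "compactin Y K" "\<And>x. x \<in> K \<Longrightarrow> \<exists>W. openin Y W \<and> x \<in> W \<and> uniformly_approximated Y W"
  shows "uniformly_approximated Y K"
proof -
  define \<U> where "\<U> = {W. openin Y W \<and> uniformly_approximated Y W}"
  have "\<forall>U\<in>\<U>. openin Y U" "K \<subseteq> \<Union>\<U>" using assms(2) by (auto simp: \<U>_def)
  then obtain \<F> where "finite \<F>" "\<F> \<subseteq> \<U>" "K \<subseteq> \<Union>\<F>"
    using assms(1) unfolding compactin_def by blast
  then have "uniformly_approximated Y (\<Union>\<F>)"
    by (intro uniformly_approximated_Union) (auto simp: \<U>_def)
  then show ?thesis using \<open>K \<subseteq> \<Union>\<F>\<close> by (rule uniformly_approximated_mono)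
qed

text \<open>Choose functions
  \<open>\<phi>\<^sub>0, \<phi>\<^sub>1, \<dots>\<close> successively, each close to \<open>1\<close> wherever one of the earlier ones is not. Their average
  is then close to \<open>1\<close> everywhere, since at most one of them is bad at any given point.\<close>

lemma uniformly_approximated_punctured:
  assumes p: "p \<in> topspace Y"
    and N: "\<And>V. \<lbrakk>openin Y V; p \<in> V\<rbrakk> \<Longrightarrow> uniformly_approximated Y (N - V)" and NY: "N \<subseteq> topspace Y"
  shows "uniformly_approximated Y N"
  unfolding uniformly_approximated_def
proof (intro allI impI)
  fix A F and e :: real
  assume A: "pointwise_approximating Y A" and F: "finite F" "F \<subseteq> topspace Y" and e: "0 < e"
  note AD = pointwise_approximatingD[OF A]
  have "\<exists>\<phi>\<in>A. \<forall>x\<in>(N - V) \<union> insert p F. cmod (\<phi> x - 1) < e / 2" if "openin Y V" "p \<in> V" for V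
    using uniformly_approximatedD[OF N[OF that] A, of "insert p F" "e / 2"] F e p by simp
  then obtain \<Phi> where \<Phi>A: "\<And>V. \<lbrakk>openin Y V; p \<in> V\<rbrakk> \<Longrightarrow> \<Phi> V \<in> A"
    and \<Phi>: "\<And>V x. \<lbrakk>openin Y V; p \<in> V; x \<in> (N - V) \<union> insert p F\<rbrakk> \<Longrightarrow> cmod (\<Phi> V x - 1) < e / 2"
    by metis
  \<comment> \<open>\<open>V (Suc k)\<close> keeps the points of \<open>V k\<close> at which the
    function chosen for \<open>V k\<close> is good. On \<open>N\<close> this function is good
    outside \<open>V k\<close>, hence bad at most on \<open>V k - V (Suc k)\<close>, and these
    differences are disjoint.\<close>
  define V where "V = rec_nat (topspace Y) (\<lambda>_ U. U \<inter> {x \<in> topspace Y. \<Phi> U x \<in> ball 1 (e / 2)})"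
  have V_Suc: "V (Suc k) = V k \<inter> {x \<in> topspace Y. \<Phi> (V k) x \<in> ball 1 (e / 2)}" for k
    by (simp add: V_def)
  have V: "openin Y (V k)" "p \<in> V k" for k
  proof (induction k)
    case (Suc k)
    {
      case 1
      have "openin Y {x \<in> topspace Y. \<Phi> (V k) x \<in> ball 1 (e / 2)}"
        using AD(1)[OF \<Phi>A[OF Suc]] by (rule openin_continuous_map_preimage) simp
      then show ?case using Suc(1) unfolding V_Suc by (rule openin_Int[rotated])
    next
      case 2
      show ?case using Suc \<Phi>[OF Suc, of p] p
        by (simp add: V_Suc dist_norm norm_minus_commute)
    }
  qed (use p in \<open>simp_all add: V_def\<close>)
  have V_anti: "V j \<subseteq> V i" if "i \<le> j" for i j
    using that by (induction rule: dec_induct) (auto simp: V_Suc)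
  define \<phi> where "\<phi> k = \<Phi> (V k)" for k
  have \<phi>A: "\<phi> k \<in> A" for k using \<Phi>A V by (simp add: \<phi>_def)
  have unique_bad: "i = j"
    if "x \<in> N" "e / 2 \<le> cmod (\<phi> i x - 1)" "e / 2 \<le> cmod (\<phi> j x - 1)" for x i j
  proof -
    have "x \<in> V k \<and> x \<notin> V (Suc k)" if "e / 2 \<le> cmod (\<phi> k x - 1)" for k
      using \<Phi>[OF V(1)[of k] V(2)[of k], of x] that \<open>x \<in> N\<close>
      by (auto simp: \<phi>_def V_Suc dist_norm norm_minus_commute not_less)
    then show ?thesis using that V_anti[of "Suc i" j] V_anti[of "Suc j" i]
      by (metis Suc_leI linorder_neqE_nat subsetD)
  qed
  \<comment> \<open>The one bad function adds at most 2 to the sum, hence \<open>2 / Suc m\<close>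
    to the average, which has to stay below \<open>e / 2\<close>.\<close>
  obtain m :: nat where m: "4 / e < m" using reals_Archimedean2 by blast
  have m': "4 / e < Suc m" using m by simp
  have avg: "cmod ((\<Sum>k<Suc m. \<phi> k x) / Suc m - 1) \<le> (\<Sum>k<Suc m. cmod (\<phi> k x - 1)) / Suc m" for x
  proof -
    have "(\<Sum>k<Suc m. \<phi> k x) / Suc m - 1 = (\<Sum>k<Suc m. \<phi> k x - 1) / Suc m"
      by (simp only: sum_subtractf diff_divide_distrib) (simp del: of_nat_Suc sum.lessThan_Suc)
    then show ?thesis
      by (simp add: norm_divide divide_right_mono norm_sum del: of_nat_Suc sum.lessThan_Suc)
  qed
  show "\<exists>\<phi>\<in>A. \<forall>x\<in>N \<union> F. cmod (\<phi> x - 1) < e"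
  proof (intro bexI ballI)
    show "(\<lambda>x. (\<Sum>k<Suc m. \<phi> k x) / Suc m) \<in> A" by (rule pointwise_approximating_average[OF A \<phi>A])
    fix x assume "x \<in> N \<union> F"
    define bad where "bad = {k \<in> {..<Suc m}. e / 2 \<le> cmod (\<phi> k x - 1)}"
    have "card bad \<le> 1"
    proof (cases "x \<in> N")
      case True
      then show ?thesis using unique_bad by (simp add: card_le_Suc0_iff_eq bad_def)
    next
      case False
      then have "cmod (\<phi> k x - 1) < e / 2" for k
        using \<Phi>[OF V(1)[of k] V(2)[of k], of x] \<open>x \<in> N \<union> F\<close> by (simp add: \<phi>_def)
      then have "bad = {}" by (simp add: bad_def not_le[symmetric])
      then show ?thesis by simp
    qed
    have x: "x \<in> topspace Y" using \<open>x \<in> N \<union> F\<close> NY F by blast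
    have "(\<Sum>k<Suc m. cmod (\<phi> k x - 1)) \<le> (\<Sum>k<Suc m. e / 2 + (if k \<in> bad then 2 else 0))"
      using e AD(2)[OF \<phi>A x] by (intro sum_mono) (auto simp: bad_def not_le intro: less_imp_le add_increasing)
    also have "\<dots> = Suc m * (e / 2) + 2 * card bad"
    proof -
      have "{..<Suc m} \<inter> bad = bad" by (auto simp: bad_def)
      then show ?thesis
        by (simp add: sum.distrib sum.inter_restrict[symmetric] del: of_nat_Suc sum.lessThan_Suc)
    qed
    also have "\<dots> \<le> Suc m * (e / 2) + 2" using \<open>card bad \<le> 1\<close> by simp
    also have "\<dots> < Suc m * e" using m' e by (simp add: field_simps del: of_nat_Suc)
    finally have "(\<Sum>k<Suc m. cmod (\<phi> k x - 1)) / Suc m < e"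
      by (simp add: field_simps del: of_nat_Suc sum.lessThan_Suc)
    then show "cmod ((\<Sum>k<Suc m. \<phi> k x) / Suc m - 1) < e" using avg[of x] by linarith
  qed
qed

text \<open>The points without a good neighborhood form a closed set \<open>B\<close>. If it is
  nonempty it has an isolated point \<open>p\<close>; a small closed neighborhood of
  \<open>p\<close> meets \<open>B\<close> only in \<open>p\<close>, so it is good by the punctured
  case. This replaces transfinite induction along Cantor-Bendixson derivatives.\<close>

theorem uniformly_approximated_countable_compact:
  assumes comp: "compact_space Y" and haus: "Hausdorff_space Y" and count: "countable (topspace Y)"
  shows "uniformly_approximated Y (topspace Y)"
proof -
  define B where "B = {x \<in> topspace Y. \<forall>W. openin Y W \<longrightarrow> x \<in> W \<longrightarrow> \<not> uniformly_approximated Y W}"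
  have off_B: "uniformly_approximated Y K" if "compactin Y K" "K \<inter> B = {}" for K
  proof (rule uniformly_approximated_compactin[OF that(1)])
    fix x assume "x \<in> K"
    then show "\<exists>W. openin Y W \<and> x \<in> W \<and> uniformly_approximated Y W"
      using that compactin_subset_topspace[OF that(1)] by (auto simp: B_def)
  qed
  have "B = {}"
  proof (rule ccontr)
    assume "B \<noteq> {}"
    have BY: "B \<subseteq> topspace Y" by (auto simp: B_def)
    have "openin Y (topspace Y - B)"
    proof (subst openin_subopen, intro ballI)
      fix x assume "x \<in> topspace Y - B"
      then obtain W where W: "openin Y W" "x \<in> W" "uniformly_approximated Y W" by (auto simp: B_def)
      then show "\<exists>W. openin Y W \<and> x \<in> W \<and> W \<subseteq> topspace Y - B"
        using openin_subset[OF W(1)] by (auto simp: B_def)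
    qed
    then have "closedin Y B" using BY by (simp add: closedin_def)
    then have "compactin Y B" using comp by (rule closedin_compact_space[rotated])
    then have "compact_space (subtopology Y B)" by (rule compact_space_subtopology)
    moreover have "countable (topspace (subtopology Y B))" using count by (simp add: countable_Int1)
    moreover have "topspace (subtopology Y B) \<noteq> {}" using BY \<open>B \<noteq> {}\<close> by auto
    ultimately obtain p where p: "p \<in> topspace (subtopology Y B)" "openin (subtopology Y B) {p}"
      using countable_compact_Hausdorff_isolated Hausdorff_space_subtopology[OF haus] by metis
    then obtain U where U: "openin Y U" "{p} = U \<inter> B" unfolding openin_subtopology by blast
    have "neighbourhood_base_of (closedin Y) Y"
      using comp haus by (simp add: neighbourhood_base_of_closedin compact_Hausdorff_imp_regular_space)
    moreover have "openin Y U \<and> p \<in> U" using U by auto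
    ultimately have "\<exists>V N. openin Y V \<and> closedin Y N \<and> p \<in> V \<and> V \<subseteq> N \<and> N \<subseteq> U"
      unfolding neighbourhood_base_of by (elim allE impE)
    then obtain V N where V: "openin Y V" "closedin Y N" "p \<in> V" "V \<subseteq> N" "N \<subseteq> U"
      by (elim exE conjE)
    have "uniformly_approximated Y N"
    proof (rule uniformly_approximated_punctured)
      show "p \<in> topspace Y" using p by simp
      show "N \<subseteq> topspace Y" using V(2) by (rule closedin_subset)
      fix W assume W: "openin Y W" "p \<in> W"
      show "uniformly_approximated Y (N - W)"
      proof (rule off_B)
        show "compactin Y (N - W)"
          using closedin_diff[OF V(2) W(1)] comp by (rule closedin_compact_space[rotated])
        have "U \<inter> B \<subseteq> W" using W(2) by (simp flip: U(2))
        then show "(N - W) \<inter> B = {}" using V(5) by blast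
      qed
    qed
    then have "uniformly_approximated Y V" using V(4) by (rule uniformly_approximated_mono)
    then show False using p V(1,3) by (auto simp: B_def)
  qed
  then show ?thesis using off_B[of "topspace Y"] comp by (simp add: compact_space_def)
qed

section \<open>Convex combinations of characters\<close>

definition nontrivial_characters :: "('g, 'b) monoid_scheme \<Rightarrow> 'g topology \<Rightarrow> ('g \<Rightarrow> complex) set" where
  "nontrivial_characters G T = {\<theta> \<in> unitary_characters G T. \<exists>a\<in>carrier G. \<theta> a \<noteq> 1}"

text \<open>The coefficients at unit vectors of finite direct sums of nontrivial characters.\<close>

definition character_mixtures :: "('g, 'b) monoid_scheme \<Rightarrow> 'g topology \<Rightarrow> ('g \<Rightarrow> complex) set" where
  "character_mixtures G T = {\<lambda>x. \<Sum>i<n. complex_of_real (a i) * \<theta> i x | (n :: nat) a \<theta>.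
     (\<forall>i<n. 0 \<le> a i \<and> \<theta> i \<in> nontrivial_characters G T) \<and> (\<Sum>i<n. a i) = 1}"

lemma character_mixturesE:
  assumes "\<phi> \<in> character_mixtures G T"
  obtains n :: nat and a \<theta> where "\<phi> = (\<lambda>x. \<Sum>i<n. complex_of_real (a i) * \<theta> i x)"
    "\<And>i. i < n \<Longrightarrow> 0 \<le> a i" "\<And>i. i < n \<Longrightarrow> \<theta> i \<in> nontrivial_characters G T" "(\<Sum>i<n. a i) = 1"
  using assms unfolding character_mixtures_def by blast

lemma character_mixtures_convex:
  assumes "\<phi> \<in> character_mixtures G T" "\<psi> \<in> character_mixtures G T" "0 \<le> t" "t \<le> 1"
  shows "(\<lambda>x. (1 - complex_of_real t) * \<phi> x + t * \<psi> x) \<in> character_mixtures G T"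
proof -
  obtain n :: nat and a \<theta> where \<phi>: "\<phi> = (\<lambda>x. \<Sum>i<n. complex_of_real (a i) * \<theta> i x)"
    and a: "\<And>i. i < n \<Longrightarrow> 0 \<le> a i" "\<And>i. i < n \<Longrightarrow> \<theta> i \<in> nontrivial_characters G T" "(\<Sum>i<n. a i) = 1"
    using assms(1) by (rule character_mixturesE) blast
  obtain m :: nat and b \<omega> where \<psi>: "\<psi> = (\<lambda>x. \<Sum>i<m. complex_of_real (b i) * \<omega> i x)"
    and b: "\<And>i. i < m \<Longrightarrow> 0 \<le> b i" "\<And>i. i < m \<Longrightarrow> \<omega> i \<in> nontrivial_characters G T" "(\<Sum>i<m. b i) = 1"
    using assms(2) by (rule character_mixturesE) blast
  define c where "c i = (if i < n then (1 - t) * a i else t * b (i - n))" for i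
  define \<eta> where "\<eta> i = (if i < n then \<theta> i else \<omega> (i - n))" for i
  have "(\<lambda>x. (1 - complex_of_real t) * \<phi> x + t * \<psi> x) = (\<lambda>x. \<Sum>i<n + m. complex_of_real (c i) * \<eta> i x)"
    unfolding sum_lessThan_add \<phi> \<psi> by (simp add: c_def \<eta>_def sum_distrib_left mult.assoc)
  moreover have "(\<Sum>i<n + m. c i) = 1"
    unfolding sum_lessThan_add using a(3) b(3) by (simp add: c_def flip: sum_distrib_left)
  moreover have "0 \<le> c i \<and> \<eta> i \<in> nontrivial_characters G T" if "i < n + m" for i
    using that a(1,2)[of i] b(1,2)[of "i - n"] assms(3,4) by (auto simp: c_def \<eta>_def)
  ultimately show ?thesis unfolding character_mixtures_def by blast
qed

lemma nontrivial_character_mixture: "\<theta> \<in> nontrivial_characters G T \<Longrightarrow> \<theta> \<in> character_mixtures G T"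
  unfolding character_mixtures_def
  by (rule CollectI, rule exI[of _ 1], rule exI[of _ "\<lambda>_. 1"], rule exI[of _ "\<lambda>_. \<theta>"]) simp

text \<open>\<open>C\<close> is a countable compact Hausdorff space, and on it a convex combination
  of unimodular values is within 2 of 1, as the averaging argument requires.\<close>

theorem character_mixture_near_one:
  assumes G: "topological_group G T" and comm: "comm_group G" and pre: "precompact_group TYPE('k) G T"
    and count: "countable (carrier G)" and inf: "infinite (carrier G)"
    and C: "compactin T C" and e: "0 < e"
  obtains \<phi> where "\<phi> \<in> character_mixtures G T" "\<And>x. x \<in> C \<Longrightarrow> cmod (\<phi> x - 1) < e"
proof -
  interpret topological_group G T by fact
  have CG: "C \<subseteq> carrier G" using compactin_subset_topspace[OF C] topspace_eq by simp
  define Y where "Y = subtopology T C"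
  have top: "topspace Y = C" using CG by (auto simp: Y_def topspace_eq)
  have "pointwise_approximating Y (character_mixtures G T)"
    unfolding pointwise_approximating_def
  proof (intro conjI ballI allI impI)
    fix \<phi> assume "\<phi> \<in> character_mixtures G T"
    then obtain n :: nat and a \<theta> where \<phi>: "\<phi> = (\<lambda>x. \<Sum>i<n. complex_of_real (a i) * \<theta> i x)"
      and a: "\<And>i. i < n \<Longrightarrow> 0 \<le> a i" "\<And>i. i < n \<Longrightarrow> \<theta> i \<in> nontrivial_characters G T" "(\<Sum>i<n. a i) = 1"
      by (rule character_mixturesE) blast
    have "continuous_map T euclidean \<phi>"
      unfolding \<phi> using a(2)
      by (intro continuous_map_sum) (auto simp: nontrivial_characters_def unitary_characters_def continuous_map_atin intro: tendsto_mult)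
    then show "continuous_map Y euclidean \<phi>" unfolding Y_def by (rule continuous_map_from_subtopology)
    fix x assume "x \<in> topspace Y"
    then have "x \<in> carrier G" using CG top by auto
    then have "cmod (\<phi> x) \<le> (\<Sum>i<n. a i)"
      unfolding \<phi> using a(1,2)
      by (intro order.trans[OF norm_sum] sum_mono) (auto simp: norm_mult nontrivial_characters_def unitary_characters_def)
    then show "cmod (\<phi> x - 1) \<le> 2" using a(3) norm_triangle_ineq4[of "\<phi> x" 1] by simp
  next
    fix F and d :: real assume F: "finite F" "F \<subseteq> topspace Y" "0 < d"
    have "infinite (unitary_characters G T)" by (rule infinite_unitary_characters[OF G comm pre inf])
    then obtain \<theta> where "\<theta> \<in> unitary_characters G T" "\<exists>a\<in>carrier G. \<theta> a \<noteq> 1" "\<And>x. x \<in> F \<Longrightarrow> cmod (\<theta> x - 1) < d"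
      using infinite_unitary_characters_near_one[of G T F d] F CG top by (metis order.trans)
    then show "\<exists>\<phi>\<in>character_mixtures G T. \<forall>x\<in>F. cmod (\<phi> x - 1) < d"
      by (intro bexI[of _ \<theta>] nontrivial_character_mixture) (auto simp: nontrivial_characters_def)
  qed (rule character_mixtures_convex)
  moreover have "uniformly_approximated Y C"
  proof -
    have "compact_space Y" using C by (simp add: Y_def compact_space_subtopology)
    moreover have "Hausdorff_space Y" unfolding Y_def by (rule Hausdorff_space_subtopology[OF Hausdorff])
    ultimately show ?thesis
      using uniformly_approximated_countable_compact[of Y] countable_subset[OF CG count] top by simp
  qed
  ultimately have "\<exists>\<phi>\<in>character_mixtures G T. \<forall>x\<in>C \<union> {}. cmod (\<phi> x - 1) < e"
    using e by (intro uniformly_approximatedD) auto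
  then show thesis using that by auto
qed

section \<open>Finite-dimensional diagonal representations\<close>

text \<open>A copy of C^n inside \<open>'h\<close>. Taking C^n as the sequences that vanish from
  \<open>n\<close> on lets one injection \<open>\<iota>\<close> serve all dimensions.\<close>

definition coordinate_space :: "((nat \<Rightarrow> complex) \<Rightarrow> 'h) \<Rightarrow> nat \<Rightarrow> 'h inner_space" where
  "coordinate_space \<iota> n = \<lparr>carrier = \<iota> ` {x. \<forall>i\<ge>n. x i = 0},
     monoid.mult = (\<lambda>_ _. undefined), one = undefined, ring.zero = \<iota> (\<lambda>_. 0),
     add = (\<lambda>u v. \<iota> (\<lambda>i. the_inv \<iota> u i + the_inv \<iota> v i)),
     module.smult = (\<lambda>c u. \<iota> (\<lambda>i. c * the_inv \<iota> u i)),
     hinner = (\<lambda>u v. \<Sum>i<n. the_inv \<iota> u i * cnj (the_inv \<iota> v i))\<rparr>"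

text \<open>Restricted to the carrier because \<open>unitary_maps\<close> consists of extensional
  functions.\<close>

definition diagonal_rep ::
    "((nat \<Rightarrow> complex) \<Rightarrow> 'h) \<Rightarrow> nat \<Rightarrow> (nat \<Rightarrow> 'g \<Rightarrow> complex) \<Rightarrow> 'g \<Rightarrow> 'h \<Rightarrow> 'h" where
  "diagonal_rep \<iota> n \<theta> g = (\<lambda>v\<in>carrier (coordinate_space \<iota> n). \<iota> (\<lambda>i. \<theta> i g * the_inv \<iota> v i))"

lemma coordinate_space_simps [simp]:
  "carrier (coordinate_space \<iota> n) = \<iota> ` {x. \<forall>i\<ge>n. x i = 0}"
  "\<zero>\<^bsub>coordinate_space \<iota> n\<^esub> = \<iota> (\<lambda>_. 0)"
  "u \<oplus>\<^bsub>coordinate_space \<iota> n\<^esub> v = \<iota> (\<lambda>i. the_inv \<iota> u i + the_inv \<iota> v i)"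
  "c \<odot>\<^bsub>coordinate_space \<iota> n\<^esub> u = \<iota> (\<lambda>i. c * the_inv \<iota> u i)"
  "hinner (coordinate_space \<iota> n) u v = (\<Sum>i<n. the_inv \<iota> u i * cnj (the_inv \<iota> v i))"
  by (simp_all add: coordinate_space_def)

context
  fixes \<iota> :: "(nat \<Rightarrow> complex) \<Rightarrow> 'h"
  assumes \<iota>: "inj \<iota>"
begin

lemma the_inv_\<iota> [simp]: "the_inv \<iota> (\<iota> x) = x"
  using \<iota> by (rule the_inv_f_f)

lemma \<iota>_eq_iff [simp]: "\<iota> x = \<iota> y \<longleftrightarrow> x = y"
  using \<iota> by (auto dest: injD)

lemma abelian_group_coordinate_space: "abelian_group (coordinate_space \<iota> n)"
proof (rule abelian_groupI)
  fix x assume "x \<in> carrier (coordinate_space \<iota> n)"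
  then show "\<exists>y\<in>carrier (coordinate_space \<iota> n). y \<oplus>\<^bsub>coordinate_space \<iota> n\<^esub> x = \<zero>\<^bsub>coordinate_space \<iota> n\<^esub>"
    by (intro bexI[of _ "\<iota> (\<lambda>i. - the_inv \<iota> x i)"]) auto
qed (auto simp: algebra_simps)

lemma complex_inner_space_coordinate_space: "complex_inner_space (coordinate_space \<iota> n)"
proof -
  have "Module.module (ring_of_type_algebra :: complex ring) (coordinate_space \<iota> n)"
    by (rule moduleI[OF cring_from_type_algebra abelian_group_coordinate_space])
      (auto simp: ring_of_type_algebra_def algebra_simps)
  moreover have "complex_inner_space_axioms (coordinate_space \<iota> n)"
  proof
    fix x y assume xy: "x \<in> carrier (coordinate_space \<iota> n)" "y \<in> carrier (coordinate_space \<iota> n)"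
    show "hinner (coordinate_space \<iota> n) y x = cnj (hinner (coordinate_space \<iota> n) x y)"
      by (simp add: mult.commute)
  next
    fix x
    assume x: "x \<in> carrier (coordinate_space \<iota> n)" "hinner (coordinate_space \<iota> n) x x = 0"
    have "(\<Sum>i<n. the_inv \<iota> x i * cnj (the_inv \<iota> x i)) = complex_of_real (\<Sum>i<n. (cmod (the_inv \<iota> x i))\<^sup>2)"
      by (simp add: complex_norm_square[symmetric])
    then have "complex_of_real (\<Sum>i<n. (cmod (the_inv \<iota> x i))\<^sup>2) = 0" using x(2) by simp
    then have "(\<Sum>i<n. (cmod (the_inv \<iota> x i))\<^sup>2) = 0" by (simp only: of_real_eq_0_iff)
    then have "\<forall>i<n. the_inv \<iota> x i = 0" by (simp add: sum_nonneg_eq_0_iff)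
    then show "x = \<zero>\<^bsub>coordinate_space \<iota> n\<^esub>"
      using x(1) by (auto simp: fun_eq_iff) (metis not_le)
  qed (auto simp: sum.distrib sum_distrib_left algebra_simps intro!: sum_nonneg add_nonneg_nonneg)
  ultimately show ?thesis by (simp add: complex_inner_space_def)
qed

lemma hdist_coordinate_space:
  assumes "\<forall>i\<ge>n. x i = 0" "\<forall>i\<ge>n. y i = 0"
  shows "hdist (coordinate_space \<iota> n) (\<iota> x) (\<iota> y) = L2_set (\<lambda>i. cmod (x i - y i)) {..<n}"
proof -
  interpret H: abelian_group "coordinate_space \<iota> n" by (rule abelian_group_coordinate_space)
  have "\<ominus>\<^bsub>coordinate_space \<iota> n\<^esub> (\<iota> y) = \<iota> (\<lambda>i. - y i)"
    using assms by (intro H.minus_equality) auto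
  then have "\<iota> x \<ominus>\<^bsub>coordinate_space \<iota> n\<^esub> \<iota> y = \<iota> (\<lambda>i. x i - y i)"
    by (simp add: a_minus_def)
  moreover have "Re (w * cnj w) = (cmod w)\<^sup>2" for w
    unfolding cmod_power2 by (simp add: power2_eq_square)
  then have "Re (\<Sum>i<n. (x i - y i) * cnj (x i - y i)) = (\<Sum>i<n. (cmod (x i - y i))\<^sup>2)"
    by (simp only: Re_sum)
  ultimately show ?thesis
    using assms by (simp add: hdist_def hnorm_def L2_set_def del: complex_cnj_diff)
qed

lemma complex_hilbert_space_coordinate_space: "complex_hilbert_space (coordinate_space \<iota> n)"
proof -
  let ?H = "coordinate_space \<iota> n"
  interpret complex_inner_space ?H by (rule complex_inner_space_coordinate_space)
  interpret metric: Metric_space "carrier ?H" "hdist ?H" by (rule Metric_space_hdist)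
  have "metric.mcomplete"
    unfolding metric.mcomplete_def
  proof (intro allI impI)
    fix \<sigma> assume \<sigma>: "metric.MCauchy \<sigma>"
    then have "range \<sigma> \<subseteq> carrier ?H" unfolding metric.MCauchy_def by (rule conjunct1)
    then have "\<forall>k. \<exists>x. (\<forall>i\<ge>n. x i = 0) \<and> \<sigma> k = \<iota> x" by (auto simp: image_subset_iff)
    then obtain c where c: "\<And>k i. i \<ge> n \<Longrightarrow> c k i = 0" "\<And>k. \<sigma> k = \<iota> (c k)" by metis
    have dist: "hdist ?H (\<sigma> k) (\<sigma> l) = L2_set (\<lambda>i. cmod (c k i - c l i)) {..<n}" for k l
      unfolding c(2) using c(1) by (intro hdist_coordinate_space) auto
    have "Cauchy (\<lambda>k. c k i)" for i
    proof (cases "i < n")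
      case True
      show ?thesis
      proof (rule CauchyI)
        fix e :: real assume "0 < e"
        then obtain N where N: "\<And>k l. N \<le> k \<Longrightarrow> N \<le> l \<Longrightarrow> hdist ?H (\<sigma> k) (\<sigma> l) < e"
          using \<sigma> unfolding metric.MCauchy_def by blast
        have "cmod (c k i - c l i) \<le> hdist ?H (\<sigma> k) (\<sigma> l)" for k l
          unfolding dist using True by (intro member_le_L2_set) auto
        then show "\<exists>N. \<forall>k\<ge>N. \<forall>l\<ge>N. cmod (c k i - c l i) < e" using N by (meson order.strict_trans1)
      qed
    qed (simp add: c(1) convergent_Cauchy convergent_const)
    then have "\<exists>z. (\<lambda>k. c k i) \<longlonglongrightarrow> z" for i by (simp add: Cauchy_convergent_iff convergent_def)
    then obtain z where z: "\<And>i. (\<lambda>k. c k i) \<longlonglongrightarrow> z i" by metis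
    have z0: "z i = 0" if "i \<ge> n" for i
      using z[of i] c(1)[OF that] by (simp add: LIMSEQ_const_iff)
    have "limitin metric.mtopology \<sigma> (\<iota> z) sequentially"
      unfolding metric.limit_metric_sequentially
    proof (intro conjI allI impI)
      show "\<iota> z \<in> carrier ?H" using z0 by auto
      fix e :: real assume "0 < e"
      have "(\<lambda>k. \<Sum>i<n. cmod (c k i - z i)) \<longlonglongrightarrow> (\<Sum>i<n. cmod (z i - z i))"
        by (intro tendsto_intros z)
      then have "(\<lambda>k. \<Sum>i<n. cmod (c k i - z i)) \<longlonglongrightarrow> 0" by simp
      then have "\<forall>\<^sub>F k in sequentially. (\<Sum>i<n. cmod (c k i - z i)) < e"
        using \<open>0 < e\<close> by (rule order_tendstoD(2))
      then obtain N where N: "\<And>k. N \<le> k \<Longrightarrow> (\<Sum>i<n. cmod (c k i - z i)) < e"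
        unfolding eventually_sequentially by blast
      have "\<sigma> k \<in> carrier ?H \<and> hdist ?H (\<sigma> k) (\<iota> z) < e" if "N \<le> k" for k
      proof -
        have "hdist ?H (\<sigma> k) (\<iota> z) = L2_set (\<lambda>i. cmod (c k i - z i)) {..<n}"
          unfolding c(2) using c(1) z0 by (intro hdist_coordinate_space) auto
        also have "\<dots> \<le> (\<Sum>i<n. cmod (c k i - z i))" by (intro L2_set_le_sum) auto
        finally show ?thesis using N[OF that] c by auto
      qed
      then show "\<exists>N. \<forall>k\<ge>N. \<sigma> k \<in> carrier ?H \<and> hdist ?H (\<sigma> k) (\<iota> z) < e" by blast
    qed
    then show "\<exists>x. limitin metric.mtopology \<sigma> x sequentially" by blast
  qed
  then show ?thesis by unfold_locales
qed

lemma diagonal_rep_simps: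
  "\<forall>i\<ge>n. x i = 0 \<Longrightarrow> diagonal_rep \<iota> n \<theta> g (\<iota> x) = \<iota> (\<lambda>i. \<theta> i g * x i)"
  by (simp add: diagonal_rep_def)

lemma diagonal_rep_unitary:
  assumes "\<And>i. i < n \<Longrightarrow> cmod (\<theta> i g) = 1"
  shows "diagonal_rep \<iota> n \<theta> g \<in> unitary_maps (coordinate_space \<iota> n) (coordinate_space \<iota> n)"
proof -
  have unit: "\<theta> i g * cnj (\<theta> i g) = 1" if "i < n" for i
    using assms[OF that] by (simp add: complex_norm_square[symmetric])
  have unit': "\<theta> i g * x i * cnj (\<theta> i g * y i) = x i * cnj (y i)" if "i < n" for i and x y :: "nat \<Rightarrow> complex"
  proof -
    have "\<theta> i g * x i * cnj (\<theta> i g * y i) = (\<theta> i g * cnj (\<theta> i g)) * (x i * cnj (y i))" by simp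
    then show ?thesis using unit[OF that] by simp
  qed
  have inner: "(\<Sum>i<n. \<theta> i g * x i * cnj (\<theta> i g * y i)) = (\<Sum>i<n. x i * cnj (y i))" for x y :: "nat \<Rightarrow> complex"
    by (intro sum.cong refl unit') simp
  have "bij_betw (diagonal_rep \<iota> n \<theta> g) (carrier (coordinate_space \<iota> n)) (carrier (coordinate_space \<iota> n))"
  proof (rule bij_betw_byWitness[where f' = "diagonal_rep \<iota> n (\<lambda>i g. cnj (\<theta> i g)) g"])
    have "cnj (\<theta> i g) * (\<theta> i g * x i) = x i \<and> \<theta> i g * (cnj (\<theta> i g) * x i) = x i"
      if "\<forall>i\<ge>n. x i = 0" for x i
    proof (cases "i < n")
      case True
      have "cnj (\<theta> i g) * (\<theta> i g * x i) = (\<theta> i g * cnj (\<theta> i g)) * x i"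
        "\<theta> i g * (cnj (\<theta> i g) * x i) = (\<theta> i g * cnj (\<theta> i g)) * x i" by simp_all
      then show ?thesis unfolding unit[OF True] by simp
    qed (use that in simp)
    then show "\<forall>a\<in>carrier (coordinate_space \<iota> n). diagonal_rep \<iota> n (\<lambda>i g. cnj (\<theta> i g)) g (diagonal_rep \<iota> n \<theta> g a) = a"
      "\<forall>a\<in>carrier (coordinate_space \<iota> n). diagonal_rep \<iota> n \<theta> g (diagonal_rep \<iota> n (\<lambda>i g. cnj (\<theta> i g)) g a) = a"
      by (auto simp: diagonal_rep_simps)
  qed (auto simp: diagonal_rep_simps)
  then show ?thesis
    unfolding unitary_maps_def
    by (auto simp: diagonal_rep_simps distrib_left mult.left_commute inner simp del: complex_cnj_mult)
      (simp add: diagonal_rep_def)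
qed

lemma diagonal_rep_in_unitary_reps:
  assumes G: "topological_group G T" and \<theta>: "\<And>i. i < n \<Longrightarrow> \<theta> i \<in> unitary_characters G T"
  shows "(coordinate_space \<iota> n, diagonal_rep \<iota> n \<theta>) \<in> unitary_reps G T"
proof -
  let ?H = "coordinate_space \<iota> n"
  interpret topological_group G T by fact
  interpret complex_hilbert_space ?H by (rule complex_hilbert_space_coordinate_space)
  interpret metric: Metric_space "carrier ?H" "hdist ?H" by (rule Metric_space_hdist)
  have norm: "cmod (\<theta> i g) = 1" if "i < n" "g \<in> carrier G" for i g
    using \<theta>[OF that(1)] that(2) by (simp add: unitary_characters_def)
  have unitary: "diagonal_rep \<iota> n \<theta> g \<in> unitary_maps ?H ?H" if "g \<in> carrier G" for g
    using norm that by (intro diagonal_rep_unitary) auto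
  have "diagonal_rep \<iota> n \<theta> \<in> hom G (unitary_group ?H)"
  proof (rule homI)
    fix g h assume gh: "g \<in> carrier G" "h \<in> carrier G"
    have mult: "\<theta> i (g \<otimes>\<^bsub>G\<^esub> h) = \<theta> i g * \<theta> i h" if "i < n" for i
      using \<theta>[OF that] gh by (simp add: unitary_characters_def)
    have m: "(\<lambda>i. \<theta> i (g \<otimes>\<^bsub>G\<^esub> h) * x i) = (\<lambda>i. \<theta> i g * (\<theta> i h * x i))" if "\<forall>i\<ge>n. x i = 0" for x
      using mult that by (auto simp: fun_eq_iff not_le[symmetric])
    show "diagonal_rep \<iota> n \<theta> (g \<otimes>\<^bsub>G\<^esub> h)
        = diagonal_rep \<iota> n \<theta> g \<otimes>\<^bsub>unitary_group ?H\<^esub> diagonal_rep \<iota> n \<theta> h"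
    proof (rule ext)
      fix v
      show "diagonal_rep \<iota> n \<theta> (g \<otimes>\<^bsub>G\<^esub> h) v
        = (diagonal_rep \<iota> n \<theta> g \<otimes>\<^bsub>unitary_group ?H\<^esub> diagonal_rep \<iota> n \<theta> h) v"
      proof (cases "v \<in> carrier ?H")
        case True
        then obtain x where x: "\<forall>i\<ge>n. x i = 0" "v = \<iota> x" by auto
        then show ?thesis using m[OF x(1)] True
          by (simp add: unitary_group_def compose_def diagonal_rep_simps)
      qed (simp add: unitary_group_def compose_def diagonal_rep_def)
    qed
  qed (simp add: unitary_group_def unitary)
  moreover have "continuous_map T (unitary_sot ?H) (diagonal_rep \<iota> n \<theta>)"
    unfolding unitary_sot_def continuous_map_in_subtopology continuous_map_componentwise
  proof (intro conjI ballI)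
    show "diagonal_rep \<iota> n \<theta> ` topspace T \<subseteq> extensional (carrier ?H)"
      by (auto simp: diagonal_rep_def)
    show "diagonal_rep \<iota> n \<theta> \<in> topspace T \<rightarrow> unitary_maps ?H ?H"
      using unitary by (auto simp: topspace_eq)
    fix v assume "v \<in> carrier ?H"
    then obtain x where x: "\<forall>i\<ge>n. x i = 0" "v = \<iota> x" by auto
    \<comment> \<open>Strong continuity follows because the bound is a finite sum of continuous
      functions of \<open>h\<close> that vanishes at \<open>h = g\<close>.\<close>
    have dist: "hdist ?H (diagonal_rep \<iota> n \<theta> g v) (diagonal_rep \<iota> n \<theta> h v) \<le> (\<Sum>i<n. cmod ((\<theta> i g - \<theta> i h) * x i))" for g h
    proof -
      have "hdist ?H (diagonal_rep \<iota> n \<theta> g v) (diagonal_rep \<iota> n \<theta> h v)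
          = L2_set (\<lambda>i. cmod (\<theta> i g * x i - \<theta> i h * x i)) {..<n}"
        unfolding x(2) diagonal_rep_simps[OF x(1)] using x(1) by (intro hdist_coordinate_space) auto
      also have "\<dots> \<le> (\<Sum>i<n. cmod ((\<theta> i g - \<theta> i h) * x i))"
        unfolding left_diff_distrib by (intro L2_set_le_sum) auto
      finally show ?thesis .
    qed
    show "continuous_map T metric.mtopology (\<lambda>g. diagonal_rep \<iota> n \<theta> g v)"
      unfolding metric.continuous_map_to_metric
    proof (intro ballI allI impI)
      fix g and e :: real assume g: "g \<in> topspace T" and e: "0 < e"
      define F where "F h = (\<Sum>i<n. cmod ((\<theta> i g - \<theta> i h) * x i))" for h
      have "continuous_map T euclideanreal F"
        unfolding F_def using \<theta>
        by (intro continuous_map_sum continuous_map_norm)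
          (auto simp: unitary_characters_def continuous_map_atin intro!: tendsto_mult tendsto_diff)
      then have "openin T {h \<in> topspace T. F h \<in> {..<e}}"
        by (rule openin_continuous_map_preimage) simp
      moreover have "g \<in> {h \<in> topspace T. F h \<in> {..<e}}" using g e by (simp add: F_def)
      moreover have "diagonal_rep \<iota> n \<theta> h v \<in> metric.mball (diagonal_rep \<iota> n \<theta> g v) e"
        if "h \<in> {h \<in> topspace T. F h \<in> {..<e}}" for h
        unfolding metric.in_mball using that dist[of g h] x by (auto simp: F_def diagonal_rep_simps)
      ultimately show "\<exists>U. openin T U \<and> g \<in> U \<and>
          (\<forall>h\<in>U. diagonal_rep \<iota> n \<theta> h v \<in> metric.mball (diagonal_rep \<iota> n \<theta> g v) e)"
        by blast
    qed
  qed
  ultimately show ?thesis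
    unfolding unitary_reps_def using complex_hilbert_space_coordinate_space by simp
qed

lemma diagonal_rep_no_invariant_vector:
  assumes "\<And>i. i < n \<Longrightarrow> \<exists>g\<in>carrier G. \<theta> i g \<noteq> 1"
  shows "\<not> has_invariant_vector G (coordinate_space \<iota> n, diagonal_rep \<iota> n \<theta>)"
proof
  assume "has_invariant_vector G (coordinate_space \<iota> n, diagonal_rep \<iota> n \<theta>)"
  then obtain x where x: "\<forall>i\<ge>n. x i = 0" "x \<noteq> (\<lambda>_. 0)"
    and inv: "\<And>g. g \<in> carrier G \<Longrightarrow> (\<lambda>i. \<theta> i g * x i) = x"
    by (auto simp: diagonal_rep_simps)
  have "x i = 0" for i
  proof (cases "i < n")
    case True
    then obtain g where g: "g \<in> carrier G" "\<theta> i g \<noteq> 1" using assms by blast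
    have "\<theta> i g * x i = x i" using fun_cong[OF inv[OF g(1)], of i] by simp
    then show ?thesis using g(2) by simp
  qed (use x(1) in simp)
  then show False using x(2) by auto
qed

text \<open>The vector with coordinates \<open>sqrt (t * a i)\<close> realizes it as a single
  coefficient. The factor \<open>t\<close> is present because the coefficient sums of the trivial
  class are arbitrary nonnegative constants, not only 1.\<close>

lemma diagonal_rep_coefficient:
  assumes t: "0 \<le> t" and a: "\<And>i. i < n \<Longrightarrow> 0 \<le> a i"
  shows "(\<lambda>g\<in>carrier G. complex_of_real t * (\<Sum>i<n. complex_of_real (a i) * \<theta> i g))
    \<in> matrix_coeff_sums G (coordinate_space \<iota> n, diagonal_rep \<iota> n \<theta>)"
proof -
  define x where "x i = (if i < n then complex_of_real (sqrt (t * a i)) else 0)" for i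
  have x: "\<forall>i\<ge>n. x i = 0" by (simp add: x_def)
  have "(\<Sum>i<n. \<theta> i g * x i * cnj (x i)) = complex_of_real t * (\<Sum>i<n. complex_of_real (a i) * \<theta> i g)" for g
    unfolding sum_distrib_left
  proof (intro sum.cong refl)
    fix i assume "i \<in> {..<n}"
    then have "x i * cnj (x i) = complex_of_real (t * a i)"
      using t a by (simp add: x_def flip: of_real_mult)
    then show "\<theta> i g * x i * cnj (x i) = complex_of_real t * (complex_of_real (a i) * \<theta> i g)"
      by (simp add: mult.assoc mult.commute mult.left_commute)
  qed
  then have "(\<lambda>g\<in>carrier G. complex_of_real t * (\<Sum>i<n. complex_of_real (a i) * \<theta> i g))
    = (\<lambda>g\<in>carrier G. hinner (coordinate_space \<iota> n) (diagonal_rep \<iota> n \<theta> g (\<iota> x)) (\<iota> x))"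
    by (simp add: diagonal_rep_simps[OF x])
  also have "\<dots> \<in> matrix_coeffs G (coordinate_space \<iota> n, diagonal_rep \<iota> n \<theta>)"
    unfolding matrix_coeffs.simps using x by (intro CollectI exI[of _ "\<iota> x"] conjI refl) auto
  finally have c: "(\<lambda>g\<in>carrier G. complex_of_real t * (\<Sum>i<n. complex_of_real (a i) * \<theta> i g))
    \<in> matrix_coeffs G (coordinate_space \<iota> n, diagonal_rep \<iota> n \<theta>)" (is "?f \<in> _") .
  have "?f = (\<lambda>g\<in>carrier G. \<Sum>i<Suc 0. ?f g)" by (simp add: restrict_def fun_eq_iff)
  then show ?thesis unfolding matrix_coeff_sums_def using c
    by (intro CollectI exI[of _ "Suc 0"] exI[of _ "\<lambda>_. ?f"]) blast
qed

end

section \<open>Equivalence classes of representations and the trivial class\<close>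

lemma unitary_rep_closed:
  assumes "\<rho> \<in> hom G (unitary_group H)" "g \<in> carrier G" "v \<in> carrier H"
  shows "\<rho> g v \<in> carrier H"
proof -
  have "\<rho> g \<in> unitary_maps H H" using assms(1,2) by (auto simp: hom_def unitary_group_def)
  then have "bij_betw (\<rho> g) (carrier H) (carrier H)" by (simp add: unitary_maps_def)
  then show ?thesis using assms(3) by (rule bij_betw_apply)
qed

lemma rep_equiv_refl:
  assumes "r \<in> unitary_reps G T" shows "(r, r) \<in> rep_equiv G T"
proof -
  obtain H \<rho> where r: "r = (H, \<rho>)" by fastforce
  have "complex_hilbert_space H" and \<rho>: "\<rho> \<in> hom G (unitary_group H)"
    using assms by (auto simp: r unitary_reps_def)
  then interpret complex_hilbert_space H by simp
  have "(\<lambda>x\<in>carrier H. x) \<in> unitary_maps H H"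
    by (auto simp: unitary_maps_def bij_betw_def inj_on_def M.a_closed smult_closed)
  moreover have "\<rho> g v \<in> carrier H" if "g \<in> carrier G" "v \<in> carrier H" for g v
    using \<rho> that by (rule unitary_rep_closed)
  ultimately show ?thesis
    using assms unfolding r rep_equiv_def by (auto intro!: bexI[of _ "\<lambda>x\<in>carrier H. x"])
qed

text \<open>Property (T) asks about every member of a class, whereas invariant vectors are excluded
  directly only for the diagonal representative.\<close>

lemma has_invariant_vector_rep_equiv:
  assumes "(r, s) \<in> rep_equiv G T" "has_invariant_vector G s"
  shows "has_invariant_vector G r"
proof -
  obtain H \<rho> K \<sigma> where rs: "r = (H, \<rho>)" "s = (K, \<sigma>)" by fastforce
  obtain U where "complex_hilbert_space H" "complex_hilbert_space K" and \<rho>: "\<rho> \<in> hom G (unitary_group H)"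
    and U: "U \<in> unitary_maps H K" "\<And>g v. \<lbrakk>g \<in> carrier G; v \<in> carrier H\<rbrakk> \<Longrightarrow> U (\<rho> g v) = \<sigma> g (U v)"
    using assms(1) by (auto simp: rs rep_equiv_def unitary_reps_def)
  then interpret H: complex_hilbert_space H + K: complex_hilbert_space K by simp_all
  obtain w where w: "w \<in> carrier K" "w \<noteq> \<zero>\<^bsub>K\<^esub>" "\<And>g. g \<in> carrier G \<Longrightarrow> \<sigma> g w = w"
    using assms(2) by (auto simp: rs)
  have bij: "bij_betw U (carrier H) (carrier K)"
    and add: "\<And>x y. \<lbrakk>x \<in> carrier H; y \<in> carrier H\<rbrakk> \<Longrightarrow> U (x \<oplus>\<^bsub>H\<^esub> y) = U x \<oplus>\<^bsub>K\<^esub> U y"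
    using U(1) by (auto simp: unitary_maps_def)
  have "w \<in> U ` carrier H" using bij_betw_imp_surj_on[OF bij] w(1) by simp
  then obtain v where v: "w = U v" "v \<in> carrier H" by (rule imageE)
  have "U \<zero>\<^bsub>H\<^esub> \<in> carrier K" using bij by (rule bij_betw_apply) simp
  moreover have "U \<zero>\<^bsub>H\<^esub> \<oplus>\<^bsub>K\<^esub> U \<zero>\<^bsub>H\<^esub> = U \<zero>\<^bsub>H\<^esub>" using add[of "\<zero>\<^bsub>H\<^esub>" "\<zero>\<^bsub>H\<^esub>"] by simp
  ultimately have "U \<zero>\<^bsub>H\<^esub> = \<zero>\<^bsub>K\<^esub>" by (metis K.M.add.l_cancel_one)
  then have "v \<noteq> \<zero>\<^bsub>H\<^esub>" using v w by auto
  moreover have "\<rho> g v = v" if g: "g \<in> carrier G" for g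
  proof -
    have "\<rho> g v \<in> carrier H"
      using \<rho> g v(2) by (rule unitary_rep_closed)
    moreover have "U (\<rho> g v) = U v" using U(2)[OF g v(2)] w(3)[OF g] v by simp
    ultimately show ?thesis using bij_betw_imp_inj_on[OF bij] v(2) by (simp add: inj_on_eq_iff)
  qed
  ultimately show ?thesis using v by (auto simp: rs)
qed

text \<open>Each coefficient of a trivial action is the constant squared norm of its vector.\<close>

lemma trivial_class_coeff_sum:
  fixes G :: "('g, 'b) monoid_scheme"
  assumes "f \<in> class_coeff_sums G (trivial_class G T :: ('g, 'h) rep set)"
  obtains t where "0 \<le> t" "\<And>x. x \<in> carrier G \<Longrightarrow> f x = complex_of_real t"
proof -
  obtain H :: "'h inner_space" and \<rho> where r: "(H, \<rho>) \<in> trivial_class G T" and f: "f \<in> matrix_coeff_sums G (H, \<rho>)"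
    using assms by (auto simp: class_coeff_sums_def)
  have "complex_hilbert_space H" and triv: "\<And>g v. \<lbrakk>g \<in> carrier G; v \<in> carrier H\<rbrakk> \<Longrightarrow> \<rho> g v = v"
    using r by (auto simp: trivial_class_def unitary_reps_def)
  then interpret complex_hilbert_space H by simp
  obtain n F where F: "\<And>i. i < (n::nat) \<Longrightarrow> F i \<in> matrix_coeffs G (H, \<rho>)" and fF: "f = (\<lambda>g\<in>carrier G. \<Sum>i<n. F i g)"
    using f by (auto simp: matrix_coeff_sums_def)
  have "\<exists>v\<in>carrier H. \<forall>g\<in>carrier G. F i g = complex_of_real ((hnorm H v)\<^sup>2)" if i: "i < n" for i
    using F[OF i] triv inner_self by fastforce
  then obtain v where v: "\<And>i g. \<lbrakk>i < n; g \<in> carrier G\<rbrakk> \<Longrightarrow> F i g = complex_of_real ((hnorm H (v i))\<^sup>2)"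
    by metis
  show thesis
    by (rule that[of "\<Sum>i<n. (hnorm H (v i))\<^sup>2"]) (simp_all add: sum_nonneg fF v)
qed

text \<open>The injection gives \<open>'h\<close> room for every C^n and at least continuum many
  elements, so that \<open>property_T\<close> is not degenerate.\<close>

theorem theorem6p1:
  fixes G :: "('g, 'b) monoid_scheme" and T :: "'g topology"
  assumes "topological_group G T"
    and "comm_group G"
    and "countable (carrier G)" and "infinite (carrier G)"
    and "precompact_group TYPE('k) G T"
    and "\<exists>\<iota> :: (nat \<Rightarrow> complex) \<Rightarrow> 'h. inj \<iota>"
  shows "\<not> property_T TYPE('h) G T"
proof
  assume property_T: "property_T TYPE('h) G T"
  obtain \<iota> :: "(nat \<Rightarrow> complex) \<Rightarrow> 'h" where \<iota>: "inj \<iota>" using assms(6) by blast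
  define rep where "rep n \<theta> = (coordinate_space \<iota> n, diagonal_rep \<iota> n \<theta>)" for n and \<theta> :: "nat \<Rightarrow> 'g \<Rightarrow> complex"
  \<comment> \<open>\<open>R\<close> must be fixed before the Fell neighborhood is known, so it
    takes in the direct sums of all finite families of nontrivial characters.\<close>
  define R where "R = {rep_equiv G T `` {rep n \<theta>} | n \<theta>. \<forall>i<n. \<theta> i \<in> nontrivial_characters G T}"
  have rep: "rep n \<theta> \<in> unitary_reps G T" "\<not> has_invariant_vector G (rep n \<theta>)"
    if "\<forall>i<n. \<theta> i \<in> nontrivial_characters G T" for n \<theta>
    using that diagonal_rep_in_unitary_reps[OF \<iota> assms(1), of n \<theta>] diagonal_rep_no_invariant_vector[OF \<iota>, of n G \<theta>]
    unfolding rep_def nontrivial_characters_def by auto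
  have R_classes: "R \<subseteq> rep_classes G T"
    using rep(1) by (auto simp: R_def rep_classes_def intro!: quotientI)
  have R_inv: "\<forall>c\<in>R. \<forall>r\<in>c. \<not> has_invariant_vector G r"
    using rep(2) has_invariant_vector_rep_equiv unfolding R_def by blast
  have "openin (fell_topology G T (insert (trivial_class G T) R)) {trivial_class G T}"
    using property_T[unfolded property_T_def, THEN spec, THEN mp, THEN mp, OF R_classes R_inv] .
  then have "fell_open G T (insert (trivial_class G T) R) {trivial_class G T}"
    by (simp only: openin_fell_topology)
  then have "\<exists>k f C \<epsilon>. (\<forall>i<k. f i \<in> class_coeff_sums G (trivial_class G T :: ('g, 'h) rep set)) \<and>
      compactin T C \<and> 0 < \<epsilon> \<and> fell_nbhd G (insert (trivial_class G T) R) k f C \<epsilon> \<subseteq> {trivial_class G T}"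
    unfolding fell_open_def by (elim conjE ballE) (assumption, simp)
  then obtain k f C \<epsilon> where f: "\<forall>i<k. f i \<in> class_coeff_sums G (trivial_class G T :: ('g, 'h) rep set)"
    and C: "compactin T C" and \<epsilon>: "0 < \<epsilon>"
    and nbhd: "fell_nbhd G (insert (trivial_class G T) R) k f C \<epsilon> \<subseteq> {trivial_class G T}"
    by (elim exE conjE)
  have CG: "C \<subseteq> carrier G"
    using compactin_subset_topspace[OF C] topological_group.topspace_eq[OF assms(1)] by simp
  have "\<forall>i<k. \<exists>t\<ge>0. \<forall>x\<in>carrier G. f i x = complex_of_real t"
    using trivial_class_coeff_sum[OF f[rule_format]] by metis
  then obtain t where t: "\<And>i. i < k \<Longrightarrow> 0 \<le> t i" "\<And>i x. \<lbrakk>i < k; x \<in> carrier G\<rbrakk> \<Longrightarrow> f i x = complex_of_real (t i)"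
    by metis
  \<comment> \<open>One accuracy for all the constants \<open>t i\<close>, each at most their sum.
    The 1 makes the denominator positive and the final inequality strict.\<close>
  define \<delta> where "\<delta> = \<epsilon> / (1 + (\<Sum>i<k. t i))"
  have t_sum: "0 \<le> (\<Sum>i<k. t i)" using t(1) by (intro sum_nonneg) simp
  then have "0 < \<delta>" using \<epsilon> by (simp add: \<delta>_def)
  then obtain \<phi> where \<phi>: "\<phi> \<in> character_mixtures G T" "\<And>x. x \<in> C \<Longrightarrow> cmod (\<phi> x - 1) < \<delta>"
    using character_mixture_near_one[OF assms(1,2,5,3,4) C] by blast
  obtain n :: nat and a \<theta> where \<phi>_eq: "\<phi> = (\<lambda>x. \<Sum>i<n. complex_of_real (a i) * \<theta> i x)"
    and a: "\<And>i. i < n \<Longrightarrow> 0 \<le> a i" and "\<And>i. i < n \<Longrightarrow> \<theta> i \<in> nontrivial_characters G T"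
    using \<phi>(1) by (rule character_mixturesE) blast
  then have \<theta>: "\<forall>i<n. \<theta> i \<in> nontrivial_characters G T" by blast
  define c where "c = rep_equiv G T `` {rep n \<theta>}"
  have "c \<in> R" using \<theta> unfolding R_def c_def by blast
  have in_c: "rep n \<theta> \<in> c" unfolding c_def using rep_equiv_refl[OF rep(1)[OF \<theta>]] by simp
  define g where "g i = (\<lambda>x\<in>carrier G. complex_of_real (t i) * \<phi> x)" for i
  have "g i \<in> class_coeff_sums G c" if "i < k" for i
    using diagonal_rep_coefficient[where a = a and G = G and \<theta> = \<theta>, OF \<iota> t(1)[OF that] a] in_c
    unfolding class_coeff_sums_def g_def \<phi>_eq rep_def by (intro UN_I) simp_all
  moreover have "cmod (f i x - g i x) < \<epsilon>" if "x \<in> C" "i < k" for x i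
  proof -
    have x: "x \<in> carrier G" using that CG by auto
    have "f i x - g i x = - (complex_of_real (t i) * (\<phi> x - 1))"
      using t(2)[OF that(2) x] x by (simp add: g_def algebra_simps)
    then have "cmod (f i x - g i x) = t i * cmod (\<phi> x - 1)"
      using t(1)[OF that(2)] by (simp add: norm_mult)
    also have "\<dots> \<le> t i * \<delta>"
      using t(1)[OF that(2)] \<phi>(2)[OF that(1)] by (intro mult_left_mono) auto
    also have "\<dots> \<le> (\<Sum>i<k. t i) * \<delta>"
      using t(1) that(2) \<open>0 < \<delta>\<close> by (intro mult_right_mono member_le_sum) auto
    also have "\<dots> < \<epsilon>" using t_sum \<epsilon> by (simp add: \<delta>_def field_simps)
    finally show ?thesis .
  qed
  ultimately have "c \<in> fell_nbhd G (insert (trivial_class G T) R) k f C \<epsilon>"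
    using \<open>c \<in> R\<close> unfolding fell_nbhd_def by (auto intro!: exI[of _ g])
  then have "c = trivial_class G T" using nbhd by blast
  \<comment> \<open>\<open>rep n \<theta>\<close> would now act trivially on a line, whose spanning
    vector is nonzero and fixed.\<close>
  then have "has_invariant_vector G (rep n \<theta>)"
    using in_c by (auto simp: trivial_class_def rep_def simp del: coordinate_space_simps)
  then show False using rep(2)[OF \<theta>] by blast
qed

end
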